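(* Let $(F_{1,n},F_{2,n},\dots,F_{t,n})$ be a sequence of positive tuples of flags in $\mathbb{R}^d$ whose ultralimit is a positive tuple of flags $(F_1,\dots,F_t)$ in $\mathbb{F}^d$. Let $\mathcal{A}_1,\mathcal{A}_2,\mathcal{A}_3$ be the apartments in $\mathcal{B}_d$ corresponding to pairs of flags $(F_{i_1},F_{j_1})$, $(F_{i_2},F_{j_2})$, $(F_{i_3},F_{j_3})$ respectively. If $\mathcal{A}_2$ combinatorially separates $\mathcal{A}_1$ and $\mathcal{A}_3$, then $$\mathcal{A}_1\cap\mathcal{A}_3=\mathcal{A}_1\cap\mathcal{A}_2\cap\mathcal{A}_3.$$
   Context: **Combinatorial separation.** $\mathcal{A}_{i_2j_2}$ combinatorially separates $\mathcal{A}_{i_1j_1}$ and $\mathcal{A}_{i_3j_3}$ if, up to a cyclic permutation of the indices of $(F_1,\dots,F_t)$, $1\le i_1\le i_2\le i_3<j_3\le j_2\le j_1\le t$. **The field $\mathbb{F}$.** Fix a non-principal ultrafilter $\omega$ on $\mathbb{N}$ and a real sequence $\lambda_n\ge 1$ with $\lambda_n\to\infty$. $\mathbb{F}$ is the set of real sequences $(x_n)$ with $\lim_\omega|x_n|^{1/\lambda_n}<\infty$, modulo $(x_n)\sim(y_n)$ iff $\lim_\omega|x_n-y_n|^{1/\lambda_n}=0$; it is a field under termwise operations. The class of $(x_n)$ is denoted $\operatorname{ulim}x_n$. The valuation is $v(x)=-\lim_\omega\log|x_n|^{1/\lambda_n}\in\mathbb{R}\cup\{\infty\}$, and $|x|_v=e^{-v(x)}$.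 $\mathbb{F}$ is ordered by $[x_n]\ge[y_n]$ if (for suitable representatives) $x_n\ge y_n$ for $\omega$-almost every $n$; $\mathbb{F}_{\ge0}=\{x\ge0\}$, $\mathbb{F}_{>0}=\mathbb{F}_{\ge0}\setminus\{0\}$. A sequence of vectors in $\mathbb{R}^d$ whose coordinates define elements of $\mathbb{F}$ has as ultralimit the vector of ultralimits of the coordinates. **Flags and their invariants.** A flag $F$ in $K^d$ ($K=\mathbb{R}$ or $\mathbb{F}$) is a chain $0=F^{(0)}\subset F^{(1)}\subset\dots\subset F^{(d)}=K^d$ of subspaces with $\dim F^{(i)}=i$. A tuple $(F_1,\dots,F_t)$ of flags has the maximum span property if $\dim(F_1^{(a_1)}+\dots+F_t^{(a_t)})=\min\{a_1+\dots+a_t,d\}$ for all integers $0\le a_1,\dots,a_t\le d$. For flags in $\mathbb{R}^d$ with the maximum span property let $e^{(i)}$ be any non-zero element of $\bigwedge^iE^{(i)}$ (similarly for $F,G,H$) and identify $\bigwedge^d\mathbb{R}^d\cong\mathbb{R}$. Triple ratios ($a,b,c\ge1$, $a+b+c=d$): $$X_{a,b,c}(E,F,G)=\frac{e^{(a-1)}\wedge f^{(b)}\wedge g^{(c+1)}}{e^{(a+1)}\wedge f^{(b)}\wedge g^{(c-1)}}\cdot\frac{e^{(a)}\wedge f^{(b+1)}\wedge g^{(c-1)}}{e^{(a)}\wedge f^{(b-1)}\wedge g^{(c+1)}}\cdot\frac{e^{(a+1)}\wedge f^{(b-1)}\wedge g^{(c)}}{e^{(a-1)}\wedge f^{(b+1)}\wedge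 g^{(c)}}.$$ Double ratios ($0<s<d$): $$Z_s(E,F,G,H)=-\frac{e^{(s)}\wedge g^{(d-s-1)}\wedge f^{(1)}}{e^{(s)}\wedge g^{(d-s-1)}\wedge h^{(1)}}\cdot\frac{e^{(s-1)}\wedge g^{(d-s)}\wedge h^{(1)}}{e^{(s-1)}\wedge g^{(d-s)}\wedge f^{(1)}}.$$ **Positivity.** Let $\mathscr{P}_t$ be the convex polygon with vertices $v_1,\dots,v_t$ in this cyclic order, and let $\mathscr{T}$ be an oriented triangulation of it (a triangulation with vertices $v_1,\dots,v_t$ and oriented edges). The Fock–Goncharov coordinates of a maximum span tuple $(F_1,\dots,F_t)$ with respect to $\mathscr{T}$ are the triple ratios $X_{a,b,c}(F_i,F_j,F_k)$ for the triangles $(v_i,v_j,v_k)$, $i<j<k$, of $\mathscr{T}$ and the double ratios $Z_s(F_i,F_j,F_k,F_l)$ for the internal oriented edges $(v_i,v_k)$ of $\mathscr{T}$, where the two triangles adjacent to the edge form the quadrilateral $(v_i,v_j,v_k,v_l)$ with vertices in this cyclic order. A tuple in $\mathbb{R}^d$ is positive if it has the maximum span property and its coordinates with respect to $\mathscr{T}$ are all positive; this does not depend on $\mathscr{T}$. **Ultralimits of flags.** The ultralimit of a sequence $F_n$ of flags in $\mathbb{R}^d$ is the (unique) flag $F$ in $\mathbb{F}^d$ for which there are bases $(v_{1,n},\dots,v_{d,n})$ of $\mathbb{R}^d$ and a basis $(v_1,\dots,v_d)$ of $\mathbb{F}^d$ with $\operatorname{ulim}v_{i,n}=v_i$, $F_n^{(i)}=\mathrm{Span}(v_{1,n},\dots,v_{i,n})$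 and $F^{(i)}=\mathrm{Span}(v_1,\dots,v_i)$. The ultralimit $(F_1,\dots,F_t)$ of a sequence of tuples is positive if it has the maximum span property and the sequences of Fock–Goncharov coordinates of $(F_{1,n},\dots,F_{t,n})$ with respect to $\mathscr{T}$ all define (non-zero, finite) elements of $\mathbb{F}_{>0}$; this does not depend on $\mathscr{T}$. **The building.** $\mathbb{A}^{d-1}=\{x\in\mathbb{R}^d:\sum x_i=1\}$. Let $V=(\mathbb{F}^d)^*$. An ultrametric norm on $V$ is $\eta\colon V\to\mathbb{R}$ with $\eta(w)=0$ iff $w=0$, $\eta(xw)=|x|_v\eta(w)$, $\eta(w+z)\le\max\{\eta(w),\eta(z)\}$. It is adapted to a basis $(e_1,\dots,e_d)$ if $\eta(\sum x_je_j)=\max_j|x_j|_v\eta(e_j)$, and adaptable if adapted to some basis. $\eta,\eta'$ are homothetic if $\eta(w)=\eta'(xw)$ for all $w$, for some $x\in\mathbb{F}\setminus\{0\}$. $\mathcal{B}_d$ is the set of homothety classes of adaptable norms. The apartment of a line decomposition of $V$ is the set of classes of norms adapted to a basis $(e_i)$ with $e_i$ spanning the lines of the decomposition. For two flags $E,G$ of a maximum span tuple in $\mathbb{F}^d$, the apartment corresponding to $(E,G)$ is that of the line decomposition $L_i=(E^{(d-i)}\oplus G^{(i-1)})^\perp$, $i=1,\dots,d$, of $V$, where $\perp$ denotes annihilator. *)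

theory Defs
  imports Complex_Main "HOL-Library.Extended_Real" "HOL-Library.FuncSet"
    "HOL-Analysis.Elementary_Topology"
    "Jordan_Normal_Form.VS_Connect"
begin

section \<open>The ordered valued field of an ultrafilter and a scaling sequence\<close>

text \<open>Throughout, \<open>\<omega>\<close> is the ultrafilter (as a filter on \<open>nat\<close>) and \<open>\<Lambda>\<close> is the
  scaling sequence. Because the field depends on both, it is a ring record rather than a type.\<close>

definition nonprincipal_ultrafilter :: "nat filter \<Rightarrow> bool" where
  "nonprincipal_ultrafilter \<omega> \<longleftrightarrow>
     \<omega> \<noteq> bot \<and>
     (\<forall>P. eventually P \<omega> \<or> eventually (\<lambda>n. \<not> P n) \<omega>) \<and>
     (\<forall>k. \<omega> \<noteq> principal {k})"

text \<open>Note that \<open>0 powr a = 0\<close>. The limit along an ultrafilter always exists in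
  \<open>[0, \<infinity>]\<close>, so it is finite exactly if there is a real limit.\<close>

definition moderate :: "nat filter \<Rightarrow> (nat \<Rightarrow> real) \<Rightarrow> (nat \<Rightarrow> real) \<Rightarrow> bool" where
  "moderate \<omega> \<Lambda> x \<longleftrightarrow> (\<exists>l::real. ((\<lambda>n. \<bar>x n\<bar> powr (1 / \<Lambda> n)) \<longlongrightarrow> l) \<omega>)"

definition asymp_rel ::
  "nat filter \<Rightarrow> (nat \<Rightarrow> real) \<Rightarrow> ((nat \<Rightarrow> real) \<times> (nat \<Rightarrow> real)) set" where
  "asymp_rel \<omega> \<Lambda> =
     {(x, y). moderate \<omega> \<Lambda> x \<and> moderate \<omega> \<Lambda> y \<and>
              ((\<lambda>n. \<bar>x n - y n\<bar> powr (1 / \<Lambda> n)) \<longlongrightarrow> 0) \<omega>}"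

type_synonym asymp = "(nat \<Rightarrow> real) set"

definition ulim :: "nat filter \<Rightarrow> (nat \<Rightarrow> real) \<Rightarrow> (nat \<Rightarrow> real) \<Rightarrow> asymp" where
  "ulim \<omega> \<Lambda> x = asymp_rel \<omega> \<Lambda> `` {x}"

definition asymp_rep :: "asymp \<Rightarrow> nat \<Rightarrow> real" where
  "asymp_rep A = (SOME x. x \<in> A)"

definition asymp_field :: "nat filter \<Rightarrow> (nat \<Rightarrow> real) \<Rightarrow> asymp ring" where
  "asymp_field \<omega> \<Lambda> =
     \<lparr> carrier = {x. moderate \<omega> \<Lambda> x} // asymp_rel \<omega> \<Lambda>,
       mult = (\<lambda>A B. ulim \<omega> \<Lambda> (\<lambda>n. asymp_rep A n * asymp_rep B n)),
       one = ulim \<omega> \<Lambda> (\<lambda>n. 1),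
       zero = ulim \<omega> \<Lambda> (\<lambda>n. 0),
       add = (\<lambda>A B. ulim \<omega> \<Lambda> (\<lambda>n. asymp_rep A n + asymp_rep B n)) \<rparr>"

locale asymp_scale =
  fixes \<omega> :: "nat filter" and \<Lambda> :: "nat \<Rightarrow> real"
  assumes ultrafilter_omega: "nonprincipal_ultrafilter \<omega>" and scale_ge_1: "\<And>n. 1 \<le> \<Lambda> n"
begin

abbreviation N where "N x n \<equiv> \<bar>x n\<bar> powr (1 / \<Lambda> n)"

lemma omega_nontrivial: "\<omega> \<noteq> bot" using ultrafilter_omega by (simp add: nonprincipal_ultrafilter_def)

lemma ultrafilter_cases: "eventually P \<omega> \<or> eventually (\<lambda>n. \<not> P n) \<omega>"
  using ultrafilter_omega by (simp add: nonprincipal_ultrafilter_def)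

lemma bounded_limit_exists: assumes "eventually (\<lambda>n. \<bar>f n\<bar> \<le> (B::real)) \<omega>" shows "\<exists>l. (f \<longlongrightarrow> l) \<omega>"
proof -
  have "compact {-B..B}" by simp
  moreover have "filtermap f \<omega> \<le> principal {-B..B}"
    using assms by (simp add: le_principal eventually_filtermap abs_le_iff) (auto elim: eventually_mono)
  moreover have "filtermap f \<omega> \<noteq> bot" using omega_nontrivial by (simp add: filtermap_bot_iff)
  ultimately obtain l where l: "inf (nhds l) (filtermap f \<omega>) \<noteq> bot"
    using compact_filter[THEN iffD1, rule_format, of "{-B..B}" "filtermap f \<omega>"] by (auto simp: le_principal)
  have "(f \<longlongrightarrow> l) \<omega>"
  proof (rule topological_tendstoI, rule ccontr)
    fix S assume S: "open S" "l \<in> S" "\<not> eventually (\<lambda>n. f n \<in> S) \<omega>"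
    then have "eventually (\<lambda>n. f n \<notin> S) \<omega>" using ultrafilter_cases[of "\<lambda>n. f n \<in> S"] by auto
    then have "eventually (\<lambda>y. y \<notin> S) (filtermap f \<omega>)" by (simp add: eventually_filtermap)
    moreover have "eventually (\<lambda>y. y \<in> S) (nhds l)" using S by (auto simp: eventually_nhds)
    ultimately have "eventually (\<lambda>y. False) (inf (nhds l) (filtermap f \<omega>))"
      by (subst eventually_inf) blast
    then show False using l by (simp add: eventually_False)
  qed
  then show ?thesis ..
qed

lemma N_mult: "N (\<lambda>n. x n * y n) n = N x n * N y n"
  by (simp add: abs_mult powr_mult)

lemma N_add: "N (\<lambda>n. x n + y n) n \<le> 2 * (N x n + N y n)"
proof -
  have p: "0 \<le> 1 / \<Lambda> n" "1 / \<Lambda> n \<le> 1" using scale_ge_1[of n] by auto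
  have "N (\<lambda>n. x n + y n) n \<le> (2 * max \<bar>x n\<bar> \<bar>y n\<bar>) powr (1 / \<Lambda> n)"
    by (rule powr_mono2) (use p in auto)
  also have "\<dots> = 2 powr (1 / \<Lambda> n) * max \<bar>x n\<bar> \<bar>y n\<bar> powr (1 / \<Lambda> n)"
    by (simp add: powr_mult)
  also have "\<dots> \<le> 2 * (N x n + N y n)"
  proof (rule mult_mono)
    show "2 powr (1 / \<Lambda> n) \<le> 2" using powr_mono[of "1 / \<Lambda> n" 1 2] p by simp
    show "max \<bar>x n\<bar> \<bar>y n\<bar> powr (1 / \<Lambda> n) \<le> N x n + N y n" by (auto simp: max_def)
  qed auto
  finally show ?thesis .
qed

abbreviation null where "null x \<equiv> (N x \<longlongrightarrow> 0) \<omega>"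

lemma moderateI: assumes "eventually (\<lambda>n. N x n \<le> B) \<omega>" shows "moderate \<omega> \<Lambda> x"
  unfolding moderate_def by (rule bounded_limit_exists[of _ B]) (use assms in simp)

lemma moderateD: assumes "moderate \<omega> \<Lambda> x" shows "\<exists>B. eventually (\<lambda>n. N x n \<le> B) \<omega>"
proof -
  obtain l where "(N x \<longlongrightarrow> l) \<omega>" using assms by (auto simp: moderate_def)
  then have "eventually (\<lambda>n. N x n < l + 1) \<omega>" by (rule order_tendstoD) simp
  then show ?thesis by (intro exI[of _ "l+1"]) (auto elim: eventually_mono)
qed

lemma moderate_add: "moderate \<omega> \<Lambda> x \<Longrightarrow> moderate \<omega> \<Lambda> y \<Longrightarrow> moderate \<omega> \<Lambda> (\<lambda>n. x n + y n)"
proof -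
  assume "moderate \<omega> \<Lambda> x" "moderate \<omega> \<Lambda> y"
  then obtain A B where "eventually (\<lambda>n. N x n \<le> A) \<omega>" "eventually (\<lambda>n. N y n \<le> B) \<omega>"
    using moderateD by blast
  then have "eventually (\<lambda>n. N (\<lambda>n. x n + y n) n \<le> 2 * (A + B)) \<omega>"
  proof eventually_elim
    case (elim n) have "2 * (N x n + N y n) \<le> 2 * (A + B)" using elim by simp
    with N_add[of x n y] show ?case by (rule order_trans)
  qed
  then show ?thesis by (rule moderateI)
qed

lemma moderate_mult: "moderate \<omega> \<Lambda> x \<Longrightarrow> moderate \<omega> \<Lambda> y \<Longrightarrow> moderate \<omega> \<Lambda> (\<lambda>n. x n * y n)"
  unfolding moderate_def N_mult
proof (elim exE)
  fix l m assume "(N x \<longlongrightarrow> l) \<omega>" "(N y \<longlongrightarrow> m) \<omega>"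
  from tendsto_mult[OF this] show "\<exists>l. ((\<lambda>n. N x n * N y n) \<longlongrightarrow> l) \<omega>" ..
qed

lemma moderate_minus: "moderate \<omega> \<Lambda> x \<Longrightarrow> moderate \<omega> \<Lambda> (\<lambda>n. - x n)"
  by (simp add: moderate_def)

lemma moderate_const: "moderate \<omega> \<Lambda> (\<lambda>n. c)"
proof (rule moderateI)
  have "\<bar>c\<bar> powr (1 / \<Lambda> n) \<le> max 1 \<bar>c\<bar>" for n
  proof -
    have p: "0 \<le> 1 / \<Lambda> n" "1 / \<Lambda> n \<le> 1" using scale_ge_1[of n] by auto
    have "\<bar>c\<bar> powr (1 / \<Lambda> n) \<le> max 1 \<bar>c\<bar> powr (1 / \<Lambda> n)" by (rule powr_mono2) (use p in auto)
    also have "\<dots> \<le> max 1 \<bar>c\<bar> powr 1" by (rule powr_mono) (use p in auto)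
    finally show ?thesis by simp
  qed
  then show "eventually (\<lambda>n. \<bar>c\<bar> powr (1 / \<Lambda> n) \<le> max 1 \<bar>c\<bar>) \<omega>" by simp
qed

lemma null_add: assumes "null x" "null y" shows "null (\<lambda>n. x n + y n)"
proof (rule tendsto_sandwich[of "\<lambda>_. 0" _ _ "\<lambda>n. 2 * (N x n + N y n)"])
  show "eventually (\<lambda>n. N (\<lambda>n. x n + y n) n \<le> 2 * (N x n + N y n)) \<omega>" using N_add by (intro always_eventually allI)
  show "((\<lambda>n. 2 * (N x n + N y n)) \<longlongrightarrow> 0) \<omega>"
    using tendsto_mult[OF tendsto_const[of 2] tendsto_add[OF assms]] by simp
qed auto

lemma null_mult: assumes "null x" "moderate \<omega> \<Lambda> y" shows "null (\<lambda>n. x n * y n)"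
proof -
  obtain l where "(N y \<longlongrightarrow> l) \<omega>" using assms by (auto simp: moderate_def)
  then show ?thesis unfolding N_mult using tendsto_mult[OF assms(1), of "N y" l] by simp
qed

lemma null_minus: "null x \<Longrightarrow> null (\<lambda>n. - x n)" by simp

lemma equiv_asymp_rel: "equiv {x. moderate \<omega> \<Lambda> x} (asymp_rel \<omega> \<Lambda>)"
proof (rule equivI)
  show "asymp_rel \<omega> \<Lambda> \<subseteq> {x. moderate \<omega> \<Lambda> x} \<times> {x. moderate \<omega> \<Lambda> x}"
    by (auto simp: asymp_rel_def)
  show "refl_on {x. moderate \<omega> \<Lambda> x} (asymp_rel \<omega> \<Lambda>)"
    by (auto simp: refl_on_def asymp_rel_def)
  show "sym (asymp_rel \<omega> \<Lambda>)" by (auto simp: sym_def asymp_rel_def abs_minus_commute)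
  show "trans (asymp_rel \<omega> \<Lambda>)"
  proof (rule transI)
    fix x y z assume "(x, y) \<in> asymp_rel \<omega> \<Lambda>" "(y, z) \<in> asymp_rel \<omega> \<Lambda>"
    then show "(x, z) \<in> asymp_rel \<omega> \<Lambda>"
      using null_add[of "\<lambda>n. x n - y n" "\<lambda>n. y n - z n"] by (auto simp: asymp_rel_def)
  qed
qed

abbreviation K where "K \<equiv> asymp_field \<omega> \<Lambda>"

lemma carrier_cases: assumes "A \<in> carrier K" obtains x where "moderate \<omega> \<Lambda> x" "A = ulim \<omega> \<Lambda> x"
  using assms by (auto simp: asymp_field_def ulim_def elim!: quotientE)

lemma ulim_carrier[simp]: "moderate \<omega> \<Lambda> x \<Longrightarrow> ulim \<omega> \<Lambda> x \<in> carrier K"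
  by (auto simp: asymp_field_def ulim_def intro: quotientI)

lemma ulim_eq_iff: "moderate \<omega> \<Lambda> x \<Longrightarrow> moderate \<omega> \<Lambda> y \<Longrightarrow>
   ulim \<omega> \<Lambda> x = ulim \<omega> \<Lambda> y \<longleftrightarrow> null (\<lambda>n. x n - y n)"
  unfolding ulim_def by (subst eq_equiv_class_iff[OF equiv_asymp_rel]) (auto simp: asymp_rel_def)

lemma asymp_rep_ulim: assumes "moderate \<omega> \<Lambda> x"
  shows "moderate \<omega> \<Lambda> (asymp_rep (ulim \<omega> \<Lambda> x))" "null (\<lambda>n. asymp_rep (ulim \<omega> \<Lambda> x) n - x n)"
proof -
  have "x \<in> ulim \<omega> \<Lambda> x" using equiv_class_self[OF equiv_asymp_rel] assms by (auto simp: ulim_def)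
  then have "asymp_rep (ulim \<omega> \<Lambda> x) \<in> ulim \<omega> \<Lambda> x" unfolding asymp_rep_def by (rule someI[of "\<lambda>z. z \<in> ulim \<omega> \<Lambda> x"])
  then have "(x, asymp_rep (ulim \<omega> \<Lambda> x)) \<in> asymp_rel \<omega> \<Lambda>" by (simp add: ulim_def)
  then show "moderate \<omega> \<Lambda> (asymp_rep (ulim \<omega> \<Lambda> x))" "null (\<lambda>n. asymp_rep (ulim \<omega> \<Lambda> x) n - x n)"
    by (auto simp: asymp_rel_def abs_minus_commute)
qed

lemma add_ulim: assumes "moderate \<omega> \<Lambda> x" "moderate \<omega> \<Lambda> y"
  shows "ulim \<omega> \<Lambda> x \<oplus>\<^bsub>K\<^esub> ulim \<omega> \<Lambda> y = ulim \<omega> \<Lambda> (\<lambda>n. x n + y n)"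
proof -
  have "null (\<lambda>n. (asymp_rep (ulim \<omega> \<Lambda> x) n - x n) + (asymp_rep (ulim \<omega> \<Lambda> y) n - y n))"
    by (intro null_add asymp_rep_ulim assms)
  then show ?thesis using assms asymp_rep_ulim unfolding asymp_field_def
    by (simp add: ulim_eq_iff moderate_add algebra_simps)
qed

lemma mult_ulim: assumes "moderate \<omega> \<Lambda> x" "moderate \<omega> \<Lambda> y"
  shows "ulim \<omega> \<Lambda> x \<otimes>\<^bsub>K\<^esub> ulim \<omega> \<Lambda> y = ulim \<omega> \<Lambda> (\<lambda>n. x n * y n)"
proof -
  let ?a = "asymp_rep (ulim \<omega> \<Lambda> x)" and ?b = "asymp_rep (ulim \<omega> \<Lambda> y)"
  have "null (\<lambda>n. (?a n - x n) * ?b n + (?b n - y n) * x n)"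
    by (intro null_add null_mult asymp_rep_ulim assms)
  then show ?thesis using assms asymp_rep_ulim unfolding asymp_field_def
    by (simp add: ulim_eq_iff moderate_mult algebra_simps)
qed

lemma one_K: "\<one>\<^bsub>K\<^esub> = ulim \<omega> \<Lambda> (\<lambda>n. 1)" and zero_K: "\<zero>\<^bsub>K\<^esub> = ulim \<omega> \<Lambda> (\<lambda>n. 0)"
  by (auto simp: asymp_field_def)

lemmas field_simps_ulim = one_K zero_K add_ulim mult_ulim moderate_add moderate_mult moderate_const moderate_minus

lemma field_asymp_field: "field K"
proof (rule cring.cring_fieldI2)
  show "cring K"
  proof (rule cringI)
    show "abelian_group K"
    proof (rule abelian_groupI)
      fix A assume "A \<in> carrier K" then obtain x where x: "moderate \<omega> \<Lambda> x" "A = ulim \<omega> \<Lambda> x" by (rule carrier_cases)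
      show "\<exists>y\<in>carrier K. y \<oplus>\<^bsub>K\<^esub> A = \<zero>\<^bsub>K\<^esub>"
        by (rule bexI[of _ "ulim \<omega> \<Lambda> (\<lambda>n. - x n)"]) (use x in \<open>auto simp: field_simps_ulim\<close>)
    qed (auto elim!: carrier_cases simp: field_simps_ulim algebra_simps)
    show "comm_monoid K"
      by (rule comm_monoidI) (auto elim!: carrier_cases simp: field_simps_ulim algebra_simps)
  qed (auto elim!: carrier_cases simp: field_simps_ulim algebra_simps)
  show "\<zero>\<^bsub>K\<^esub> \<noteq> \<one>\<^bsub>K\<^esub>"
  proof
    assume "\<zero>\<^bsub>K\<^esub> = \<one>\<^bsub>K\<^esub>"
    then have "null (\<lambda>n. 0 - 1)" by (simp add: field_simps_ulim ulim_eq_iff)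
    then have "((\<lambda>n. 1::real) \<longlongrightarrow> 0) \<omega>" by simp
    then show False using omega_nontrivial by (simp add: tendsto_const_iff)
  qed
  fix A assume A: "A \<in> carrier K" "A \<noteq> \<zero>\<^bsub>K\<^esub>"
  then obtain x where x: "moderate \<omega> \<Lambda> x" "A = ulim \<omega> \<Lambda> x" by (blast elim: carrier_cases)
  obtain l where l: "(N x \<longlongrightarrow> l) \<omega>" using x by (auto simp: moderate_def)
  have "l \<noteq> 0" using A x l by (auto simp: field_simps_ulim ulim_eq_iff)
  have inv: "((\<lambda>n. N (\<lambda>n. inverse (x n)) n) \<longlongrightarrow> inverse l) \<omega>"
    using tendsto_inverse[OF l \<open>l \<noteq> 0\<close>] by (simp add: powr_def abs_inverse ln_inverse exp_minus)
      (auto simp: if_distrib powr_def ln_inverse exp_minus cong: if_cong)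
  then have im: "moderate \<omega> \<Lambda> (\<lambda>n. inverse (x n))" by (auto simp: moderate_def)
  have "eventually (\<lambda>n. N x n \<noteq> 0) \<omega>" using tendsto_imp_eventually_ne[OF l \<open>l \<noteq> 0\<close>] .
  then have "eventually (\<lambda>n. N (\<lambda>n. x n * inverse (x n) - 1) n = 0) \<omega>" by eventually_elim auto
  then have "null (\<lambda>n. x n * inverse (x n) - 1)" by (rule tendsto_eventually)
  then show "\<exists>b\<in>carrier K. A \<otimes>\<^bsub>K\<^esub> b = \<one>\<^bsub>K\<^esub>"
    by (intro bexI[of _ "ulim \<omega> \<Lambda> (\<lambda>n. inverse (x n))"]) (use x im in \<open>auto simp: field_simps_ulim ulim_eq_iff\<close>)
qed

end

definition ext_ln :: "real \<Rightarrow> ereal" where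
  "ext_ln y = (if y = 0 then - \<infinity> else ereal (ln y))"

definition asymp_val :: "nat filter \<Rightarrow> (nat \<Rightarrow> real) \<Rightarrow> asymp \<Rightarrow> ereal" where
  "asymp_val \<omega> \<Lambda> A = - Lim \<omega> (\<lambda>n. ext_ln (\<bar>asymp_rep A n\<bar> powr (1 / \<Lambda> n)))"

text \<open>The absolute value \<open>exp (- v)\<close>, with \<open>exp (- \<infinity>) = 0\<close>.\<close>

definition asymp_abs :: "nat filter \<Rightarrow> (nat \<Rightarrow> real) \<Rightarrow> asymp \<Rightarrow> real" where
  "asymp_abs \<omega> \<Lambda> A =
     (if asymp_val \<omega> \<Lambda> A = \<infinity> then 0 else exp (- real_of_ereal (asymp_val \<omega> \<Lambda> A)))"

definition asymp_le :: "nat filter \<Rightarrow> asymp \<Rightarrow> asymp \<Rightarrow> bool" where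
  "asymp_le \<omega> A B \<longleftrightarrow> (\<exists>a\<in>A. \<exists>b\<in>B. eventually (\<lambda>n. a n \<le> b n) \<omega>)"

definition asymp_nonneg :: "nat filter \<Rightarrow> (nat \<Rightarrow> real) \<Rightarrow> asymp set" where
  "asymp_nonneg \<omega> \<Lambda> =
     {A \<in> carrier (asymp_field \<omega> \<Lambda>). asymp_le \<omega> \<zero>\<^bsub>asymp_field \<omega> \<Lambda>\<^esub> A}"

definition asymp_pos :: "nat filter \<Rightarrow> (nat \<Rightarrow> real) \<Rightarrow> asymp set" where
  "asymp_pos \<omega> \<Lambda> = asymp_nonneg \<omega> \<Lambda> - {\<zero>\<^bsub>asymp_field \<omega> \<Lambda>\<^esub>}"


section \<open>Vector spaces and flags\<close>

text \<open>The space \<open>K\<^sup>d\<close> over a field record \<open>K\<close>. For \<open>K = \<real>\<close> the field record is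
  \<^term>\<open>class_ring :: real ring\<close>. Vector components are indexed from \<open>0\<close>, whereas bases and
  tuples of flags are indexed from \<open>1\<close>.\<close>

definition coord_space :: "('a, 'm) ring_scheme \<Rightarrow> nat \<Rightarrow> ('a, 'a vec) module" where
  "coord_space K d =
     \<lparr> carrier = {v \<in> carrier_vec d. \<forall>i<d. v $ i \<in> carrier K},
       mult = undefined,
       one = undefined,
       zero = vec d (\<lambda>i. \<zero>\<^bsub>K\<^esub>),
       add = (\<lambda>u v. vec d (\<lambda>i. u $ i \<oplus>\<^bsub>K\<^esub> v $ i)),
       smult = (\<lambda>a v. vec d (\<lambda>i. a \<otimes>\<^bsub>K\<^esub> v $ i)) \<rparr>"

definition dual_space ::
  "('a, 'm) ring_scheme \<Rightarrow> ('a, 'b, 'n) module_scheme \<Rightarrow> ('a, 'b \<Rightarrow> 'a) module" where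
  "dual_space K V =
     \<lparr> carrier = {\<phi> \<in> carrier V \<rightarrow>\<^sub>E carrier K.
         (\<forall>u\<in>carrier V. \<forall>w\<in>carrier V. \<phi> (u \<oplus>\<^bsub>V\<^esub> w) = \<phi> u \<oplus>\<^bsub>K\<^esub> \<phi> w) \<and>
         (\<forall>a\<in>carrier K. \<forall>u\<in>carrier V. \<phi> (a \<odot>\<^bsub>V\<^esub> u) = a \<otimes>\<^bsub>K\<^esub> \<phi> u)},
       mult = undefined,
       one = undefined,
       zero = (\<lambda>u\<in>carrier V. \<zero>\<^bsub>K\<^esub>),
       add = (\<lambda>\<phi> \<psi>. \<lambda>u\<in>carrier V. \<phi> u \<oplus>\<^bsub>K\<^esub> \<psi> u),
       smult = (\<lambda>a \<phi>. \<lambda>u\<in>carrier V. a \<otimes>\<^bsub>K\<^esub> \<phi> u) \<rparr>"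

lemma vectorspace_coord_space: assumes "field K" shows "vectorspace K (coord_space K d)"
proof -
  interpret field K by fact
  show ?thesis
  proof (intro vectorspace.intro module.intro assms)
    show "abelian_group (coord_space K d)"
    proof (rule abelian_groupI)
      fix x assume "x \<in> carrier (coord_space K d)"
      then show "\<exists>y\<in>carrier (coord_space K d). y \<oplus>\<^bsub>coord_space K d\<^esub> x = \<zero>\<^bsub>coord_space K d\<^esub>"
        by (intro bexI[of _ "vec d (\<lambda>i. \<ominus>\<^bsub>K\<^esub> x $ i)"]) (auto simp: coord_space_def l_neg)
    qed (auto simp: coord_space_def a_ac)
    show "module_axioms K (coord_space K d)"
      by unfold_locales (auto simp: coord_space_def l_distr r_distr m_assoc)
  qed (rule is_cring)
qed

lemma vectorspace_dual_space: fixes K :: "('a,'m) ring_scheme" and V :: "('a,'b,'n) module_scheme" assumes "field K" "vectorspace K V" shows "vectorspace K (dual_space K V)"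
proof -
  interpret vectorspace K V by fact
  have e: "\<phi> = \<psi>" if "\<phi> \<in> extensional (carrier V)" "\<psi> \<in> extensional (carrier V)"
    "\<And>u. u \<in> carrier V \<Longrightarrow> \<phi> u = \<psi> u" for \<phi> \<psi> :: "'b \<Rightarrow> 'a" using that by (rule extensionalityI)
  show ?thesis
  proof (intro vectorspace.intro module.intro assms)
    show "abelian_group (dual_space K V)"
    proof (rule abelian_groupI)
      fix x assume "x \<in> carrier (dual_space K V)"
      then show "\<exists>y\<in>carrier (dual_space K V). y \<oplus>\<^bsub>dual_space K V\<^esub> x = \<zero>\<^bsub>dual_space K V\<^esub>"
        by (intro bexI[of _ "\<lambda>u\<in>carrier V. \<ominus>\<^bsub>K\<^esub> x u"])
          (auto simp: dual_space_def PiE_iff R.l_neg R.minus_add R.r_minus intro!: restrict_ext)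
    qed (auto simp: dual_space_def PiE_iff R.a_ac R.r_distr R.m_lcomm intro!: e cong: restrict_cong)
    show "module_axioms K (dual_space K V)"
      by unfold_locales (auto simp: dual_space_def PiE_iff R.l_distr R.r_distr R.m_ac intro!: e)
  qed (rule R.is_cring)
qed

definition annihilator ::
  "('a, 'm) ring_scheme \<Rightarrow> ('a, 'b, 'n) module_scheme \<Rightarrow> 'b set \<Rightarrow> ('b \<Rightarrow> 'a) set" where
  "annihilator K V W = {\<phi> \<in> carrier (dual_space K V). \<forall>w\<in>W. \<phi> w = \<zero>\<^bsub>K\<^esub>}"

definition indexed_basis ::
  "('a, 'm) ring_scheme \<Rightarrow> ('a, 'b, 'n) module_scheme \<Rightarrow> nat \<Rightarrow> (nat \<Rightarrow> 'b) \<Rightarrow> bool" where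
  "indexed_basis K V d e \<longleftrightarrow> inj_on e {1..d} \<and> vectorspace.basis K V (e ` {1..d})"

definition sum_of_subspaces ::
  "('a, 'b, 'n) module_scheme \<Rightarrow> 'i set \<Rightarrow> ('i \<Rightarrow> 'b set) \<Rightarrow> 'b set" where
  "sum_of_subspaces V I W = {finsum V x I | x. \<forall>i\<in>I. x i \<in> W i}"

text \<open>The value of a flag at \<open>i\<close> is its \<open>i\<close>-dimensional subspace; values at \<open>i > d\<close> are
  irrelevant.\<close>

type_synonym 'a flag = "nat \<Rightarrow> 'a vec set"

definition is_flag :: "('a, 'm) ring_scheme \<Rightarrow> nat \<Rightarrow> 'a flag \<Rightarrow> bool" where
  "is_flag K d F \<longleftrightarrow>
     (\<forall>i\<le>d. VectorSpace.subspace K (F i) (coord_space K d) \<and>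
            vectorspace.dim K ((coord_space K d)\<lparr>carrier := F i\<rparr>) = i) \<and>
     (\<forall>i<d. F i \<subseteq> F (Suc i)) \<and>
     F 0 = {\<zero>\<^bsub>coord_space K d\<^esub>} \<and> F d = carrier (coord_space K d)"

text \<open>A tuple \<open>(F\<^sub>1, \<dots>, F\<^sub>t)\<close> is a function on \<open>{1..t}\<close>.\<close>

definition maximum_span ::
  "('a, 'm) ring_scheme \<Rightarrow> nat \<Rightarrow> nat \<Rightarrow> (nat \<Rightarrow> 'a flag) \<Rightarrow> bool" where
  "maximum_span K d t F \<longleftrightarrow>
     (\<forall>a. (\<forall>i\<in>{1..t}. a i \<le> d) \<longrightarrow>
        vectorspace.dim K
          ((coord_space K d)\<lparr>carrier :=
              sum_of_subspaces (coord_space K d) {1..t} (\<lambda>i. F i (a i))\<rparr>)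
        = min (\<Sum>i\<in>{1..t}. a i) d)"


section \<open>Fock--Goncharov coordinates and positivity\<close>

text \<open>A non-zero element of the line \<open>\<And>\<^sup>i E\<^sup>(\<^sup>i\<^sup>)\<close> is given by a list
  \<open>[u\<^sub>1, \<dots>, u\<^sub>i]\<close> forming a basis of \<open>E\<^sup>(\<^sup>i\<^sup>)\<close>, which stands for
  \<open>u\<^sub>1 \<and> \<dots> \<and> u\<^sub>i\<close>; the wedge product is then concatenation, and \<open>\<And>\<^sup>d \<real>\<^sup>d\<close> is
  identified with \<open>\<real>\<close> by the determinant. In the ratios below every such element occurs equally
  often in numerators and denominators, so the choice is immaterial.\<close>

definition flag_wedge :: "nat \<Rightarrow> real flag \<Rightarrow> nat \<Rightarrow> real vec list" where
  "flag_wedge d E i =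
     (SOME us. length us = i \<and> distinct us \<and>
        vectorspace.basis class_ring ((coord_space class_ring d)\<lparr>carrier := E i\<rparr>) (set us))"

definition wedge3 ::
  "nat \<Rightarrow> real flag \<Rightarrow> nat \<Rightarrow> real flag \<Rightarrow> nat \<Rightarrow> real flag \<Rightarrow> nat \<Rightarrow> real" where
  "wedge3 d E a F b G c =
     det (mat_of_cols d (flag_wedge d E a @ flag_wedge d F b @ flag_wedge d G c))"

definition triple_ratio ::
  "nat \<Rightarrow> nat \<Rightarrow> nat \<Rightarrow> nat \<Rightarrow> real flag \<Rightarrow> real flag \<Rightarrow> real flag \<Rightarrow> real" where
  "triple_ratio d a b c E F G =
     wedge3 d E (a - 1) F b G (c + 1) / wedge3 d E (a + 1) F b G (c - 1) *
     (wedge3 d E a F (b + 1) G (c - 1) / wedge3 d E a F (b - 1) G (c + 1)) *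
     (wedge3 d E (a + 1) F (b - 1) G c / wedge3 d E (a - 1) F (b + 1) G c)"

definition double_ratio ::
  "nat \<Rightarrow> nat \<Rightarrow> real flag \<Rightarrow> real flag \<Rightarrow> real flag \<Rightarrow> real flag \<Rightarrow> real" where
  "double_ratio d s E F G H =
     - (wedge3 d E s G (d - s - 1) F 1 / wedge3 d E s G (d - s - 1) H 1) *
       (wedge3 d E (s - 1) G (d - s) H 1 / wedge3 d E (s - 1) G (d - s) F 1)"

definition cyclically_ordered :: "nat \<Rightarrow> nat \<Rightarrow> nat \<Rightarrow> nat \<Rightarrow> bool" where
  "cyclically_ordered i j k l \<longleftrightarrow>
     i < j \<and> j < k \<and> k < l \<or> j < k \<and> k < l \<and> l < i \<or>
     k < l \<and> l < i \<and> i < j \<or> l < i \<and> i < j \<and> j < k"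

definition chords_cross :: "nat \<Rightarrow> nat \<Rightarrow> nat \<Rightarrow> nat \<Rightarrow> bool" where
  "chords_cross i k j l \<longleftrightarrow> cyclically_ordered i j k l \<or> cyclically_ordered i l k j"

text \<open>A triangulation of the convex polygon with vertices \<open>1, \<dots>, t\<close>, without further
  vertices, is a maximal set of pairwise non-crossing chords. Maximality puts the sides of the
  polygon, which cross no chord, into the triangulation. Each edge is recorded with exactly one
  orientation.\<close>

definition oriented_triangulation :: "nat \<Rightarrow> (nat \<times> nat) set \<Rightarrow> bool" where
  "oriented_triangulation t T \<longleftrightarrow>
     (\<forall>(i, j)\<in>T. i \<in> {1..t} \<and> j \<in> {1..t} \<and> i \<noteq> j \<and> (j, i) \<notin> T) \<and>
     (\<forall>(i, k)\<in>T. \<forall>(j, l)\<in>T. \<not> chords_cross i k j l) \<and>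
     (\<forall>i\<in>{1..t}. \<forall>k\<in>{1..t}. i \<noteq> k \<and> (i, k) \<notin> T \<and> (k, i) \<notin> T \<longrightarrow>
        (\<exists>(j, l)\<in>T. chords_cross i k j l))"

definition is_edge :: "(nat \<times> nat) set \<Rightarrow> nat \<Rightarrow> nat \<Rightarrow> bool" where
  "is_edge T i j \<longleftrightarrow> (i, j) \<in> T \<or> (j, i) \<in> T"

definition is_triangle :: "(nat \<times> nat) set \<Rightarrow> nat \<Rightarrow> nat \<Rightarrow> nat \<Rightarrow> bool" where
  "is_triangle T i j k \<longleftrightarrow> is_edge T i j \<and> is_edge T j k \<and> is_edge T i k"

text \<open>The coordinates with respect to \<open>T\<close>, as functions of the tuple. An oriented edge
  \<open>(i, k)\<close> with a triangle on each side is automatically an internal one.\<close>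

definition fg_coordinates ::
  "nat \<Rightarrow> (nat \<times> nat) set \<Rightarrow> ((nat \<Rightarrow> real flag) \<Rightarrow> real) set" where
  "fg_coordinates d T =
     {\<lambda>F. triple_ratio d a b c (F i) (F j) (F k) | a b c i j k.
        1 \<le> a \<and> 1 \<le> b \<and> 1 \<le> c \<and> a + b + c = d \<and>
        i < j \<and> j < k \<and> is_triangle T i j k} \<union>
     {\<lambda>F. double_ratio d s (F i) (F j) (F k) (F l) | s i j k l.
        0 < s \<and> s < d \<and> (i, k) \<in> T \<and> cyclically_ordered i j k l \<and>
        is_triangle T i j k \<and> is_triangle T i k l}"

definition positive_tuple ::
  "nat \<Rightarrow> nat \<Rightarrow> (nat \<times> nat) set \<Rightarrow> (nat \<Rightarrow> real flag) \<Rightarrow> bool" where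
  "positive_tuple d t T F \<longleftrightarrow>
     (\<forall>i\<in>{1..t}. is_flag class_ring d (F i)) \<and>
     maximum_span class_ring d t F \<and>
     (\<forall>X\<in>fg_coordinates d T. 0 < X F)"


section \<open>Ultralimits of flags\<close>

definition is_flag_ulim ::
  "nat filter \<Rightarrow> (nat \<Rightarrow> real) \<Rightarrow> nat \<Rightarrow> (nat \<Rightarrow> real flag) \<Rightarrow> asymp flag \<Rightarrow> bool" where
  "is_flag_ulim \<omega> \<Lambda> d Fs F \<longleftrightarrow>
     (\<forall>n. is_flag class_ring d (Fs n)) \<and> is_flag (asymp_field \<omega> \<Lambda>) d F \<and>
     (\<exists>(vs :: nat \<Rightarrow> nat \<Rightarrow> real vec) (v :: nat \<Rightarrow> asymp vec).
        (\<forall>n. indexed_basis class_ring (coord_space class_ring d) d (\<lambda>i. vs i n)) \<and>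
        indexed_basis (asymp_field \<omega> \<Lambda>) (coord_space (asymp_field \<omega> \<Lambda>) d) d v \<and>
        (\<forall>i\<in>{1..d}. \<forall>m<d. moderate \<omega> \<Lambda> (\<lambda>n. vs i n $ m) \<and>
           ulim \<omega> \<Lambda> (\<lambda>n. vs i n $ m) = v i $ m) \<and>
        (\<forall>n. \<forall>i\<le>d. Fs n i =
           module.span class_ring (coord_space class_ring d) ((\<lambda>j. vs j n) ` {1..i})) \<and>
        (\<forall>i\<le>d. F i =
           module.span (asymp_field \<omega> \<Lambda>) (coord_space (asymp_field \<omega> \<Lambda>) d) (v ` {1..i})))"

definition ulim_positive ::
  "nat filter \<Rightarrow> (nat \<Rightarrow> real) \<Rightarrow> nat \<Rightarrow> nat \<Rightarrow> (nat \<times> nat) set \<Rightarrow>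
   (nat \<Rightarrow> nat \<Rightarrow> real flag) \<Rightarrow> (nat \<Rightarrow> asymp flag) \<Rightarrow> bool" where
  "ulim_positive \<omega> \<Lambda> d t T Fs F \<longleftrightarrow>
     maximum_span (asymp_field \<omega> \<Lambda>) d t F \<and>
     (\<forall>X\<in>fg_coordinates d T.
        moderate \<omega> \<Lambda> (\<lambda>n. X (Fs n)) \<and> ulim \<omega> \<Lambda> (\<lambda>n. X (Fs n)) \<in> asymp_pos \<omega> \<Lambda>)"


section \<open>The building and its apartments\<close>

abbreviation dual_coord_space ::
  "nat filter \<Rightarrow> (nat \<Rightarrow> real) \<Rightarrow> nat \<Rightarrow> (asymp, asymp vec \<Rightarrow> asymp) module" where
  "dual_coord_space \<omega> \<Lambda> d \<equiv>
     dual_space (asymp_field \<omega> \<Lambda>) (coord_space (asymp_field \<omega> \<Lambda>) d)"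

type_synonym norm_fun = "(asymp vec \<Rightarrow> asymp) \<Rightarrow> real"

definition ultrametric_norm :: "nat filter \<Rightarrow> (nat \<Rightarrow> real) \<Rightarrow> nat \<Rightarrow> norm_fun \<Rightarrow> bool" where
  "ultrametric_norm \<omega> \<Lambda> d \<eta> \<longleftrightarrow>
     (let V = dual_coord_space \<omega> \<Lambda> d in
        \<eta> \<in> extensional (carrier V) \<and>
        (\<forall>w\<in>carrier V. \<eta> w = 0 \<longleftrightarrow> w = \<zero>\<^bsub>V\<^esub>) \<and>
        (\<forall>x\<in>carrier (asymp_field \<omega> \<Lambda>). \<forall>w\<in>carrier V.
           \<eta> (x \<odot>\<^bsub>V\<^esub> w) = asymp_abs \<omega> \<Lambda> x * \<eta> w) \<and>
        (\<forall>w\<in>carrier V. \<forall>z\<in>carrier V. \<eta> (w \<oplus>\<^bsub>V\<^esub> z) \<le> max (\<eta> w) (\<eta> z)))"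

definition adapted ::
  "nat filter \<Rightarrow> (nat \<Rightarrow> real) \<Rightarrow> nat \<Rightarrow> (nat \<Rightarrow> asymp vec \<Rightarrow> asymp) \<Rightarrow> norm_fun \<Rightarrow> bool" where
  "adapted \<omega> \<Lambda> d e \<eta> \<longleftrightarrow>
     (let V = dual_coord_space \<omega> \<Lambda> d in
        ultrametric_norm \<omega> \<Lambda> d \<eta> \<and> indexed_basis (asymp_field \<omega> \<Lambda>) V d e \<and>
        (\<forall>x\<in>{1..d} \<rightarrow> carrier (asymp_field \<omega> \<Lambda>).
           \<eta> (\<Oplus>\<^bsub>V\<^esub>j\<in>{1..d}. x j \<odot>\<^bsub>V\<^esub> e j) =
           Max ((\<lambda>j. asymp_abs \<omega> \<Lambda> (x j) * \<eta> (e j)) ` {1..d})))"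

definition adaptable_norms :: "nat filter \<Rightarrow> (nat \<Rightarrow> real) \<Rightarrow> nat \<Rightarrow> norm_fun set" where
  "adaptable_norms \<omega> \<Lambda> d = {\<eta>. \<exists>e. adapted \<omega> \<Lambda> d e \<eta>}"

definition homothety_rel ::
  "nat filter \<Rightarrow> (nat \<Rightarrow> real) \<Rightarrow> nat \<Rightarrow> (norm_fun \<times> norm_fun) set" where
  "homothety_rel \<omega> \<Lambda> d =
     (let K = asymp_field \<omega> \<Lambda>; V = dual_coord_space \<omega> \<Lambda> d in
        {(\<eta>, \<eta>'). \<eta> \<in> adaptable_norms \<omega> \<Lambda> d \<and> \<eta>' \<in> adaptable_norms \<omega> \<Lambda> d \<and>
           (\<exists>x\<in>carrier K - {\<zero>\<^bsub>K\<^esub>}. \<forall>w\<in>carrier V. \<eta> w = \<eta>' (x \<odot>\<^bsub>V\<^esub> w))})"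

definition building :: "nat filter \<Rightarrow> (nat \<Rightarrow> real) \<Rightarrow> nat \<Rightarrow> norm_fun set set" where
  "building \<omega> \<Lambda> d = adaptable_norms \<omega> \<Lambda> d // homothety_rel \<omega> \<Lambda> d"

text \<open>The apartment of a line decomposition \<open>L\<^sub>1, \<dots>, L\<^sub>d\<close> of the dual space.\<close>

definition apartment ::
  "nat filter \<Rightarrow> (nat \<Rightarrow> real) \<Rightarrow> nat \<Rightarrow> (nat \<Rightarrow> (asymp vec \<Rightarrow> asymp) set) \<Rightarrow>
   norm_fun set set" where
  "apartment \<omega> \<Lambda> d L =
     {c \<in> building \<omega> \<Lambda> d. \<exists>\<eta>\<in>c. \<exists>e. adapted \<omega> \<Lambda> d e \<eta> \<and>
        (\<forall>i\<in>{1..d}.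
           module.span (asymp_field \<omega> \<Lambda>) (dual_coord_space \<omega> \<Lambda> d) {e i} = L i)}"

definition flag_pair_lines ::
  "nat filter \<Rightarrow> (nat \<Rightarrow> real) \<Rightarrow> nat \<Rightarrow> asymp flag \<Rightarrow> asymp flag \<Rightarrow>
   nat \<Rightarrow> (asymp vec \<Rightarrow> asymp) set" where
  "flag_pair_lines \<omega> \<Lambda> d E G i =
     (let K = asymp_field \<omega> \<Lambda>; U = coord_space K d in
        annihilator K U (module.submodule_sum U (E (d - i)) (G (i - 1))))"

definition flag_apartment ::
  "nat filter \<Rightarrow> (nat \<Rightarrow> real) \<Rightarrow> nat \<Rightarrow> asymp flag \<Rightarrow> asymp flag \<Rightarrow> norm_fun set set" where
  "flag_apartment \<omega> \<Lambda> d E G = apartment \<omega> \<Lambda> d (flag_pair_lines \<omega> \<Lambda> d E G)"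


section \<open>Combinatorial separation\<close>

definition cyclic_shift :: "nat \<Rightarrow> nat \<Rightarrow> nat \<Rightarrow> nat" where
  "cyclic_shift t c i = (i - 1 + c) mod t + 1"

text \<open>The apartment of the pair with indices \<open>(i2, j2)\<close> separates those of \<open>(i1, j1)\<close> and
  \<open>(i3, j3)\<close>.\<close>

definition combinatorially_separates ::
  "nat \<Rightarrow> nat \<times> nat \<Rightarrow> nat \<times> nat \<Rightarrow> nat \<times> nat \<Rightarrow> bool" where
  "combinatorially_separates t = (\<lambda>(i2, j2) (i1, j1) (i3, j3).
     {i1, j1, i2, j2, i3, j3} \<subseteq> {1..t} \<and>
     (\<exists>c. let \<sigma> = cyclic_shift t c in
        \<sigma> i1 \<le> \<sigma> i2 \<and> \<sigma> i2 \<le> \<sigma> i3 \<and> \<sigma> i3 < \<sigma> j3 \<and> \<sigma> j3 \<le> \<sigma> j2 \<and> \<sigma> j2 \<le> \<sigma> j1))"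

end

theory Submission
  imports Defs
begin

text \<open>The \<open>l\<close>-th line of the apartment of \<open>(F\<^sub>i, F\<^sub>j)\<close> is spanned by the functional
  \<open>y \<mapsto> f\<^sub>i\<^sup>(\<^sup>d\<^sup>-\<^sup>l\<^sup>) \<and> f\<^sub>j\<^sup>(\<^sup>l\<^sup>-\<^sup>1\<^sup>) \<and> y\<close>. Positivity makes it possible to choose signs of the generators
  \<open>f\<^sub>i\<^sup>(\<^sup>s\<^sup>)\<close> such that all \<open>f\<^sub>i\<^sup>(\<^sup>a\<^sup>) \<and> f\<^sub>j\<^sup>(\<^sup>b\<^sup>) \<and> f\<^sub>k\<^sup>(\<^sup>c\<^sup>)\<close> with \<open>i < j < k\<close> have the same sign:
  positive triple ratios give this for each triangle, positive double ratios make the choices on two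
  sides of an edge compatible, and the three-term Pluecker relations extend it to all triples. By the
  same relations, for \<open>i < j < k\<close> the functionals of \<open>(F\<^sub>i, F\<^sub>j)\<close> and of \<open>(F\<^sub>j, F\<^sub>k)\<close> are nonnegative
  combinations of those of \<open>(F\<^sub>i, F\<^sub>k)\<close>. If \<open>\<A>\<^sub>2\<close> separates \<open>\<A>\<^sub>1\<close> and \<open>\<A>\<^sub>3\<close>, their bases
  \<open>e\<^sub>1, e\<^sub>2, e\<^sub>3\<close> hence satisfy \<open>e\<^sub>2 = A e\<^sub>1\<close> and \<open>e\<^sub>3 = B e\<^sub>2\<close> with nonnegative matrices
  \<open>A\<close> and \<open>B\<close>.

  Let \<open>\<eta>\<close> be a norm adapted to \<open>e\<^sub>1\<close> and \<open>e\<^sub>3\<close>. There is no cancellation in \<open>B A\<close>, so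
  \<open>\<bar>B\<^sub>k\<^sub>m\<bar> \<eta>(e\<^sub>2\<^sub>m) \<le> max\<^sub>l \<bar>(B A)\<^sub>k\<^sub>l\<bar> \<eta>(e\<^sub>1\<^sub>l) = \<eta>(e\<^sub>3\<^sub>k)\<close>. For \<open>w = \<Sum> x\<^sub>m e\<^sub>2\<^sub>m = \<Sum> z\<^sub>k e\<^sub>3\<^sub>k\<close> this gives
  \<open>\<bar>x\<^sub>m\<bar> \<eta>(e\<^sub>2\<^sub>m) \<le> max\<^sub>k \<bar>z\<^sub>k\<bar> \<bar>B\<^sub>k\<^sub>m\<bar> \<eta>(e\<^sub>2\<^sub>m) \<le> max\<^sub>k \<bar>z\<^sub>k\<bar> \<eta>(e\<^sub>3\<^sub>k) = \<eta>(w)\<close>: the norm is adapted to \<open>e\<^sub>2\<close>.\<close>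

section \<open>Brackets\<close>

text \<open>Nonnegativity is arranged at each time \<open>n\<close> over the reals, while growth is
  tracked separately by \<open>moderate\<close> and \<open>null\<close>. The two meet in the
  coefficients of the changes of basis, which are quotients of brackets: maximum span at time
  \<open>n\<close> makes the denominators non-zero, and maximum span of the limit makes them
  non-null, so that the quotients define elements of the field. The orientations may vary
  arbitrarily with \<open>n\<close>, because growth sees only absolute values. The obstacle is
  coherence of signs. Twisting every orientation by \<open>s \<mapsto> \<mu> ^ s\<close> multiplies
  all brackets by the same \<open>\<mu> ^ d\<close>, and gluing two polygons along an edge uses
  exactly this freedom. A cyclic rotation of the indices is not neutral either: moving a block of
  \<open>a\<close> vectors past the other \<open>d - a\<close> costs
  \<open>(-1) ^ (a * (d - a))\<close>, which has to be absorbed into the orientations. Points of the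
  building are homothety classes. Membership in two apartments therefore first yields two norms and
  two systems of generators, and a single norm adapted to both chosen bases has to be
  produced.\<close>

definition brk :: "nat \<Rightarrow> real vec list \<Rightarrow> real" where
  "brk d us = det (mat_of_rows d us)"

text \<open>The cofactors along the row of \<open>x\<close> do not see that row, so the zero vector
  may stand in for \<open>x\<close> there. This leaves coefficients independent of \<open>x\<close>
  and exhibits linearity in one slot.\<close>

lemma brk_expand:
  assumes "length us + Suc (length ws) = d"
  shows "brk d (us @ x # ws) =
    (\<Sum>m<d. x $ m * cofactor (mat_of_rows d (us @ 0\<^sub>v d # ws)) (length us) m)"
proof -
  let ?A = "mat_of_rows d (us @ x # ws)"
  have A: "?A \<in> carrier_mat d d" using assms by (intro carrier_matI) simp_all
  have "det ?A = (\<Sum>m<d. ?A $$ (length us, m) * cofactor ?A (length us) m)"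
    by (rule laplace_expansion_row[OF A]) (use assms in simp)
  also have "\<dots> = (\<Sum>m<d. x $ m * cofactor (mat_of_rows d (us @ 0\<^sub>v d # ws)) (length us) m)"
  proof (rule sum.cong[OF refl])
    fix m assume m: "m \<in> {..<d}"
    have 1: "?A $$ (length us, m) = x $ m" using m assms by (simp add: mat_of_rows_index)
    have 2: "mat_delete ?A (length us) m = mat_delete (mat_of_rows d (us @ 0\<^sub>v d # ws)) (length us) m"
      using m assms by (intro eq_matI) (auto simp: mat_delete_def mat_of_rows_index nth_append)
    show "?A $$ (length us, m) * cofactor ?A (length us) m =
      x $ m * cofactor (mat_of_rows d (us @ 0\<^sub>v d # ws)) (length us) m"
      unfolding 1 cofactor_def 2 ..
  qed
  finally show ?thesis by (simp add: brk_def)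
qed

lemma brk_sum:
  assumes "length us + Suc (length ws) = d" "\<And>m. m < d \<Longrightarrow> x $ m = (\<Sum>j\<in>S. c j * y j $ m)"
  shows "brk d (us @ x # ws) = (\<Sum>j\<in>S. c j * brk d (us @ y j # ws))"
proof -
  let ?k = "\<lambda>m. cofactor (mat_of_rows d (us @ 0\<^sub>v d # ws)) (length us) m"
  have "brk d (us @ x # ws) = (\<Sum>m<d. \<Sum>j\<in>S. c j * (y j $ m * ?k m))"
    unfolding brk_expand[OF assms(1)] using assms(2)
    by (intro sum.cong refl) (simp add: sum_distrib_right mult.assoc)
  also have "\<dots> = (\<Sum>j\<in>S. c j * brk d (us @ y j # ws))"
    unfolding brk_expand[OF assms(1)] by (subst sum.swap) (simp add: sum_distrib_left)
  finally show ?thesis .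
qed

lemma brk_repeat:
  assumes "length us = d" "i < d" "j < d" "i \<noteq> j" "us ! i = us ! j"
  shows "brk d us = 0"
proof -
  let ?A = "mat_of_rows d us"
  have "row ?A i = row ?A j" using assms by (intro eq_vecI) (simp_all add: mat_of_rows_index)
  moreover have "?A \<in> carrier_mat d d" using assms by (intro carrier_matI) simp_all
  ultimately show ?thesis unfolding brk_def using det_identical_rows assms by blast
qed

lemma brk_notdistinct: "length us = d \<Longrightarrow> \<not> distinct us \<Longrightarrow> brk d us = 0"
  unfolding distinct_conv_nth using brk_repeat by blast

lemma brk_swap:
  assumes "length us + Suc (Suc (length ws)) = d"
  shows "brk d (us @ x # y # ws) = - brk d (us @ y # x # ws)"
proof -
  let ?A = "mat_of_rows d (us @ y # x # ws)" and ?k = "length us"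
  have A: "?A \<in> carrier_mat d d" using assms by (intro carrier_matI) simp_all
  have "mat_of_rows d (us @ x # y # ws) = swaprows ?k (Suc ?k) ?A"
    using assms by (intro eq_matI) (auto simp: mat_of_rows_index nth_append nth_Cons')
  then show ?thesis unfolding brk_def using det_swaprows[of ?k d "Suc ?k" ?A] A assms by simp
qed

lemma brk_move:
  assumes "length us + Suc (length vs) + length ws = d"
  shows "brk d (us @ x # vs @ ws) = (-1) ^ length vs * brk d (us @ vs @ x # ws)"
  using assms
proof (induction vs arbitrary: us)
  case (Cons v vs)
  have "brk d (us @ x # v # vs @ ws) = - brk d ((us @ [v]) @ x # vs @ ws)"
    using Cons.prems by (subst brk_swap) auto
  also have "\<dots> = - ((-1) ^ length vs * brk d ((us @ [v]) @ vs @ x # ws))"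
    using Cons.prems by (subst Cons.IH) auto
  finally show ?case by simp
qed simp

lemma brk_block_swap:
  assumes "length us + length vs + length ws = d"
  shows "brk d (us @ vs @ ws) = (-1) ^ (length us * length vs) * brk d (vs @ us @ ws)"
  using assms
proof (induction us arbitrary: ws rule: rev_induct)
  case (snoc x us)
  have "brk d ((us @ [x]) @ vs @ ws) = (-1) ^ length vs * brk d (us @ vs @ x # ws)"
    using snoc.prems brk_move[of us vs ws d x] by simp
  also have "brk d (us @ vs @ x # ws) = (-1) ^ (length us * length vs) * brk d (vs @ us @ x # ws)"
    using snoc.prems by (subst snoc.IH) auto
  finally show ?case by (simp add: power_add)
qed simp

text \<open>The rows of \<open>us @ ws\<close> arise from those of \<open>us' @ ws\<close> by left
  multiplication with the block matrix of \<open>C\<close> and an identity. As \<open>C\<close> may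
  be singular, a known left-hand side also tests whether the bracket on the right vanishes.\<close>

lemma brk_change:
  assumes "length us = k" "length us' = k" "k + length ws = d" "C \<in> carrier_mat k k"
    and "\<And>i m. i < k \<Longrightarrow> m < d \<Longrightarrow> us ! i $ m = (\<Sum>j<k. C $$ (i, j) * us' ! j $ m)"
  shows "brk d (us @ ws) = det C * brk d (us' @ ws)"
proof -
  let ?l = "length ws"
  let ?B = "four_block_mat C (0\<^sub>m k ?l) (0\<^sub>m ?l k) (1\<^sub>m ?l)"
  let ?A = "mat_of_rows d (us' @ ws)"
  have B: "?B \<in> carrier_mat d d" using assms by auto
  have A: "?A \<in> carrier_mat d d" using assms by (intro carrier_matI) simp_all
  have "mat_of_rows d (us @ ws) = ?B * ?A"
  proof (rule eq_matI)
    fix i j assume "i < dim_row (?B * ?A)" "j < dim_col (?B * ?A)"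
    then have ij: "i < d" "j < d" using assms by auto
    have "(?B * ?A) $$ (i, j) = (\<Sum>m<d. ?B $$ (i, m) * ?A $$ (m, j))"
      using ij A B assms by (auto simp: scalar_prod_def lessThan_atLeast0 intro!: sum.cong)
    also have "\<dots> = (\<Sum>m<k. ?B $$ (i, m) * ?A $$ (m, j)) + (\<Sum>m\<in>{k..<d}. ?B $$ (i, m) * ?A $$ (m, j))"
      using assms(3) by (subst sum.union_disjoint[symmetric]) (auto intro!: sum.cong)
    also have "\<dots> = mat_of_rows d (us @ ws) $$ (i, j)"
    proof (cases "i < k")
      case True
      have "(\<Sum>m\<in>{k..<d}. ?B $$ (i, m) * ?A $$ (m, j)) = 0"
        by (intro sum.neutral) (use True assms in auto)
      moreover have "(\<Sum>m<k. ?B $$ (i, m) * ?A $$ (m, j)) = (\<Sum>m<k. C $$ (i, m) * us' ! m $ j)"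
        by (intro sum.cong) (use True ij assms in \<open>auto simp: mat_of_rows_index nth_append\<close>)
      ultimately show ?thesis using True ij assms by (simp add: mat_of_rows_index nth_append)
    next
      case False
      have "(\<Sum>m<k. ?B $$ (i, m) * ?A $$ (m, j)) = 0"
        by (intro sum.neutral) (use False ij assms in auto)
      moreover have "(\<Sum>m\<in>{k..<d}. ?B $$ (i, m) * ?A $$ (m, j)) = (\<Sum>m\<in>{i}. ?A $$ (m, j))"
        by (rule sum.mono_neutral_cong_right) (use False ij assms in \<open>auto\<close>)
      ultimately show ?thesis using False ij assms by (simp add: mat_of_rows_index nth_append)
    qed
    finally show "mat_of_rows d (us @ ws) $$ (i, j) = (?B * ?A) $$ (i, j)" ..
  qed (use assms in auto)
  then have "brk d (us @ ws) = det ?B * det ?A" unfolding brk_def using A B by (simp add: det_mult)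
  also have "det ?B = det C"
    using det_four_block_mat_upper_right_zero[of C k "0\<^sub>m k ?l" ?l "0\<^sub>m ?l k" "1\<^sub>m ?l"] assms by simp
  finally show ?thesis by (simp add: brk_def)
qed

text \<open>Cramer's rule: the coefficients are the row vector \<open>z\<close> times the adjugate,
  divided by the determinant.\<close>

lemma brk_coordinates:
  assumes "length us = d" "brk d us \<noteq> 0" "z \<in> carrier_vec d"
  obtains c where "\<And>m. m < d \<Longrightarrow> z $ m = (\<Sum>j<d. c j * us ! j $ m)"
proof -
  let ?A = "mat_of_rows d us"
  have A: "?A \<in> carrier_mat d d" using assms by (intro carrier_matI) simp_all
  define c where "c j = (\<Sum>m<d. z $ m * adj_mat ?A $$ (m, j)) / det ?A" for j
  have adj: "adj_mat ?A \<in> carrier_mat d d" "adj_mat ?A * ?A = det ?A \<cdot>\<^sub>m 1\<^sub>m d" using adj_mat[OF A] by auto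
  have "z $ m = (\<Sum>j<d. c j * us ! j $ m)" if m: "m < d" for m
  proof -
    have "(\<Sum>j<d. c j * us ! j $ m) = (\<Sum>j<d. (\<Sum>i<d. z $ i * (adj_mat ?A $$ (i, j) * ?A $$ (j, m))) / det ?A)"
    proof (intro sum.cong refl)
      fix j assume "j \<in> {..<d}"
      then have "us ! j $ m = ?A $$ (j, m)" using m assms(1) by (simp add: mat_of_rows_index)
      then show "c j * us ! j $ m = (\<Sum>i<d. z $ i * (adj_mat ?A $$ (i, j) * ?A $$ (j, m))) / det ?A"
        by (simp add: c_def sum_distrib_right mult.assoc)
    qed
    also have "\<dots> = (\<Sum>j<d. \<Sum>i<d. z $ i * (adj_mat ?A $$ (i, j) * ?A $$ (j, m))) / det ?A"
      by (simp add: sum_divide_distrib)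
    also have "(\<Sum>j<d. \<Sum>i<d. z $ i * (adj_mat ?A $$ (i, j) * ?A $$ (j, m))) =
       (\<Sum>i<d. z $ i * (adj_mat ?A * ?A) $$ (i, m))"
      by (subst sum.swap) (use m A adj(1) in \<open>auto simp: scalar_prod_def sum_distrib_left lessThan_atLeast0 intro!: sum.cong\<close>)
    also have "\<dots> = (\<Sum>i<d. if i = m then z $ i * det ?A else 0)"
      unfolding adj(2) by (intro sum.cong) (use m in auto)
    also have "\<dots> = z $ m * det ?A" using m by (simp add: sum.delta)
    finally show ?thesis using assms(2) by (simp add: brk_def)
  qed
  then show ?thesis using that by blast
qed

text \<open>For fixed \<open>L\<close> the form \<open>f u v\<close> is alternating and depends on
  its arguments only modulo the span of \<open>L\<close>, so it lives on a plane with basis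
  \<open>x\<close>, \<open>y\<close>. Expanding \<open>z\<close> and \<open>w\<close> in that basis
  reduces the relation to an identity between 2 by 2 minors.\<close>

lemma brk_plucker_end:
  assumes L: "length L + 2 = d" and xy: "brk d (L @ [x, y]) \<noteq> 0"
    and c: "z \<in> carrier_vec d" "w \<in> carrier_vec d"
  shows "brk d (L @ [x, z]) * brk d (L @ [y, w]) =
    brk d (L @ [x, y]) * brk d (L @ [z, w]) + brk d (L @ [x, w]) * brk d (L @ [y, z])"
proof -
  define f where "f u v = brk d (L @ [u, v])" for u v
  have anti: "f u v = - f v u" for u v unfolding f_def using L by (intro brk_swap) simp
  have lin: "\<exists>a b. \<forall>u. f u z = a * f u x + b * f u y" if z: "z \<in> carrier_vec d" for z
  proof -
    let ?us = "L @ [x, y]"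
    obtain c where c: "\<And>m. m < d \<Longrightarrow> z $ m = (\<Sum>j<d. c j * ?us ! j $ m)"
      using brk_coordinates[of ?us d z] L xy z by auto
    have "f u z = c (d - 2) * f u x + c (d - 1) * f u y" for u
    proof -
      have "f u z = (\<Sum>j<d. c j * brk d ((L @ [u]) @ ?us ! j # []))"
        using brk_sum[of "L @ [u]" "[]" d z c "\<lambda>j. ?us ! j" "{..<d}"] c L by (simp add: f_def)
      \<comment> \<open>Basis vectors taken from \<open>L\<close> produce a repeated argument; only
        the last two positions, those of \<open>x\<close> and \<open>y\<close>, survive.\<close>
      also have "\<dots> = (\<Sum>j\<in>{d-2,d-1}. c j * brk d ((L @ [u]) @ ?us ! j # []))"
      proof (rule sum.mono_neutral_right)
        show "\<forall>i\<in>{..<d} - {d - 2, d - 1}. c i * brk d ((L @ [u]) @ ?us ! i # []) = 0"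
        proof
          fix i assume "i \<in> {..<d} - {d - 2, d - 1}"
          then have "i < length L" using L by auto
          then have "?us ! i \<in> set L" by (simp add: nth_append)
          then have "\<not> distinct ((L @ [u]) @ ?us ! i # [])" by auto
          then have "brk d ((L @ [u]) @ ?us ! i # []) = 0" by (rule brk_notdistinct[rotated]) (use L in simp)
          then show "c i * brk d ((L @ [u]) @ ?us ! i # []) = 0" by simp
        qed
      qed (use L in auto)
      also have "\<dots> = c (d - 2) * f u x + c (d - 1) * f u y"
      proof -
        have "d - 2 = length L" "d - 1 = Suc (length L)" "d - 2 \<noteq> d - 1" using L by auto
        then show ?thesis by (simp add: f_def nth_append)
      qed
      finally show ?thesis .
    qed
    then show ?thesis by blast
  qed
  obtain a b where z: "\<And>u. f u z = a * f u x + b * f u y" using lin[OF c(1)] by blast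
  obtain p q where w: "\<And>u. f u w = p * f u x + q * f u y" using lin[OF c(2)] by blast
  have xx: "f x x = 0" "f y y = 0" "f y x = - f x y" using anti[of x x] anti[of y y] anti[of y x] by auto
  have 1: "f x z = b * f x y" "f y z = - a * f x y" "f x w = q * f x y" "f y w = - p * f x y"
    using z[of x] z[of y] w[of x] w[of y] xx by auto
  have "f z w = - p * f x z - q * f y z" using w[of z] anti[of z x] anti[of z y] by simp
  then have 2: "f z w = (a * q - b * p) * f x y" unfolding 1 by (simp add: algebra_simps)
  have "f x z * f y w = f x y * f z w + f x w * f y z"
    unfolding 1 2 by (simp add: algebra_simps)
  then show ?thesis by (simp add: f_def)
qed

text \<open>The vectors \<open>x\<close>, \<open>y\<close> and \<open>z\<close> are pushed to the
  end of the brackets, where \<open>w\<close> already stands. In each of the three products the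
  signs multiply to \<open>sx * sy * sz\<close>, so the relation at the end transfers
  unchanged.\<close>

lemma brk_plucker:
  assumes l: "length A + length B + length C + length E + 2 = d"
    and xy: "brk d (A @ x # B @ y # C @ E) \<noteq> 0"
    and c: "z \<in> carrier_vec d" "w \<in> carrier_vec d"
  shows "brk d (A @ x # B @ C @ z # E) * brk d (A @ B @ y # C @ E @ [w]) =
    brk d (A @ x # B @ y # C @ E) * brk d (A @ B @ C @ z # E @ [w]) +
    brk d (A @ x # B @ C @ E @ [w]) * brk d (A @ B @ y # C @ z # E)"
proof -
  define L where "L = A @ B @ C @ E"
  define sx :: real where "sx = (-1) ^ (length B + (length C + length E))"
  define sy :: real where "sy = (-1) ^ (length C + length E)"
  define sz :: real where "sz = (-1) ^ length E"
  have xz: "brk d (A @ x # B @ C @ z # E) = sx * sz * brk d (L @ [x, z])"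
    using brk_move[of "A @ x # B @ C" E "[]" d z] brk_move[of A "B @ C @ E" "[z]" d x] l
    by (simp add: L_def sx_def sz_def)
  have yw: "brk d (A @ B @ y # C @ E @ [w]) = sy * brk d (L @ [y, w])"
    using brk_move[of "A @ B" "C @ E" "[w]" d y] l
    by (simp add: L_def sy_def)
  have xy': "brk d (A @ x # B @ y # C @ E) = sx * sy * brk d (L @ [x, y])"
    using brk_move[of "A @ x # B" "C @ E" "[]" d y] brk_move[of A "B @ C @ E" "[y]" d x] l
    by (simp add: L_def sx_def sy_def)
  have zw: "brk d (A @ B @ C @ z # E @ [w]) = sz * brk d (L @ [z, w])"
    using brk_move[of "A @ B @ C" "E" "[w]" d z] l
    by (simp add: L_def sz_def)
  have xw: "brk d (A @ x # B @ C @ E @ [w]) = sx * brk d (L @ [x, w])"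
    using brk_move[of "A" "B @ C @ E" "[w]" d x] l
    by (simp add: L_def sx_def)
  have yz: "brk d (A @ B @ y # C @ z # E) = sy * sz * brk d (L @ [y, z])"
    using brk_move[of "A @ B @ y # C" E "[]" d z] brk_move[of "A @ B" "C @ E" "[z]" d y] l
    by (simp add: L_def sy_def sz_def)
  have "brk d (L @ [x, z]) * brk d (L @ [y, w]) =
    brk d (L @ [x, y]) * brk d (L @ [z, w]) + brk d (L @ [x, w]) * brk d (L @ [y, z])"
    by (rule brk_plucker_end) (use l xy xy' c in \<open>auto simp: L_def\<close>)
  then show ?thesis unfolding xz yw xy' zw xw yz by (simp add: algebra_simps)
qed

definition blk :: "(nat \<Rightarrow> 'a) \<Rightarrow> nat \<Rightarrow> 'a list" where
  "blk v a = map v [1..<Suc a]"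

lemma blk_simps [simp]: "length (blk v a) = a" "blk v 0 = []" "blk v (Suc a) = blk v a @ [v (Suc a)]"
  by (auto simp: blk_def)

lemma set_blk: "set (blk v a) = v ` {1..a}"
  by (auto simp: blk_def)

text \<open>The Pluecker relation applied to the next basis vector of each of four flags, which
  lengthens the corresponding block by one: the octahedron recurrence.\<close>

lemma brk_octahedron:
  fixes u v w x :: "nat \<Rightarrow> real vec"
  assumes "a + b + c + e + 2 = d" "\<And>s. s \<in> {1..d} \<Longrightarrow> w s \<in> carrier_vec d" "\<And>s. s \<in> {1..d} \<Longrightarrow> x s \<in> carrier_vec d"
    and "brk d (blk u (Suc a) @ blk v (Suc b) @ blk w c @ blk x e) \<noteq> 0"
  shows "brk d (blk u (Suc a) @ blk v b @ blk w (Suc c) @ blk x e) *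
      brk d (blk u a @ blk v (Suc b) @ blk w c @ blk x (Suc e)) =
    brk d (blk u (Suc a) @ blk v (Suc b) @ blk w c @ blk x e) *
      brk d (blk u a @ blk v b @ blk w (Suc c) @ blk x (Suc e)) +
    brk d (blk u (Suc a) @ blk v b @ blk w c @ blk x (Suc e)) *
      brk d (blk u a @ blk v (Suc b) @ blk w (Suc c) @ blk x e)"
  using brk_plucker[of "blk u a" "blk v b" "blk w c" "blk x e" d "u (Suc a)" "v (Suc b)" "w (Suc c)" "x (Suc e)"] assms
  by simp

text \<open>Here a free vector \<open>y\<close> takes the place of the fourth flag. Solved for the
  bracket with middle exponent \<open>Suc b\<close> and last argument \<open>y\<close>, the relation
  expresses one functional of \<open>y\<close> by two functionals with middle exponent
  \<open>b\<close>.\<close>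

lemma brk_three_term:
  fixes u v w :: "nat \<Rightarrow> real vec"
  assumes "a + b + c + 2 = d" "\<And>s. s \<in> {1..d} \<Longrightarrow> w s \<in> carrier_vec d" "y \<in> carrier_vec d"
    and "brk d (blk u (Suc a) @ blk v (Suc b) @ blk w c) \<noteq> 0"
  shows "brk d (blk u (Suc a) @ blk v b @ blk w (Suc c)) *
      brk d (blk u a @ blk v (Suc b) @ blk w c @ [y]) =
    brk d (blk u (Suc a) @ blk v (Suc b) @ blk w c) *
      brk d (blk u a @ blk v b @ blk w (Suc c) @ [y]) +
    brk d (blk u a @ blk v (Suc b) @ blk w (Suc c)) *
    brk d (blk u (Suc a) @ blk v b @ blk w c @ [y])"
  using brk_plucker[of "blk u a" "blk v b" "blk w c" "[]" d "u (Suc a)" "v (Suc b)" "w (Suc c)" y] assms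
  by simp

section \<open>Signs of positive tuples\<close>

text \<open>\<open>\<alpha> s\<close> is the sign by which the generator of \<open>\<And>\<^sup>s F\<^sup>(\<^sup>s\<^sup>)\<close> is multiplied.\<close>

definition orientation :: "nat \<Rightarrow> (nat \<Rightarrow> real) \<Rightarrow> bool" where
  "orientation d \<alpha> \<longleftrightarrow> \<alpha> 0 = 1 \<and> (\<forall>s\<le>d. \<alpha> s * \<alpha> s = 1)"

text \<open>A gauge fixing on the triangular lattice \<open>a + b + c = d\<close>. The sign
  functions are chosen so that the corrected sign \<open>q\<close> equals 1 on the rows
  \<open>b = 0\<close> and \<open>b = 1\<close> and on the side \<open>a = 0\<close>; each hexagon
  relation then determines one further value, row by row. The hexagon in \<open>hex\<close>
  surrounds the lattice point \<open>(a+1, b+1, c+1)\<close>.\<close>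

lemma sgn_factorization:
  fixes s :: "nat \<Rightarrow> nat \<Rightarrow> nat \<Rightarrow> real"
  assumes d: "1 \<le> d" and s1: "\<And>a b c. a + b + c = d \<Longrightarrow> s a b c * s a b c = 1"
    and hex: "\<And>a b c. a + b + c + 3 = d \<Longrightarrow>
      s a (b+1) (c+2) * s (a+2) (b+1) c * s (a+1) (b+2) c *
      s (a+1) b (c+2) * s (a+2) b (c+1) * s a (b+2) (c+1) = 1"
  obtains \<kappa> \<alpha> \<beta> \<gamma> where "\<kappa> * \<kappa> = 1" "orientation d \<alpha>" "orientation d \<beta>" "orientation d \<gamma>"
    "\<And>a b c. a + b + c = d \<Longrightarrow> \<kappa> * \<alpha> a * \<beta> b * \<gamma> c * s a b c = 1"
proof -
  \<comment> \<open>The recursion is the condition that \<open>q\<close> take the value 1 on the row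
    \<open>b = 1\<close> once it does so on the row \<open>b = 0\<close>.\<close>
  define \<gamma> where "\<gamma> = rec_nat (1::real) (\<lambda>c g. g * s (d - 1 - c) 0 (c + 1) * s (d - 1 - c) 1 c)"
  have g0: "\<gamma> 0 = 1" and gS: "\<And>c. \<gamma> (Suc c) = \<gamma> c * s (d - 1 - c) 0 (c + 1) * s (d - 1 - c) 1 c"
    by (simp_all add: \<gamma>_def)
  \<comment> \<open>This value gives \<open>\<alpha> 0 = \<beta> 0 = 1\<close>, where \<alpha> and
    \<beta> are read off from the sides \<open>b = 0\<close> and \<open>a = 0\<close>.\<close>
  define \<kappa> where "\<kappa> = s 0 0 d * \<gamma> d"
  define \<alpha> where "\<alpha> a = \<kappa> * s a 0 (d - a) * \<gamma> (d - a)" for a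
  define \<beta> where "\<beta> b = \<kappa> * s 0 b (d - b) * \<gamma> (d - b)" for b
  have g1: "\<gamma> c * \<gamma> c = 1" if "c \<le> d" for c
    using that
  proof (induction c)
    case (Suc c)
    have "\<gamma> (Suc c) * \<gamma> (Suc c) = (\<gamma> c * \<gamma> c) * (s (d - 1 - c) 0 (c + 1) * s (d - 1 - c) 0 (c + 1)) *
       (s (d - 1 - c) 1 c * s (d - 1 - c) 1 c)" unfolding gS by (simp only: mult_ac)
    also have "\<dots> = 1" using Suc s1[of "d - 1 - c" 0 "c + 1"] s1[of "d - 1 - c" 1 c] by simp
    finally show ?case .
  qed (simp add: g0)
  have k1: "\<kappa> * \<kappa> = 1"
    using s1[of 0 0 d] g1[of d] unfolding \<kappa>_def by (simp add: algebra_simps)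
  have sq: "(x * y * z) * (x * y * z) = 1" if "x * x = 1" "y * y = 1" "z * z = 1" for x y z :: real
  proof -
    have "(x * y * z) * (x * y * z) = (x * x) * (y * y) * (z * z)" by (simp only: mult_ac)
    then show ?thesis using that by simp
  qed
  have a1: "\<alpha> a * \<alpha> a = 1" if "a \<le> d" for a
    unfolding \<alpha>_def by (rule sq) (use that k1 s1 g1 in auto)
  have b1: "\<beta> b * \<beta> b = 1" if "b \<le> d" for b
    unfolding \<beta>_def by (rule sq) (use that k1 s1 g1 in auto)
  have a0: "\<alpha> 0 = 1" "\<beta> 0 = 1"
  proof -
    have "\<kappa> * s 0 0 d * \<gamma> d = \<kappa> * \<kappa>" by (simp add: \<kappa>_def)
    then show "\<alpha> 0 = 1" "\<beta> 0 = 1" using k1 by (auto simp: \<alpha>_def \<beta>_def)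
  qed
  have or: "orientation d \<alpha>" "orientation d \<beta>" "orientation d \<gamma>"
    using a0 a1 b1 g0 g1 by (auto simp: orientation_def)
  define q where "q a b c = \<kappa> * \<alpha> a * \<beta> b * \<gamma> c * s a b c" for a b c
  have q_b0: "q a 0 c = 1" if "a + c = d" for a c
  proof -
    have "q a 0 c = (\<kappa> * \<kappa>) * (s a 0 c * s a 0 c) * (\<gamma> c * \<gamma> c)"
      using that a0 by (auto simp: q_def \<alpha>_def)
    then show ?thesis using k1 s1 g1 that by simp
  qed
  have q_a0: "q 0 b c = 1" if "b + c = d" for b c
  proof -
    have "q 0 b c = (\<kappa> * \<kappa>) * (s 0 b c * s 0 b c) * (\<gamma> c * \<gamma> c)"
      using that a0 by (auto simp: q_def \<beta>_def)
    then show ?thesis using k1 s1 g1 that by simp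
  qed
  have bone: "\<beta> 1 = 1"
  proof -
    obtain e where e: "d = Suc e" using d by (cases d) auto
    have "\<beta> 1 = (s 0 0 d * s 0 0 d) * (\<gamma> e * \<gamma> e) * (s 0 1 e * s 0 1 e)"
      unfolding \<beta>_def \<kappa>_def using gS[of e] e by simp
    then show ?thesis using s1 g1[of e] e by simp
  qed
  have q_b1: "q a 1 c = 1" if "a + c + 1 = d" for a c
  proof -
    have da: "d - a = Suc c" "d - Suc c = a" "d - 1 - c = a" using that by auto
    have "q a 1 c = (\<kappa> * \<kappa>) * (s a 0 (c+1) * s a 0 (c+1)) * (\<gamma> c * \<gamma> c) * (s a 1 c * s a 1 c)"
      unfolding q_def bone \<alpha>_def da gS by simp
    then show ?thesis using k1 s1 g1 that by simp
  qed
  have main: "\<forall>a c. a + b + c = d \<longrightarrow> q a b c = 1" for b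
  proof (induction b rule: less_induct)
    case (less b)
    consider "b = 0" | "b = 1" | b' where "b = b' + 2"
      by (metis One_nat_def Suc_1 add.commute add_2_eq_Suc' not0_implies_Suc)
    then show ?case
    proof cases
      case 3
      have IH1: "q a (b' + 1) c = 1" if "a + (b' + 1) + c = d" for a c using less that 3 by auto
      have IH0: "q a b' c = 1" if "a + b' + c = d" for a c using less that 3 by auto
      have "q a (b' + 2) c = 1" if "a + (b' + 2) + c = d" for a c
        using that
      proof (induction a arbitrary: c)
        case 0 then show ?case using q_a0 by simp
      next
        case (Suc a)
        have dd: "a + b' + c + 3 = d" using Suc.prems by simp
        let ?h = "s a (b'+1) (c+2) * s (a+2) (b'+1) c * s (a+1) (b'+2) c *
          s (a+1) b' (c+2) * s (a+2) b' (c+1) * s a (b'+2) (c+1)"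
        \<comment> \<open>Around a hexagon each value of \<alpha>, \<beta> and \<gamma> that occurs
          does so exactly twice, and \<kappa> six times, so the corrections cancel.\<close>
        have "q a (b'+1) (c+2) * q (a+2) (b'+1) c * q (a+1) (b'+2) c *
          q (a+1) b' (c+2) * q (a+2) b' (c+1) * q a (b'+2) (c+1) =
          (\<kappa> * \<kappa>) * (\<kappa> * \<kappa>) * (\<kappa> * \<kappa>) *
          (\<alpha> a * \<alpha> a) * (\<alpha> (a+1) * \<alpha> (a+1)) * (\<alpha> (a+2) * \<alpha> (a+2)) *
          (\<beta> b' * \<beta> b') * (\<beta> (b'+1) * \<beta> (b'+1)) * (\<beta> (b'+2) * \<beta> (b'+2)) *
          (\<gamma> c * \<gamma> c) * (\<gamma> (c+1) * \<gamma> (c+1)) * (\<gamma> (c+2) * \<gamma> (c+2)) * ?h"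
          unfolding q_def by (simp only: mult_ac)
        also have "\<dots> = 1"
        proof -
          have "\<alpha> a * \<alpha> a = 1" "\<alpha> (a+1) * \<alpha> (a+1) = 1" "\<alpha> (a+2) * \<alpha> (a+2) = 1"
            "\<beta> b' * \<beta> b' = 1" "\<beta> (b'+1) * \<beta> (b'+1) = 1" "\<beta> (b'+2) * \<beta> (b'+2) = 1"
            "\<gamma> c * \<gamma> c = 1" "\<gamma> (c+1) * \<gamma> (c+1) = 1" "\<gamma> (c+2) * \<gamma> (c+2) = 1"
            using dd by (auto intro!: a1 b1 g1)
          then show ?thesis unfolding hex[OF dd] k1 by (simp only: mult_1)
        qed
        finally show ?case
          using IH1[of a "c+2"] IH1[of "a+2" c] IH0[of "a+1" "c+2"] IH0[of "a+2" "c+1"] Suc.IH[of "c+1"] dd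
          by simp
      qed
      then show ?thesis using 3 by simp
    qed (use q_b0 q_b1 in auto)
  qed
  show ?thesis
    by (rule that[OF k1 or]) (use main in \<open>auto simp: q_def\<close>)
qed

text \<open>The hypothesis \<open>hex\<close> is positivity of a triple ratio with denominators
  cleared; passing to signs turns it into the hexagon relation.\<close>

lemma triple_orientation:
  fixes f :: "nat \<Rightarrow> nat \<Rightarrow> nat \<Rightarrow> real"
  assumes d: "1 \<le> d" and nz: "\<And>a b c. a + b + c = d \<Longrightarrow> f a b c \<noteq> 0"
    and hex: "\<And>a b c. a + b + c + 3 = d \<Longrightarrow>
      0 < f a (b+1) (c+2) * f (a+2) (b+1) c * f (a+1) (b+2) c *
      f (a+1) b (c+2) * f (a+2) b (c+1) * f a (b+2) (c+1)"
  obtains \<kappa> \<alpha> \<beta> \<gamma> where "\<kappa> * \<kappa> = 1" "orientation d \<alpha>" "orientation d \<beta>" "orientation d \<gamma>"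
    "\<And>a b c. a + b + c = d \<Longrightarrow> 0 < \<kappa> * \<alpha> a * \<beta> b * \<gamma> c * f a b c"
proof -
  have 1: "sgn (f a b c) * sgn (f a b c) = 1" if "a + b + c = d" for a b c
    using nz[OF that] by (simp add: sgn_if)
  have 2: "sgn (f a (b+1) (c+2)) * sgn (f (a+2) (b+1) c) * sgn (f (a+1) (b+2) c) *
      sgn (f (a+1) b (c+2)) * sgn (f (a+2) b (c+1)) * sgn (f a (b+2) (c+1)) = 1"
    if "a + b + c + 3 = d" for a b c
    using hex[OF that] by (metis sgn_mult sgn_pos)
  obtain \<kappa> \<alpha> \<beta> \<gamma> where o: "\<kappa> * \<kappa> = 1" "orientation d \<alpha>" "orientation d \<beta>" "orientation d \<gamma>"
    and *: "\<And>a b c. a + b + c = d \<Longrightarrow> \<kappa> * \<alpha> a * \<beta> b * \<gamma> c * sgn (f a b c) = 1"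
    using sgn_factorization[OF d, of "\<lambda>a b c. sgn (f a b c)"] 1 2 by blast
  have "0 < \<kappa> * \<alpha> a * \<beta> b * \<gamma> c * f a b c" if "a + b + c = d" for a b c
  proof -
    have "\<kappa> * \<alpha> a * \<beta> b * \<gamma> c * f a b c = (\<kappa> * \<alpha> a * \<beta> b * \<gamma> c * sgn (f a b c)) * \<bar>f a b c\<bar>"
      by (simp only: mult.assoc sgn_mult_abs)
    then show ?thesis using *[OF that] nz[OF that] by simp
  qed
  then show ?thesis using that o by blast
qed

text \<open>The relation gives a bracket with larger \<open>b + e\<close> as a positive sum divided
  by a positive factor, so positivity spreads from the faces \<open>b = 0\<close> and
  \<open>e = 0\<close> by induction on \<open>b + e\<close>. For four flags these faces are two
  triangles with a common edge.\<close>

lemma octahedron_positive: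
  fixes f :: "nat \<Rightarrow> nat \<Rightarrow> nat \<Rightarrow> nat \<Rightarrow> real"
  assumes rel: "\<And>a b c e. a + b + c + e + 2 = d \<Longrightarrow>
      f (Suc a) b (Suc c) e * f a (Suc b) c (Suc e) =
      f (Suc a) (Suc b) c e * f a b (Suc c) (Suc e) + f (Suc a) b c (Suc e) * f a (Suc b) (Suc c) e"
    and b0: "\<And>a c e. a + c + e = d \<Longrightarrow> 0 < f a 0 c e"
    and e0: "\<And>a b c. a + b + c = d \<Longrightarrow> 0 < f a b c 0"
  shows "a + b + c + e = d \<Longrightarrow> 0 < f a b c e"
proof (induction "b + e" arbitrary: a b c e rule: less_induct)
  case less
  show ?case
  proof (cases "b = 0 \<or> e = 0")
    case False
    then obtain b' e' where be: "b = Suc b'" "e = Suc e'" by (metis not0_implies_Suc)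
    have dd: "a + b' + c + e' + 2 = d" using less.prems be by simp
    have "0 < f (Suc a) b' (Suc c) e'" "0 < f (Suc a) (Suc b') c e'" "0 < f a b' (Suc c) (Suc e')"
      "0 < f (Suc a) b' c (Suc e')" "0 < f a (Suc b') (Suc c) e'"
      by (rule less.hyps; use dd be in simp)+
    then have "0 < f (Suc a) b' (Suc c) e' * f a (Suc b') c (Suc e')" "0 < f (Suc a) b' (Suc c) e'"
      unfolding rel[OF dd] by (auto intro: add_pos_pos)
    then show ?thesis unfolding be by (rule zero_less_mult_pos)
  qed (use b0 e0 less.prems in auto)
qed

section \<open>Coherent signs on polygons of generic flags\<close>

locale generic_flags =
  fixes d t :: nat and v :: "nat \<Rightarrow> nat \<Rightarrow> real vec"
  assumes d1: "1 \<le> d"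
    and flag_carrier: "\<And>i s. i \<in> {1..t} \<Longrightarrow> s \<in> {1..d} \<Longrightarrow> v i s \<in> carrier_vec d"
    and generic: "\<And>ix as. distinct ix \<Longrightarrow> set ix \<subseteq> {1..t} \<Longrightarrow> length as = length ix \<Longrightarrow>
      sum_list as = d \<Longrightarrow> brk d (concat (map2 (\<lambda>i a. blk (v i) a) ix as)) \<noteq> 0"
begin

abbreviation br3 :: "nat \<Rightarrow> nat \<Rightarrow> nat \<Rightarrow> nat \<Rightarrow> nat \<Rightarrow> nat \<Rightarrow> real" where
  "br3 i j k a b c \<equiv> brk d (blk (v i) a @ blk (v j) b @ blk (v k) c)"

lemma br2_nz: "i \<noteq> j \<Longrightarrow> {i, j} \<subseteq> {1..t} \<Longrightarrow> a + b = d \<Longrightarrow> brk d (blk (v i) a @ blk (v j) b) \<noteq> 0"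
  using generic[of "[i, j]" "[a, b]"] by simp

lemma br3_nz: "distinct [i, j, k] \<Longrightarrow> {i, j, k} \<subseteq> {1..t} \<Longrightarrow> a + b + c = d \<Longrightarrow> br3 i j k a b c \<noteq> 0"
  using generic[of "[i, j, k]" "[a, b, c]"] by simp

lemma br4_nz: "distinct [i, j, k, l] \<Longrightarrow> {i, j, k, l} \<subseteq> {1..t} \<Longrightarrow> a + b + c + e = d \<Longrightarrow>
    brk d (blk (v i) a @ blk (v j) b @ blk (v k) c @ blk (v l) e) \<noteq> 0"
  using generic[of "[i, j, k, l]" "[a, b, c, e]"] by simp

text \<open>The normalization \<open>ori i 0 = 1\<close> lets a triple with a zero exponent agree
  with the pair that remains; the common sign is therefore carried separately as \<kappa>.\<close>

definition tri :: "real \<Rightarrow> (nat \<Rightarrow> nat \<Rightarrow> real) \<Rightarrow> nat \<Rightarrow> nat \<Rightarrow> nat \<Rightarrow> bool" where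
  "tri \<kappa> ori i j k \<longleftrightarrow>
     (\<forall>a b c. a + b + c = d \<longrightarrow> 0 < \<kappa> * ori i a * ori j b * ori k c * br3 i j k a b c)"

definition polygon :: "real \<Rightarrow> (nat \<Rightarrow> nat \<Rightarrow> real) \<Rightarrow> nat set \<Rightarrow> bool" where
  "polygon \<kappa> ori S \<longleftrightarrow> (\<forall>i\<in>S. \<forall>j\<in>S. \<forall>k\<in>S. i < j \<and> j < k \<longrightarrow> tri \<kappa> ori i j k)"

definition admissible :: "real \<Rightarrow> (nat \<Rightarrow> nat \<Rightarrow> real) \<Rightarrow> bool" where
  "admissible \<kappa> ori \<longleftrightarrow> \<kappa> * \<kappa> = 1 \<and> (\<forall>i. orientation d (ori i))"

text \<open>The orientation factors multiply to the same number \<open>Q\<close> in all three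
  products of the octahedron relation.\<close>

lemma oriented_octahedron:
  fixes \<kappa> :: real and ori :: "nat \<Rightarrow> nat \<Rightarrow> real"
  assumes "distinct [i, j, k, l]" "{i, j, k, l} \<subseteq> {1..t}" "a + b + c + e + 2 = d"
  defines "f \<equiv> \<lambda>a b c e. \<kappa> * ori i a * ori j b * ori k c * ori l e *
    brk d (blk (v i) a @ blk (v j) b @ blk (v k) c @ blk (v l) e)"
  shows "f (Suc a) b (Suc c) e * f a (Suc b) c (Suc e) =
      f (Suc a) (Suc b) c e * f a b (Suc c) (Suc e) + f (Suc a) b c (Suc e) * f a (Suc b) (Suc c) e"
proof -
  let ?g = "\<lambda>a b c e. brk d (blk (v i) a @ blk (v j) b @ blk (v k) c @ blk (v l) e)"
  define Q where "Q = \<kappa> * \<kappa> * (ori i a * ori i (Suc a)) * (ori j b * ori j (Suc b)) *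
    (ori k c * ori k (Suc c)) * (ori l e * ori l (Suc e))"
  have f: "f (Suc a) b (Suc c) e * f a (Suc b) c (Suc e) = Q * (?g (Suc a) b (Suc c) e * ?g a (Suc b) c (Suc e))"
    "f (Suc a) (Suc b) c e * f a b (Suc c) (Suc e) = Q * (?g (Suc a) (Suc b) c e * ?g a b (Suc c) (Suc e))"
    "f (Suc a) b c (Suc e) * f a (Suc b) (Suc c) e = Q * (?g (Suc a) b c (Suc e) * ?g a (Suc b) (Suc c) e)"
    unfolding f_def Q_def by (simp_all only: mult_ac)
  have "?g (Suc a) (Suc b) c e \<noteq> 0" by (rule br4_nz) (use assms in auto)
  then have "?g (Suc a) b (Suc c) e * ?g a (Suc b) c (Suc e) =
      ?g (Suc a) (Suc b) c e * ?g a b (Suc c) (Suc e) + ?g (Suc a) b c (Suc e) * ?g a (Suc b) (Suc c) e"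
    by (intro brk_octahedron) (use assms flag_carrier in auto)
  then show ?thesis unfolding f by (simp only: distrib_left)
qed

text \<open>The triangles \<open>i j k\<close> and \<open>i k l\<close> are the faces
  \<open>e = 0\<close> and \<open>b = 0\<close> of the octahedron recurrence. Once all brackets of
  the four flags are positive, the faces \<open>c = 0\<close> and \<open>a = 0\<close> give the
  triangles on the other diagonal.\<close>

lemma flip_diagonal_ik:
  assumes adm: "admissible \<kappa> ori" and D: "distinct [i, j, k, l]" "{i, j, k, l} \<subseteq> {1..t}"
    and t: "tri \<kappa> ori i j k" "tri \<kappa> ori i k l"
  shows "tri \<kappa> ori i j l" "tri \<kappa> ori j k l"
proof -
  let ?f = "\<lambda>a b c e. \<kappa> * ori i a * ori j b * ori k c * ori l e *
    brk d (blk (v i) a @ blk (v j) b @ blk (v k) c @ blk (v l) e)"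
  have o: "ori i 0 = 1" "ori j 0 = 1" "ori k 0 = 1" "ori l 0 = 1"
    using adm by (auto simp: admissible_def orientation_def)
  have *: "0 < ?f a b c e" if "a + b + c + e = d" for a b c e
    by (rule octahedron_positive[of d ?f, OF oriented_octahedron[OF D] _ _ that])
      (use t o in \<open>auto simp: tri_def\<close>)
  show "tri \<kappa> ori i j l" unfolding tri_def using *[of _ _ 0] o by simp
  show "tri \<kappa> ori j k l" unfolding tri_def using *[of 0] o by simp
qed

text \<open>The recurrence is symmetric under exchanging \<open>a\<close> with \<open>b\<close> and
  \<open>c\<close> with \<open>e\<close>; after this exchange the given triangles are again its
  initial faces.\<close>

lemma flip_diagonal_jl:
  assumes adm: "admissible \<kappa> ori" and D: "distinct [i, j, k, l]" "{i, j, k, l} \<subseteq> {1..t}"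
    and t: "tri \<kappa> ori i j l" "tri \<kappa> ori j k l"
  shows "tri \<kappa> ori i j k" "tri \<kappa> ori i k l"
proof -
  let ?f = "\<lambda>a b c e. \<kappa> * ori i a * ori j b * ori k c * ori l e *
    brk d (blk (v i) a @ blk (v j) b @ blk (v k) c @ blk (v l) e)"
  have o: "ori i 0 = 1" "ori j 0 = 1" "ori k 0 = 1" "ori l 0 = 1"
    using adm by (auto simp: admissible_def orientation_def)
  have *: "0 < ?f b a e c" if "a + b + c + e = d" for a b c e
  proof (rule octahedron_positive[of d "\<lambda>a b c e. ?f b a e c", OF _ _ _ that])
    fix a b c e assume "a + b + c + e + 2 = d"
    then have "b + a + e + c + 2 = d" by simp
    from oriented_octahedron[OF D this, of \<kappa> ori]
    show "?f b (Suc a) e (Suc c) * ?f (Suc b) a (Suc e) c =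
       ?f (Suc b) (Suc a) e c * ?f b a (Suc e) (Suc c) + ?f b (Suc a) (Suc e) c * ?f (Suc b) a e (Suc c)"
      by (simp only: mult.commute)
  qed (use t o in \<open>auto simp: tri_def\<close>)
  show "tri \<kappa> ori i j k" unfolding tri_def using *[of _ _ 0] o by simp
  show "tri \<kappa> ori i k l" unfolding tri_def using *[of 0] o by simp
qed

text \<open>Every triangle at \<open>y\<close> other than \<open>p y q\<close> is half of a
  quadrilateral that the other diagonal splits into two known triangles. The facts \<open>L\<close>
  and \<open>R\<close>, with \<open>p\<close> or \<open>q\<close> as a vertex, provide the known
  halves for triangles farther away from the gap.\<close>

lemma polygon_insert:
  assumes adm: "admissible \<kappa> ori" and S: "S \<subseteq> {1..t}" "polygon \<kappa> ori S"
    and pq: "p \<in> S" "q \<in> S" "p < y" "y < q" "y \<in> {1..t}" "\<And>s. s \<in> S \<Longrightarrow> s \<le> p \<or> q \<le> s"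
    and t: "tri \<kappa> ori p y q"
  shows "polygon \<kappa> ori (insert y S)"
proof -
  have P: "tri \<kappa> ori i j k" if "i \<in> S" "j \<in> S" "k \<in> S" "i < j" "j < k" for i j k
    using S(2) that unfolding polygon_def by blast
  have in_t: "i \<in> {1..t}" if "i \<in> S" for i using S that by auto
  have L: "tri \<kappa> ori a p y" "tri \<kappa> ori a y q" if "a \<in> S" "a < p" for a
    using flip_diagonal_jl[OF adm, of a p y q] in_t[of p] in_t[of q] in_t[OF that(1)] that pq t P[of a p q] by auto
  have R: "tri \<kappa> ori p y a" "tri \<kappa> ori y q a" if "a \<in> S" "q < a" for a
    using flip_diagonal_ik[OF adm, of p y q a] in_t[of p] in_t[of q] in_t[OF that(1)] that pq t P[of p q a] by auto
  have LL: "tri \<kappa> ori a b y" if "a \<in> S" "b \<in> S" "a < b" "b \<le> p" for a b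
  proof (cases "b = p")
    case False
    then show ?thesis
      using flip_diagonal_jl[OF adm, of a b y q] in_t[of p] in_t[of q] in_t[of a] in_t[of b] that pq P[of a b q] L(2)[of b] by auto
  qed (use L that in auto)
  have RR: "tri \<kappa> ori y a b" if "a \<in> S" "b \<in> S" "a < b" "q \<le> a" for a b
  proof (cases "a = q")
    case False
    then show ?thesis
      using flip_diagonal_ik[OF adm, of p y a b] in_t[of p] in_t[of q] in_t[of a] in_t[of b] that pq P[of p a b] R(1)[of a] by auto
  qed (use R that in auto)
  have LR: "tri \<kappa> ori a y b" if "a \<in> S" "b \<in> S" "a \<le> p" "q \<le> b" for a b
  proof -
    consider "b = q" "a = p" | "b = q" "a < p" | "b > q" "a = p" | "q < b" "a < p" using \<open>a \<le> p\<close> \<open>q \<le> b\<close> by linarith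
    then show ?thesis
    proof cases
      case 4
      then show ?thesis
        using flip_diagonal_ik[OF adm, of a y q b] in_t[of p] in_t[of q] in_t[of a] in_t[of b] that pq P[of a q b] L(2)[of a] by auto
    qed (use L R t that in auto)
  qed
  show ?thesis unfolding polygon_def
  proof (intro ballI impI)
    fix i j k assume a: "i \<in> insert y S" "j \<in> insert y S" "k \<in> insert y S" "i < j \<and> j < k"
    consider "i \<in> S" "j \<in> S" "k \<in> S" | "i = y" | "j = y" | "k = y" using a by blast
    then show "tri \<kappa> ori i j k"
    proof cases
      case 1 then show ?thesis using P a by blast
    next
      case 2
      then show ?thesis using RR[of j k] a pq(6)[of j] pq by auto
    next
      case 3
      then show ?thesis using LR[of i k] a pq(6)[of i] pq(6)[of k] pq by auto
    next
      case 4
      then show ?thesis using LL[of i j] a pq(6)[of j] pq by auto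
    qed
  qed
qed

text \<open>Inserting a single vertex of \<open>B\<close> into \<open>A\<close> settles the triples
  with at most one vertex outside \<open>A\<close>. One vertex of \<open>A\<close> beyond the edge
  together with two vertices of \<open>B\<close> takes one more flip, in a quadrilateral with
  \<open>p\<close> or \<open>q\<close> as fourth vertex.\<close>

lemma polygon_union:
  assumes adm: "admissible \<kappa> ori" and AB: "A \<subseteq> {1..t}" "B \<subseteq> {1..t}" "polygon \<kappa> ori A" "polygon \<kappa> ori B"
    and pq: "p \<in> A \<inter> B" "q \<in> A \<inter> B" "p < q" "\<And>s. s \<in> A \<Longrightarrow> s \<le> p \<or> q \<le> s" "\<And>s. s \<in> B \<Longrightarrow> p \<le> s \<and> s \<le> q"
  shows "polygon \<kappa> ori (A \<union> B)"
proof -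
  have A: "polygon \<kappa> ori (insert y A)" if "y \<in> B" for y
  proof (cases "y \<in> A")
    case False
    then have "p < y" "y < q" using that pq by (metis IntE le_neq_implies_less)+
    moreover have "tri \<kappa> ori p y q" using AB(4) that pq calculation unfolding polygon_def by blast
    ultimately show ?thesis using polygon_insert[OF adm AB(1,3)] pq AB(2) that by blast
  qed (use AB in \<open>auto simp: insert_absorb\<close>)
  have P: "tri \<kappa> ori i j k" if "i \<in> B" "j \<in> B" "k \<in> B" "i < j" "j < k" for i j k
    using AB(4) that unfolding polygon_def by blast
  have A3: "tri \<kappa> ori i j k" if "y \<in> B" "i \<in> insert y A" "j \<in> insert y A" "k \<in> insert y A" "i < j" "j < k" for i j k y
    using A[OF that(1)] that unfolding polygon_def by blast
  have L: "tri \<kappa> ori x a b" if "x \<in> A" "x < p" "a \<in> B" "b \<in> B" "a < b" for x a b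
  proof (cases "b = q \<or> b \<in> A")
    case True
    then have "b \<in> A" using pq by blast
    then show ?thesis by (intro A3[of a]) (use that pq(5)[of a] in auto)
  next
    case False
    then have bq: "b < q" using pq(5)[of b] that by auto
    have ap: "p \<le> a" using pq(5) that by blast
    show ?thesis
    proof (rule flip_diagonal_jl(1)[OF adm, of x a b q])
      show "distinct [x, a, b, q]" using ap bq that by auto
      show "{x, a, b, q} \<subseteq> {1..t}" using AB(1,2) that pq by blast
      show "tri \<kappa> ori x a q" by (rule A3[of a]) (use that bq ap pq(1-3) in auto)
      show "tri \<kappa> ori a b q" by (rule P) (use that bq pq in auto)
    qed
  qed
  have R: "tri \<kappa> ori a b x" if "x \<in> A" "q < x" "a \<in> B" "b \<in> B" "a < b" for x a b
  proof (cases "a = p \<or> a \<in> A")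
    case True
    then have "a \<in> A" using pq by blast
    then show ?thesis by (intro A3[of b]) (use that pq(5)[of b] in auto)
  next
    case False
    then have pa: "p < a" using pq(5)[of a] that by auto
    have bq: "b \<le> q" using pq(5) that by blast
    show ?thesis
    proof (rule flip_diagonal_ik(2)[OF adm, of p a b x])
      show "distinct [p, a, b, x]" using pa bq that by auto
      show "{p, a, b, x} \<subseteq> {1..t}" using AB(1,2) that pq by blast
      show "tri \<kappa> ori p b x" by (rule A3[of b]) (use that bq pa pq(1-3) in auto)
      show "tri \<kappa> ori p a b" by (rule P) (use that pa pq in auto)
    qed
  qed
  show ?thesis unfolding polygon_def
  proof (intro ballI impI)
    fix i j k assume a: "i \<in> A \<union> B" "j \<in> A \<union> B" "k \<in> A \<union> B" "i < j \<and> j < k"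
    consider "i \<in> B" "j \<in> B" "k \<in> B" | "i \<notin> B" "j \<in> B" "k \<in> B" | "j \<notin> B" "i \<in> B" "k \<in> B"
      | "k \<notin> B" "i \<in> B" "j \<in> B" | y where "y \<in> B" "{i, j, k} \<subseteq> insert y A"
      using a pq(1) by blast
    then show "tri \<kappa> ori i j k"
    proof cases
      case 1 then show ?thesis using P a by blast
    next
      case 2
      then have "i \<in> A" "i < p" using a pq(4)[of i] pq(5)[of j] pq(5)[of k] pq(1-3)
        by (auto simp: nat_less_le)
      then show ?thesis using L 2 a by blast
    next
      \<comment> \<open>Impossible: a vertex of \<open>A\<close> outside \<open>B\<close> does not
        lie strictly between \<open>p\<close> and \<open>q\<close>, whereas \<open>i\<close> and
        \<open>k\<close> lie in that interval.\<close>
      case 3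
      then have "j \<in> A" "j \<noteq> p" "j \<noteq> q" using a pq by auto
      then show ?thesis using pq(4)[of j] pq(5)[of i] pq(5)[of k] 3 a by linarith
    next
      case 4
      then have "k \<in> A" "q < k" using a pq(4)[of k] pq(5)[of i] pq(5)[of j] pq(1-3)
        by (auto simp: nat_less_le)
      then show ?thesis using R 4 a by blast
    next
      case 5 then show ?thesis using A3[of y i j k] a by blast
    qed
  qed
qed


text \<open>Positivity of all double ratios along the edge \<open>(p, q)\<close> with opposite vertices \<open>x\<close> and \<open>y\<close>,
  freed of denominators.\<close>

definition separated :: "nat \<Rightarrow> nat \<Rightarrow> nat \<Rightarrow> nat \<Rightarrow> bool" where
  "separated p q x y \<longleftrightarrow> (\<forall>a b. a + b + 2 = d \<longrightarrow>
     br3 p q x (Suc a) b 1 * br3 p q x a (Suc b) 1 * (br3 p q y (Suc a) b 1 * br3 p q y a (Suc b) 1) < 0)"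

lemma separated_sym: "separated p q x y \<longleftrightarrow> separated p q y x"
  unfolding separated_def by (simp only: mult.commute mult.left_commute)

text \<open>Reversing the edge exchanges the two leading blocks; the resulting signs occur once for
  \<open>x\<close> and once for \<open>y\<close>, so they cancel.\<close>

lemma separated_swap:
  assumes "separated p q x y" shows "separated q p x y"
  unfolding separated_def
proof (intro allI impI)
  fix a b assume ab: "a + b + 2 = d"
  have sw: "br3 q p z i j 1 = (-1) ^ (i * j) * br3 p q z j i 1" if "i + j + 1 = d" for z i j
    using brk_block_swap[of "blk (v q) i" "blk (v p) j" "blk (v z) 1" d] that by simp
  have sq: "((-1::real) ^ n) * ((-1) ^ n) = 1" for n :: nat
    by (simp flip: power_add mult_2)
  have "br3 q p x (Suc a) b 1 * br3 q p x a (Suc b) 1 * (br3 q p y (Suc a) b 1 * br3 q p y a (Suc b) 1) =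
    ((-1) ^ (Suc a * b) * (-1) ^ (Suc a * b)) * ((-1) ^ (a * Suc b) * (-1) ^ (a * Suc b)) *
    (br3 p q x (Suc b) a 1 * br3 p q x b (Suc a) 1 * (br3 p q y (Suc b) a 1 * br3 p q y b (Suc a) 1))"
  proof -
    have "br3 q p z (Suc a) b 1 = (-1) ^ (Suc a * b) * br3 p q z b (Suc a) 1"
      "br3 q p z a (Suc b) 1 = (-1) ^ (a * Suc b) * br3 p q z (Suc b) a 1" for z
      by (rule sw, use ab in simp)+
    then show ?thesis by (simp only: mult_ac)
  qed
  also have "\<dots> < 0" unfolding sq using assms ab unfolding separated_def by (simp add: add.commute)
  finally show "br3 q p x (Suc a) b 1 * br3 q p x a (Suc b) 1 * (br3 q p y (Suc a) b 1 * br3 q p y a (Suc b) 1) < 0" .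
qed

lemma neg_cancel: "x * y < 0 \<Longrightarrow> y < 0 \<Longrightarrow> 0 < (x::real)"
  by (simp add: mult_less_0_iff)

lemma unit_pos_eq: "0 < x \<Longrightarrow> x * x = 1 \<Longrightarrow> x = (1::real)"
  using square_eq_1_iff by fastforce

text \<open>Two orientations of the shared edge can only differ by the twist \<open>s \<mapsto> \<mu> ^ s\<close>, because
  the double ratios force the quotient to have period two.\<close>

lemma edge_orientations_agree:
  assumes k: "\<kappa> * \<kappa> = 1" "\<kappa>' * \<kappa>' = 1" "\<tau> * \<tau> = 1" "\<tau>' * \<tau>' = 1"
    and o: "orientation d \<alpha>" "orientation d \<beta>" "orientation d \<alpha>'" "orientation d \<beta>'"
    and sep: "separated p q x y"
    and e: "\<And>a b. a + b = d \<Longrightarrow> 0 < \<kappa> * \<alpha> a * \<beta> b * brk d (blk (v p) a @ blk (v q) b)"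
      "\<And>a b. a + b = d \<Longrightarrow> 0 < \<kappa>' * \<alpha>' a * \<beta>' b * brk d (blk (v p) a @ blk (v q) b)"
    and tx: "\<And>a b. a + b + 1 = d \<Longrightarrow> 0 < \<kappa> * \<tau> * \<alpha> a * \<beta> b * br3 p q x a b 1"
    and ty: "\<And>a b. a + b + 1 = d \<Longrightarrow> 0 < \<kappa>' * \<tau>' * (-1) ^ b * \<alpha>' a * \<beta>' b * br3 p q y a b 1"
  obtains \<mu> :: real where "\<mu> * \<mu> = 1" "\<kappa>' = \<kappa> * \<mu> ^ d"
    "\<And>s. s \<le> d \<Longrightarrow> \<alpha> s = \<alpha>' s * \<mu> ^ s" "\<And>s. s \<le> d \<Longrightarrow> \<beta> s = \<beta>' s * \<mu> ^ s"
proof -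
  define r where "r s = \<alpha> s * \<alpha>' s" for s
  define u where "u s = \<beta> s * \<beta>' s" for s
  define \<mu> where "\<mu> = r 1"
  have unit: "\<alpha> s * \<alpha> s = 1" "\<beta> s * \<beta> s = 1" "\<alpha>' s * \<alpha>' s = 1" "\<beta>' s * \<beta>' s = 1" if "s \<le> d" for s
    using o that by (auto simp: orientation_def)
  have zero: "\<alpha> 0 = 1" "\<beta> 0 = 1" "\<alpha>' 0 = 1" "\<beta>' 0 = 1"
    using o by (auto simp: orientation_def)
  have mm: "x * y * (x * y) = (1::real)" if "x * x = 1" "y * y = 1" for x y
  proof -
    have "x * y * (x * y) = (x * x) * (y * y)" by (simp only: mult_ac)
    then show ?thesis using that by simp
  qed
  have rr: "r s * r s = 1" if "s \<le> d" for s unfolding r_def using unit that by (intro mm)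
  have uu: "u s * u s = 1" if "s \<le> d" for s unfolding u_def using unit that by (intro mm)
  have kk: "\<kappa> * \<kappa>' * (\<kappa> * \<kappa>') = 1" using k by (intro mm)
  \<comment> \<open>Both orientations make the same two-flag bracket positive; multiplying the two
    inequalities eliminates the bracket.\<close>
  have ru: "\<kappa> * \<kappa>' * (r a * u b) = 1" if ab: "a + b = d" for a b
  proof (rule unit_pos_eq)
    let ?B = "brk d (blk (v p) a @ blk (v q) b)"
    have "0 < (\<kappa> * \<alpha> a * \<beta> b * ?B) * (\<kappa>' * \<alpha>' a * \<beta>' b * ?B)" using e[OF ab] by (rule mult_pos_pos)
    also have "\<dots> = (\<kappa> * \<kappa>' * (r a * u b)) * (?B * ?B)" by (simp only: r_def u_def mult_ac)
    finally show "0 < \<kappa> * \<kappa>' * (r a * u b)" by (metis zero_less_mult_pos2 not_square_less_zero mult_zero_right linorder_neqE_linordered_idom less_irrefl)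
    show "\<kappa> * \<kappa>' * (r a * u b) * (\<kappa> * \<kappa>' * (r a * u b)) = 1"
      by (intro mm kk rr uu) (use ab in auto)
  qed
  have u_r: "u b = \<kappa> * \<kappa>' * r (d - b)" if "b \<le> d" for b
  proof -
    have "\<kappa> * \<kappa>' * r (d - b) = (\<kappa> * \<kappa>' * (r (d - b) * u b)) * (\<kappa> * \<kappa>' * r (d - b))" using ru[of "d - b" b] that by simp
    also have "\<dots> = (\<kappa> * \<kappa>' * (\<kappa> * \<kappa>')) * (r (d - b) * r (d - b)) * u b" by (simp only: mult_ac)
    finally show ?thesis using kk rr[of "d - b"] by simp
  qed
  \<comment> \<open>The factor -1 from \<open>(-1) ^ b * (-1) ^ Suc b\<close> meets the negative
    product in \<open>separated\<close>, which leaves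
    \<open>r (Suc a) * r a * (u b * u (Suc b)) = 1\<close>. Substituting \<open>u_r\<close> reduces
    this to \<open>r a * r (a + 2) = 1\<close>.\<close>
  have per: "r (a + 2) = r a" if ab: "a + 2 \<le> d" for a
  proof -
    define b where "b = d - (a + 2)"
    have abd: "a + b + 2 = d" using ab by (simp add: b_def)
    let ?X = "br3 p q x (Suc a) b 1 * br3 p q x a (Suc b) 1"
    let ?Y = "br3 p q y (Suc a) b 1 * br3 p q y a (Suc b) 1"
    have XY: "?X * ?Y < 0" using sep abd unfolding separated_def by blast
    have "0 < (\<kappa> * \<tau> * \<alpha> (Suc a) * \<beta> b * br3 p q x (Suc a) b 1) * (\<kappa> * \<tau> * \<alpha> a * \<beta> (Suc b) * br3 p q x a (Suc b) 1) *
      ((\<kappa>' * \<tau>' * (-1) ^ b * \<alpha>' (Suc a) * \<beta>' b * br3 p q y (Suc a) b 1) *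
       (\<kappa>' * \<tau>' * (-1) ^ Suc b * \<alpha>' a * \<beta>' (Suc b) * br3 p q y a (Suc b) 1))"
      by (intro mult_pos_pos tx ty) (use abd in auto)
    also have "\<dots> = (\<kappa> * \<kappa>) * (\<kappa>' * \<kappa>') * (\<tau> * \<tau>) * (\<tau>' * \<tau>') * ((-1) ^ b * (-1) ^ Suc b) *
      (r (Suc a) * r a * (u b * u (Suc b))) * (?X * ?Y)"
      by (simp only: r_def u_def mult_ac)
    also have "(-1::real) ^ b * (-1) ^ Suc b = -1" by (simp flip: power_add mult_2)
    finally have "r (Suc a) * r a * (u b * u (Suc b)) * (?X * ?Y) < 0" unfolding k by simp
    then have "0 < r (Suc a) * r a * (u b * u (Suc b))" using XY by (rule neg_cancel)
    moreover have "r (Suc a) * r a * (u b * u (Suc b)) * (r (Suc a) * r a * (u b * u (Suc b))) = 1"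
      by (intro mm rr uu) (use abd in auto)
    ultimately have "r (Suc a) * r a * (u b * u (Suc b)) = 1" by (rule unit_pos_eq)
    moreover have "u b = \<kappa> * \<kappa>' * r (a + 2)" "u (Suc b) = \<kappa> * \<kappa>' * r (Suc a)"
      using u_r[of b] u_r[of "Suc b"] abd by (auto simp flip: abd)
    ultimately have "1 = r (Suc a) * r a * (\<kappa> * \<kappa>' * r (a + 2) * (\<kappa> * \<kappa>' * r (Suc a)))" by simp
    also have "\<dots> = (\<kappa> * \<kappa>' * (\<kappa> * \<kappa>')) * (r (Suc a) * r (Suc a)) * (r a * r (a + 2))" by (simp only: mult_ac)
    finally have "r a * r (a + 2) = 1" using kk rr[of "Suc a"] ab by simp
    then have "r a * r a * r (a + 2) = r a" by (metis mult.assoc mult.commute mult_1)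
    then show ?thesis using rr[of a] ab by simp
  qed
  have mu: "\<mu> * \<mu> = 1" using rr[of 1] d1 by (simp add: \<mu>_def)
  have r: "r s = \<mu> ^ s" if "s \<le> d" for s
    using that
  proof (induction s rule: less_induct)
    case (less s)
    consider "s = 0" | "s = 1" | s' where "s = s' + 2"
      by (metis One_nat_def Suc_1 add.commute add_2_eq_Suc' not0_implies_Suc)
    then show ?case
    proof cases
      case 3
      then have "r s = \<mu> ^ s'" using per[of s'] less by simp
      then show ?thesis using 3 mu by (simp add: power_add power2_eq_square)
    qed (use zero in \<open>auto simp: r_def \<mu>_def\<close>)
  qed
  have kmu: "\<kappa> * \<kappa>' * \<mu> ^ d = 1"
    using ru[of d 0] r[of d] zero by (simp add: u_def)
  have powsq: "\<mu> ^ n * \<mu> ^ n = 1" for n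
    by (metis mu power_mult_distrib power_one)
  have kap: "\<kappa>' = \<kappa> * \<mu> ^ d"
  proof -
    have "\<kappa> * \<mu> ^ d = (\<kappa> * \<kappa>' * \<mu> ^ d) * (\<kappa> * \<mu> ^ d)" using kmu by simp
    also have "\<dots> = (\<kappa> * \<kappa>) * (\<mu> ^ d * \<mu> ^ d) * \<kappa>'" by (simp only: mult_ac)
    finally show ?thesis using k powsq by simp
  qed
  have u: "u s = \<mu> ^ s" if "s \<le> d" for s
  proof -
    have "u s = \<kappa> * \<kappa> * \<mu> ^ d * \<mu> ^ (d - s)" unfolding u_r[OF that] r[OF diff_le_self] kap by (simp only: mult_ac)
    also have "\<mu> ^ d = \<mu> ^ s * \<mu> ^ (d - s)" using that by (simp flip: power_add)
    finally have "u s = \<kappa> * \<kappa> * (\<mu> ^ (d - s) * \<mu> ^ (d - s)) * \<mu> ^ s" by (simp only: mult_ac)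
    then show ?thesis using k powsq by simp
  qed
  have "\<alpha> s = \<alpha>' s * \<mu> ^ s" if "s \<le> d" for s
    using r[OF that] unit[OF that] unfolding r_def by (metis mult.left_commute mult.right_neutral)
  moreover have "\<beta> s = \<beta>' s * \<mu> ^ s" if "s \<le> d" for s
    using u[OF that] unit[OF that] unfolding u_def by (metis mult.left_commute mult.right_neutral)
  ultimately show ?thesis using that mu kap by blast
qed

text \<open>Multiplying each \<open>ori' i s\<close> by \<open>\<mu> ^ s\<close> changes every
  bracket of total degree \<open>d\<close> by the constant \<open>\<mu> ^ d\<close>, which is
  exactly the discrepancy between the two common signs. Afterwards the orientations coincide on the
  shared edge.\<close>

lemma polygon_glue:
  assumes A: "A \<subseteq> {1..t}" "admissible \<kappa> ori" "polygon \<kappa> ori A"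
    and B: "B \<subseteq> {1..t}" "admissible \<kappa>' ori'" "polygon \<kappa>' ori' B"
    and pq: "p \<in> A \<inter> B" "q \<in> A \<inter> B" "p < q" "\<And>s. s \<in> A \<Longrightarrow> s \<le> p \<or> q \<le> s" "\<And>s. s \<in> B \<Longrightarrow> p \<le> s \<and> s \<le> q"
    and xy: "x \<in> A" "x < p \<or> q < x" "y \<in> B" "p < y" "y < q" "separated p q x y"
  obtains \<kappa>'' ori'' where "admissible \<kappa>'' ori''" "polygon \<kappa>'' ori'' (A \<union> B)"
proof -
  have or: "orientation d (ori i)" "orientation d (ori' i)" and k: "\<kappa> * \<kappa> = 1" "\<kappa>' * \<kappa>' = 1" for i
    using A B by (auto simp: admissible_def)
  have unit: "ori i s * ori i s = 1" "ori' i s * ori' i s = 1" if "s \<le> d" for i s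
    using or that by (auto simp: orientation_def)
  have zero: "ori i 0 = 1" "ori' i 0 = 1" for i
    using or by (auto simp: orientation_def)
  have sq: "((-1::real) ^ n) * ((-1) ^ n) = 1" for n :: nat
    by (simp flip: power_add mult_2)
  \<comment> \<open>The sign of \<open>x\<close> once it is written as the last vector. If
    \<open>x\<close> precedes \<open>p\<close>, it has to pass the other \<open>d - 1\<close>
    vectors.\<close>
  define \<tau> where "\<tau> = (if q < x then ori x 1 else (-1) ^ (d - 1) * ori x 1)"
  have t1: "\<tau> * \<tau> = 1" using unit(1)[OF d1, of x] sq[of "d - 1"] by (auto simp: \<tau>_def algebra_simps)
  have y1: "ori' y 1 * ori' y 1 = 1" using unit d1 by blast
  have Ty: "tri \<kappa>' ori' p y q" using B(3) pq xy unfolding polygon_def by blast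
  have Tx: "if q < x then tri \<kappa> ori p q x else tri \<kappa> ori x p q" using A(3) pq xy unfolding polygon_def by auto
  have e: "0 < \<kappa> * ori p a * ori q b * brk d (blk (v p) a @ blk (v q) b)" if ab: "a + b = d" for a b
  proof (cases "q < x")
    case True
    then have "tri \<kappa> ori p q x" using Tx by simp
    then have "0 < \<kappa> * ori p a * ori q b * ori x 0 * br3 p q x a b 0"
      using ab unfolding tri_def by (metis add_0_right)
    then show ?thesis using zero by simp
  next
    case False
    then have "tri \<kappa> ori x p q" using Tx by simp
    then have "0 < \<kappa> * ori x 0 * ori p a * ori q b * br3 x p q 0 a b"
      using ab unfolding tri_def by (metis add_0)
    then show ?thesis using zero by simp
  qed
  have e': "0 < \<kappa>' * ori' p a * ori' q b * brk d (blk (v p) a @ blk (v q) b)" if ab: "a + b = d" for a b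
  proof -
    have "0 < \<kappa>' * ori' p a * ori' y 0 * ori' q b * br3 p y q a 0 b" using Ty ab unfolding tri_def by (metis add_0_right)
    then show ?thesis using zero by simp
  qed
  have tx: "0 < \<kappa> * \<tau> * ori p a * ori q b * br3 p q x a b 1" if ab: "a + b + 1 = d" for a b
  proof (cases "q < x")
    case True
    then have "tri \<kappa> ori p q x" using Tx by simp
    then have "0 < \<kappa> * ori p a * ori q b * ori x 1 * br3 p q x a b 1" using ab unfolding tri_def by metis
    then show ?thesis using True by (simp add: \<tau>_def mult_ac)
  next
    case False
    then have "tri \<kappa> ori x p q" using Tx by simp
    then have "0 < \<kappa> * ori x 1 * ori p a * ori q b * br3 x p q 1 a b" using ab unfolding tri_def by (metis add.commute add.assoc)
    moreover have "br3 x p q 1 a b = (-1) ^ (d - 1) * br3 p q x a b 1"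
      using brk_block_swap[of "blk (v x) 1" "blk (v p) a @ blk (v q) b" "[]" d] ab by (simp flip: ab)
    ultimately show ?thesis using False by (simp add: \<tau>_def mult_ac)
  qed
  \<comment> \<open>The vertex \<open>y\<close> lies between \<open>p\<close> and \<open>q\<close>,
    so moving it to the end passes the \<open>b\<close> vectors of \<open>q\<close>. This
    alternation in \<open>b\<close>, absent on the side of \<open>x\<close>, accounts for the minus
    sign in the double ratio.\<close>
  have ty: "0 < \<kappa>' * ori' y 1 * (-1) ^ b * ori' p a * ori' q b * br3 p q y a b 1" if ab: "a + b + 1 = d" for a b
  proof -
    have "0 < \<kappa>' * ori' p a * ori' y 1 * ori' q b * br3 p y q a 1 b" using Ty ab unfolding tri_def by (metis add.commute add.assoc)
    moreover have "br3 p y q a 1 b = (-1) ^ b * br3 p q y a b 1"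
      using brk_move[of "blk (v p) a" "blk (v q) b" "[]" d "v y 1"] ab by simp
    ultimately show ?thesis by (simp add: mult_ac)
  qed
  obtain \<mu> where mu: "\<mu> * \<mu> = 1" "\<kappa>' = \<kappa> * \<mu> ^ d"
    "\<And>s. s \<le> d \<Longrightarrow> ori p s = ori' p s * \<mu> ^ s" "\<And>s. s \<le> d \<Longrightarrow> ori q s = ori' q s * \<mu> ^ s"
    using edge_orientations_agree[OF k t1 y1 or(1)[of p] or(1)[of q] or(2)[of p] or(2)[of q] xy(6) e e' tx ty] by blast
  have powsq: "\<mu> ^ n * \<mu> ^ n = 1" for n
    by (metis mu(1) power_mult_distrib power_one)
  \<comment> \<open>On the shared vertices \<open>p\<close> and \<open>q\<close> both formulas
    agree, so the case distinction respects the orientation of \<open>B\<close> as well.\<close>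
  define ori'' where "ori'' i = (if i \<in> A then ori i else (\<lambda>s. ori' i s * \<mu> ^ s))" for i
  have adm: "admissible \<kappa> ori''"
    unfolding admissible_def
  proof (intro conjI allI k)
    fix i
    have eq: "ori' i s * \<mu> ^ s * (ori' i s * \<mu> ^ s) = (ori' i s * ori' i s) * (\<mu> ^ s * \<mu> ^ s)" for s
      by (simp only: mult_ac)
    have "ori' i s * \<mu> ^ s * (ori' i s * \<mu> ^ s) = 1" if "s \<le> d" for s
      unfolding eq unit(2)[OF that, of i] powsq by simp
    then show "orientation d (ori'' i)" using or zero by (auto simp: ori''_def orientation_def)
  qed
  have pA: "polygon \<kappa> ori'' A"
    using A(3) by (auto simp: polygon_def tri_def ori''_def)
  have eqB: "ori'' i s = ori' i s * \<mu> ^ s" if "i \<in> B" "s \<le> d" for i s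
  proof (cases "i \<in> A")
    case True
    then have "i = p \<or> i = q" using pq(4)[of i] pq(5)[of i] that by auto
    then show ?thesis using mu that True by (auto simp: ori''_def)
  qed (simp add: ori''_def)
  have pB: "polygon \<kappa> ori'' B"
    unfolding polygon_def tri_def
  proof (intro ballI impI allI)
    fix i j k a b c assume ijk: "i \<in> B" "j \<in> B" "k \<in> B" "i < j \<and> j < k" and abc: "a + b + c = d"
    then have "0 < \<kappa>' * ori' i a * ori' j b * ori' k c * br3 i j k a b c"
      using B(3) unfolding polygon_def tri_def by blast
    also have "\<dots> = \<kappa> * (\<mu> ^ (a + b + c)) * ori' i a * ori' j b * ori' k c * br3 i j k a b c"
      unfolding mu(2) abc ..
    also have "\<dots> = \<kappa> * ori'' i a * ori'' j b * ori'' k c * br3 i j k a b c"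
    proof -
      have "a \<le> d" "b \<le> d" "c \<le> d" using abc by auto
      then show ?thesis using ijk by (simp only: eqB power_add mult_ac)
    qed
    finally show "0 < \<kappa> * ori'' i a * ori'' j b * ori'' k c * br3 i j k a b c" .
  qed
  show ?thesis
    by (rule that[OF adm]) (rule polygon_union[OF adm A(1) B(1) pA pB pq])
qed


lemma polygon_triangle:
  assumes ijk: "i < j" "j < k" "{i, j, k} \<subseteq> {1..t}"
    and hex: "\<And>a b c. a + b + c + 3 = d \<Longrightarrow>
      0 < br3 i j k a (b+1) (c+2) * br3 i j k (a+2) (b+1) c * br3 i j k (a+1) (b+2) c *
      br3 i j k (a+1) b (c+2) * br3 i j k (a+2) b (c+1) * br3 i j k a (b+2) (c+1)"
  obtains \<kappa> ori where "admissible \<kappa> ori" "polygon \<kappa> ori {i, j, k}"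
proof -
  have nz: "br3 i j k a b c \<noteq> 0" if "a + b + c = d" for a b c
    by (rule br3_nz[OF _ ijk(3) that]) (use ijk in auto)
  obtain \<kappa> \<alpha> \<beta> \<gamma> where o: "\<kappa> * \<kappa> = 1" "orientation d \<alpha>" "orientation d \<beta>" "orientation d \<gamma>"
    and p: "\<And>a b c. a + b + c = d \<Longrightarrow> 0 < \<kappa> * \<alpha> a * \<beta> b * \<gamma> c * br3 i j k a b c"
    using triple_orientation[of d "br3 i j k", OF d1 nz hex] by metis
  define ori where "ori x = (if x = i then \<alpha> else if x = j then \<beta> else if x = k then \<gamma> else (\<lambda>_. 1))" for x
  have "orientation d (\<lambda>_. 1)" by (simp add: orientation_def)
  then have "admissible \<kappa> ori" using o by (auto simp: admissible_def ori_def)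
  moreover have "tri \<kappa> ori i j k"
    using p ijk by (auto simp: tri_def ori_def)
  then have "polygon \<kappa> ori {i, j, k}"
    unfolding polygon_def using ijk by auto
  ultimately show ?thesis by (rule that)
qed

end

text \<open>The apex is the largest \<open>m < q\<close> joined to \<open>p\<close>; the neighbour
  \<open>Suc p\<close> is a candidate because a side of the polygon crosses no chord. If
  \<open>m q\<close> were not an edge, some edge would cross it from a point \<open>x\<close>
  between \<open>m\<close> and \<open>q\<close>. As that edge crosses neither \<open>p q\<close> nor
  \<open>p m\<close>, its other end is \<open>p\<close>, against the choice of
  \<open>m\<close>.\<close>

lemma triangulation_apex:
  assumes T: "oriented_triangulation t T" and e: "is_edge T p q" and pq: "Suc p < q"
  obtains m where "p < m" "m < q" "is_edge T p m" "is_edge T m q"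
proof -
  have in_t: "i \<in> {1..t}" "k \<in> {1..t}" if "is_edge T i k" for i k
    using T that unfolding oriented_triangulation_def is_edge_def by blast+
  have nc: "\<not> chords_cross i k j l" if "is_edge T i k" "is_edge T j l" for i k j l
  proof -
    have "\<not> chords_cross i k j l" if "(i, k) \<in> T" "(j, l) \<in> T" for i k j l
      using T that unfolding oriented_triangulation_def by blast
    moreover have "chords_cross i k l j" "chords_cross k i j l" "chords_cross k i l j" if "chords_cross i k j l"
      using that by (auto simp: chords_cross_def cyclically_ordered_def)
    ultimately show ?thesis using that unfolding is_edge_def by blast
  qed
  have mx: "\<exists>j l. is_edge T j l \<and> chords_cross i k j l"
    if "i \<in> {1..t}" "k \<in> {1..t}" "i \<noteq> k" "\<not> is_edge T i k" for i k
    using T that unfolding oriented_triangulation_def is_edge_def by blast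
  have p1: "is_edge T p (Suc p)"
  proof (rule ccontr)
    assume "\<not> is_edge T p (Suc p)"
    then obtain j l where "chords_cross p (Suc p) j l"
      using mx[of p "Suc p"] in_t[OF e] pq by auto
    then show False by (auto simp: chords_cross_def cyclically_ordered_def)
  qed
  define M where "M = {x. p < x \<and> x < q \<and> is_edge T p x}"
  have M: "finite M" "Suc p \<in> M" using p1 pq by (auto simp: M_def)
  define m where "m = Max M"
  have mM: "m \<in> M" unfolding m_def using M Max_in by blast
  have mmax: "x \<le> m" if "x \<in> M" for x unfolding m_def using M that by simp
  have m: "p < m" "m < q" "is_edge T p m" using mM by (auto simp: M_def)
  have "is_edge T m q"
  proof (rule ccontr)
    assume "\<not> is_edge T m q"
    then obtain j l where jl: "is_edge T j l" "chords_cross m q j l"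
      using mx[of m q] in_t[OF e] in_t[OF m(3)] m by auto
    then obtain x y where xy: "is_edge T x y" "m < x" "x < q" "y < m \<or> q < y"
      using m(2) by (auto simp: chords_cross_def cyclically_ordered_def is_edge_def)
    have "y = p"
    proof (rule ccontr)
      assume "y \<noteq> p"
      then have "chords_cross p q x y \<or> chords_cross p m y x"
        using xy m by (auto simp: chords_cross_def cyclically_ordered_def)
      moreover have "is_edge T y x" using xy by (auto simp: is_edge_def)
      ultimately show False using nc e m xy by blast
    qed
    then have "x \<in> M" using xy m by (auto simp: M_def is_edge_def)
    from mmax[OF this] show False using xy(2) by simp
  qed
  then show ?thesis using that m by blast
qed

text \<open>A chord crossing this side would need an endpoint outside the range from 1 to
  \<open>t\<close>, so maximality forces the side into the triangulation.\<close>

lemma triangulation_long_edge: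
  assumes T: "oriented_triangulation t T" and t: "2 \<le> t"
  shows "is_edge T 1 t"
proof (rule ccontr)
  assume "\<not> is_edge T 1 t"
  then have "(1, t) \<notin> T" "(t, 1) \<notin> T" by (auto simp: is_edge_def)
  moreover have "(1::nat) \<in> {1..t}" "t \<in> {1..t}" "1 \<noteq> t" using t by auto
  ultimately have "\<exists>(j, l)\<in>T. chords_cross 1 t j l"
    using T unfolding oriented_triangulation_def by blast
  then obtain j l where "(j, l) \<in> T" "chords_cross 1 t j l" by blast
  moreover from this have "j \<in> {1..t}" "l \<in> {1..t}"
    using T unfolding oriented_triangulation_def by blast+
  ultimately show False by (auto simp: chords_cross_def cyclically_ordered_def)
qed

section \<open>Induction over a triangulation\<close>

locale positive_flags = generic_flags +
  fixes T :: "(nat \<times> nat) set"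
  assumes triangulation: "oriented_triangulation t T"
    and triangle: "\<And>i j k a b c. i < j \<Longrightarrow> j < k \<Longrightarrow> is_triangle T i j k \<Longrightarrow> a + b + c + 3 = d \<Longrightarrow>
      0 < br3 i j k a (b+1) (c+2) * br3 i j k (a+2) (b+1) c * br3 i j k (a+1) (b+2) c *
      br3 i j k (a+1) b (c+2) * br3 i j k (a+2) b (c+1) * br3 i j k a (b+2) (c+1)"
    and quadrilateral: "\<And>i j k l. (i, k) \<in> T \<Longrightarrow> cyclically_ordered i j k l \<Longrightarrow>
      is_triangle T i j k \<Longrightarrow> is_triangle T i k l \<Longrightarrow> separated i k j l"
begin

lemma edge_sym: "is_edge T i j \<longleftrightarrow> is_edge T j i"
  by (auto simp: is_edge_def)

lemma edge_in: "is_edge T i j \<Longrightarrow> i \<in> {1..t} \<and> j \<in> {1..t}"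
  using triangulation unfolding oriented_triangulation_def is_edge_def by blast

text \<open>The triangulation records the edge in one direction only. The opposite direction yields
  the condition with \<open>p\<close> and \<open>q\<close> exchanged, which
  \<open>separated_swap\<close> undoes.\<close>

lemma edge_separated:
  assumes "is_edge T p q" "p < y" "y < q" "x < p \<or> q < x"
    "is_edge T p y" "is_edge T y q" "is_edge T p x" "is_edge T x q"
  shows "separated p q x y"
proof -
  consider "(p, q) \<in> T" | "(q, p) \<in> T" using assms(1) by (auto simp: is_edge_def)
  then show ?thesis
  proof cases
    case 1
    then have "separated p q y x"
      by (rule quadrilateral)
        (use assms edge_sym[of x q] in \<open>auto simp: cyclically_ordered_def is_triangle_def\<close>)
    then show ?thesis using separated_sym by blast
  next
    case 2
    then have "separated q p x y"
      by (rule quadrilateral)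
        (use assms edge_sym[of x q] edge_sym[of p x] edge_sym[of p y] edge_sym[of y q] edge_sym[of p q]
          in \<open>auto simp: cyclically_ordered_def is_triangle_def\<close>)
    then show ?thesis by (rule separated_swap)
  qed
qed

text \<open>The triangle over the edge \<open>p q\<close> with apex \<open>m\<close> leaves two
  shorter intervals, which are glued to it along \<open>p m\<close> and \<open>m q\<close>. Adjacent
  endpoints leave no triples to orient.\<close>

lemma polygon_interval:
  assumes "is_edge T p q" "p < q"
  shows "\<exists>\<kappa> ori. admissible \<kappa> ori \<and> polygon \<kappa> ori {p..q}"
  using assms
proof (induction "q - p" arbitrary: p q rule: less_induct)
  case less
  note e = less.prems(1) and pq = less.prems(2)
  show ?case
  proof (cases "Suc p < q")
    case False
    then have "polygon 1 (\<lambda>_ _. 1) {p..q}" by (auto simp: polygon_def)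
    moreover have "admissible 1 (\<lambda>_ _. 1)" by (simp add: admissible_def orientation_def)
    ultimately show ?thesis by blast
  next
    case True
    obtain m where m: "p < m" "m < q" "is_edge T p m" "is_edge T m q"
      using triangulation_apex[OF triangulation e True] by blast
    have in_t: "{p..q} \<subseteq> {1..t}" using edge_in[OF e] by auto
    have tri: "is_triangle T p m q" using m e by (simp add: is_triangle_def)
    obtain \<kappa>0 o0 where P0: "admissible \<kappa>0 o0" "polygon \<kappa>0 o0 {p, m, q}"
    proof (rule polygon_triangle[OF m(1,2) _ triangle[OF m(1,2) tri]])
      show "{p, m, q} \<subseteq> {1..t}" using in_t m by auto
    qed auto
    \<comment> \<open>The result of gluing along \<open>p m\<close>; if this edge is a side of the
      polygon, the triangle alone already has the required vertex set.\<close>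
    obtain \<kappa>1 o1 where P1: "admissible \<kappa>1 o1" "polygon \<kappa>1 o1 (insert q {p..m})"
    proof (cases "Suc p < m")
      case False
      then have "insert q {p..m} = {p, m, q}" using m by auto
      then show ?thesis using that P0 by simp
    next
      case True
      obtain y where y: "p < y" "y < m" "is_edge T p y" "is_edge T y m"
        using triangulation_apex[OF triangulation m(3) True] by blast
      obtain \<kappa>' o' where P': "admissible \<kappa>' o'" "polygon \<kappa>' o' {p..m}"
        using less.hyps[of m p, OF _ m(3,1)] diff_less_mono[of m q p] m by auto
      have "separated p m q y"
        by (rule edge_separated) (use m y e edge_sym[of p m] edge_sym[of q m] in \<open>simp_all\<close>)
      then obtain \<kappa>'' o'' where "admissible \<kappa>'' o''" "polygon \<kappa>'' o'' ({p, m, q} \<union> {p..m})"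
        by (rule polygon_glue[OF _ P0 _ P', of p m q y, rotated -2]) (use m(1,2) y(1,2) in_t in auto)
      moreover have "{p, m, q} \<union> {p..m} = insert q {p..m}" using m by auto
      ultimately show ?thesis using that by simp
    qed
    show ?thesis
    proof (cases "Suc m < q")
      case False
      then have "insert q {p..m} = {p..q}" using m by auto
      then show ?thesis using P1 by auto
    next
      case True
      obtain y where y: "m < y" "y < q" "is_edge T m y" "is_edge T y q"
        using triangulation_apex[OF triangulation m(4) True] by blast
      obtain \<kappa>' o' where P': "admissible \<kappa>' o'" "polygon \<kappa>' o' {m..q}"
        using less.hyps[of q m, OF _ m(4,2)] diff_less_mono2[of p m q] m by auto
      have "separated m q p y"
        by (rule edge_separated) (use m y e edge_sym[of p m] edge_sym[of p q] in \<open>simp_all\<close>)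
      then obtain \<kappa>'' o'' where "admissible \<kappa>'' o''" "polygon \<kappa>'' o'' (insert q {p..m} \<union> {m..q})"
        by (rule polygon_glue[OF _ P1 _ P', of m q p y, rotated -2]) (use m(1,2) y(1,2) in_t in auto)
      moreover have "insert q {p..m} \<union> {m..q} = {p..q}" using m by auto
      ultimately show ?thesis by auto
    qed
  qed
qed

lemma polygon_all:
  assumes "2 \<le> t"
  obtains \<kappa> ori where "admissible \<kappa> ori" "polygon \<kappa> ori {1..t}"
  using polygon_interval[OF triangulation_long_edge[OF triangulation assms]] assms that by auto

end

section \<open>Cyclic rotation of the indices\<close>

context generic_flags
begin

text \<open>The vertices with \<open>w\<close> are those that wrap around under the shift. Moving
  their blocks to the front changes a bracket by a sign that is a product of one factor
  \<open>(-1) ^ (s * (d - 1))\<close> per wrapped flag of exponent \<open>s\<close>, so it can be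
  put into the orientation.\<close>

lemma polygon_rotate:
  assumes adm: "admissible \<kappa> ori" and P: "polygon \<kappa> ori {1..t}"
  obtains ori' where "admissible \<kappa> ori'"
    "\<And>i j k. {i, j, k} \<subseteq> {1..t} \<Longrightarrow> cyclic_shift t c i < cyclic_shift t c j \<Longrightarrow>
       cyclic_shift t c j < cyclic_shift t c k \<Longrightarrow> tri \<kappa> ori' i j k"
proof -
  define c0 where "c0 = c mod t"
  define w where "w i \<longleftrightarrow> t < i + c0" for i
  define ori' where "ori' i s = ori i s * (if w i then (-1) ^ (s * (d - 1)) else 1)" for i s
  have sq: "((-1::real) ^ n) * ((-1) ^ n) = 1" for n :: nat
    by (simp flip: power_add mult_2)
  have or: "orientation d (ori i)" for i using adm by (simp add: admissible_def)
  have adm': "admissible \<kappa> ori'"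
    unfolding admissible_def
  proof (intro conjI allI)
    show "\<kappa> * \<kappa> = 1" using adm by (simp add: admissible_def)
    fix i
    have "ori' i s * ori' i s = 1" if "s \<le> d" for s
    proof -
      have "ori i s * ori i s = 1" using or that by (simp add: orientation_def)
      moreover have "ori' i s * ori' i s = (ori i s * ori i s) *
          ((if w i then (-1) ^ (s * (d - 1)) else 1) * (if w i then (-1) ^ (s * (d - 1)) else 1))"
        unfolding ori'_def by (simp only: mult_ac)
      ultimately show ?thesis using sq by simp
    qed
    then show "orientation d (ori' i)" using or by (auto simp: orientation_def ori'_def)
  qed
  have sh: "cyclic_shift t c i = (if w i then i + c0 - t else i + c0)" if "i \<in> {1..t}" for i
  proof -
    have m: "(i - 1 + c) mod t = (i - 1 + c0) mod t" by (simp add: c0_def mod_add_right_eq)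
    have c0: "c0 < t" using that by (auto simp: c0_def)
    show ?thesis
    proof (cases "w i")
      case True
      then have "(i - 1 + c0) mod t = i - 1 + c0 - t" using that c0 by (auto simp: w_def le_mod_geq)
      then show ?thesis unfolding cyclic_shift_def m using True that by (auto simp: w_def)
    next
      case False
      then have "(i - 1 + c0) mod t = i - 1 + c0" using that by (auto simp: w_def)
      then show ?thesis unfolding cyclic_shift_def m using False that by auto
    qed
  qed
  \<comment> \<open>\<open>n * (d - n)\<close> and \<open>n * (d - 1)\<close> have the same parity
    because \<open>n * n\<close> and \<open>n\<close> do. The second form is additive in
    \<open>n\<close>, which distributes the sign over the separate flags.\<close>
  have par: "(-1::real) ^ (n * (d - n)) = (-1) ^ (n * (d - 1))" if "n \<le> d" for n
    using that d1 by (auto simp: minus_one_power_iff)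
  have T: "tri \<kappa> ori i j k" if "{i, j, k} \<subseteq> {1..t}" "i < j" "j < k" for i j k
    using P that unfolding polygon_def by auto
  have "tri \<kappa> ori' i j k" if ijk: "{i, j, k} \<subseteq> {1..t}" "cyclic_shift t c i < cyclic_shift t c j"
    "cyclic_shift t c j < cyclic_shift t c k" for i j k
  proof -
    have in_t: "i \<in> {1..t}" "j \<in> {1..t}" "k \<in> {1..t}" using ijk by auto
    consider "\<not> w i" "\<not> w j" "\<not> w k" "i < j" "j < k" | "w i" "w j" "w k" "i < j" "j < k"
      | "w i" "\<not> w j" "\<not> w k" "j < k" "k < i" | "w i" "w j" "\<not> w k" "k < i" "i < j"
      using ijk(2,3) in_t unfolding sh[OF in_t(1)] sh[OF in_t(2)] sh[OF in_t(3)] w_def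
      by (auto split: if_splits)
    then show ?thesis
    proof cases
      case 1
      then show ?thesis using T[OF ijk(1)] by (simp add: tri_def ori'_def)
    next
      \<comment> \<open>With all three vertices wrapped, the signs multiply to
        \<open>(-1) ^ (d * (d - 1)) = 1\<close>.\<close>
      case 2
      show ?thesis unfolding tri_def
      proof (intro allI impI)
        fix a b c assume abc: "a + b + c = d"
        have "0 < \<kappa> * ori i a * ori j b * ori k c * br3 i j k a b c" using T[OF ijk(1)] 2 abc by (simp add: tri_def)
        also have "\<dots> = \<kappa> * ori i a * ori j b * ori k c * br3 i j k a b c * (-1) ^ (d * (d - 1))" using par[of d] by simp
        also have "d * (d - 1) = a * (d - 1) + b * (d - 1) + c * (d - 1)" using abc by (metis add_mult_distrib)
        also have "\<kappa> * ori i a * ori j b * ori k c * br3 i j k a b c * (-1) ^ (a * (d - 1) + b * (d - 1) + c * (d - 1)) =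
            \<kappa> * ori' i a * ori' j b * ori' k c * br3 i j k a b c"
          using 2 by (simp add: ori'_def power_add)
        finally show "0 < \<kappa> * ori' i a * ori' j b * ori' k c * br3 i j k a b c" .
      qed
    next
      case 3
      show ?thesis unfolding tri_def
      proof (intro allI impI)
        fix a b c assume abc: "a + b + c = d"
        have "{j, k, i} \<subseteq> {1..t}" using ijk by auto
        then have "0 < \<kappa> * ori j b * ori k c * ori i a * br3 j k i b c a"
          using T[of j k i] 3 abc by (simp add: tri_def)
        also have "br3 j k i b c a = (-1) ^ (a * (d - a)) * br3 i j k a b c"
        proof -
          have "d - a = b + c" using abc by simp
          then show ?thesis using brk_block_swap[of "blk (v j) b @ blk (v k) c" "blk (v i) a" "[]" d] abc
            by (simp add: mult.commute)
        qed
        also have "\<dots> = (-1) ^ (a * (d - 1)) * br3 i j k a b c" using par[of a] abc by simp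
        finally show "0 < \<kappa> * ori' i a * ori' j b * ori' k c * br3 i j k a b c"
          using 3 by (simp add: ori'_def mult_ac)
      qed
    next
      case 4
      show ?thesis unfolding tri_def
      proof (intro allI impI)
        fix a b c assume abc: "a + b + c = d"
        have "{k, i, j} \<subseteq> {1..t}" using ijk by auto
        then have "0 < \<kappa> * ori k c * ori i a * ori j b * br3 k i j c a b"
          using T[of k i j] 4 abc by (simp add: tri_def)
        also have "br3 k i j c a b = (-1) ^ ((a + b) * (d - (a + b))) * br3 i j k a b c"
        proof -
          have "d - (a + b) = c" using abc by simp
          then show ?thesis using brk_block_swap[of "blk (v k) c" "blk (v i) a @ blk (v j) b" "[]" d] abc
            by (simp add: mult.commute)
        qed
        also have "\<dots> = (-1) ^ (a * (d - 1)) * (-1) ^ (b * (d - 1)) * br3 i j k a b c"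
          using par[of "a + b"] abc by (simp add: add_mult_distrib power_add)
        finally show "0 < \<kappa> * ori' i a * ori' j b * ori' k c * br3 i j k a b c"
          using 4 by (simp add: ori'_def mult_ac)
      qed
    qed
  qed
  then show ?thesis using that adm' by blast
qed

end

section \<open>Moderate nonnegative changes of basis\<close>

context asymp_scale
begin

lemma abs_eq_cong:
  assumes "\<And>n. \<bar>x n\<bar> = \<bar>y n\<bar>"
  shows "moderate \<omega> \<Lambda> x \<longleftrightarrow> moderate \<omega> \<Lambda> y" "null x \<longleftrightarrow> null y"
  using assms by (simp_all add: moderate_def)

lemma moderate_inverse:
  assumes "moderate \<omega> \<Lambda> x" "\<not> null x" shows "moderate \<omega> \<Lambda> (\<lambda>n. inverse (x n))"
proof -
  obtain l where l: "(N x \<longlongrightarrow> l) \<omega>" using assms by (auto simp: moderate_def)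
  then have "l \<noteq> 0" using assms by auto
  have "N (\<lambda>n. inverse (x n)) = (\<lambda>n. inverse (N x n))"
    by (auto simp: fun_eq_iff inverse_powr abs_inverse)
  then show ?thesis using tendsto_inverse[OF l \<open>l \<noteq> 0\<close>] by (auto simp: moderate_def)
qed

lemma moderate_divide:
  assumes "moderate \<omega> \<Lambda> x" "moderate \<omega> \<Lambda> y" "\<not> null y"
  shows "moderate \<omega> \<Lambda> (\<lambda>n. x n / y n)"
  using moderate_mult[OF assms(1) moderate_inverse[OF assms(2,3)]] by (simp only: divide_inverse[symmetric])

lemma moderate_sum: "(\<And>i. i \<in> A \<Longrightarrow> moderate \<omega> \<Lambda> (f i)) \<Longrightarrow> moderate \<omega> \<Lambda> (\<lambda>n. \<Sum>i\<in>A. f i n)"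
  by (induction A rule: infinite_finite_induct) (auto intro!: moderate_add moderate_const)

lemma moderate_prod: "(\<And>i. i \<in> A \<Longrightarrow> moderate \<omega> \<Lambda> (f i)) \<Longrightarrow> moderate \<omega> \<Lambda> (\<lambda>n. \<Prod>i\<in>A. f i n)"
  by (induction A rule: infinite_finite_induct) (auto intro!: moderate_mult moderate_const)

lemma moderate_det:
  assumes "\<And>n. A n \<in> carrier_mat d d" "\<And>i j. i < d \<Longrightarrow> j < d \<Longrightarrow> moderate \<omega> \<Lambda> (\<lambda>n. A n $$ (i, j))"
  shows "moderate \<omega> \<Lambda> (\<lambda>n. det (A n))"
  unfolding det_def'[OF assms(1)]
  by (intro moderate_sum moderate_mult moderate_prod moderate_const assms(2))
    (auto dest: permutes_in_image)

lemma moderate_brk: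
  assumes "\<And>n. length (us n) = d" "\<And>i m. i < d \<Longrightarrow> m < d \<Longrightarrow> moderate \<omega> \<Lambda> (\<lambda>n. us n ! i $ m)"
  shows "moderate \<omega> \<Lambda> (\<lambda>n. brk d (us n))"
  unfolding brk_def
proof (rule moderate_det)
  show "mat_of_rows d (us n) \<in> carrier_mat d d" for n by (rule carrier_matI) (use assms in auto)
  show "moderate \<omega> \<Lambda> (\<lambda>n. mat_of_rows d (us n) $$ (i, j))" if "i < d" "j < d" for i j
    using that assms by (simp add: mat_of_rows_index)
qed

text \<open>A family of \<open>d\<close> functionals is given by coordinate sequences: \<open>\<epsilon> l p n\<close> is the \<open>p\<close>-th
  coordinate at time \<open>n\<close> of the \<open>l\<close>-th functional.\<close>

definition cone :: "nat \<Rightarrow> (nat \<Rightarrow> nat \<Rightarrow> nat \<Rightarrow> real) \<Rightarrow> (nat \<Rightarrow> nat \<Rightarrow> nat \<Rightarrow> real) \<Rightarrow> bool" where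
  "cone d \<epsilon> \<epsilon>' \<longleftrightarrow> (\<exists>M. (\<forall>m\<in>{1..d}. \<forall>l\<in>{1..d}. moderate \<omega> \<Lambda> (M m l) \<and> (\<forall>n. 0 \<le> M m l n)) \<and>
     (\<forall>m\<in>{1..d}. \<forall>p<d. \<forall>n. \<epsilon>' m p n = (\<Sum>l\<in>{1..d}. M m l n * \<epsilon> l p n)))"

lemma cone_refl: "cone d \<epsilon> \<epsilon>"
  unfolding cone_def
  by (rule exI[of _ "\<lambda>m l n. if m = l then 1 else 0"]) (auto simp: moderate_const if_distrib[of "\<lambda>x. x * _"] cong: if_cong)

lemma cone_trans:
  assumes "cone d \<epsilon>1 \<epsilon>2" "cone d \<epsilon>2 \<epsilon>3" shows "cone d \<epsilon>1 \<epsilon>3"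
proof -
  obtain A where A: "\<And>m l. m \<in> {1..d} \<Longrightarrow> l \<in> {1..d} \<Longrightarrow> moderate \<omega> \<Lambda> (A m l) \<and> (\<forall>n. 0 \<le> A m l n)"
    "\<And>m p n. m \<in> {1..d} \<Longrightarrow> p < d \<Longrightarrow> \<epsilon>2 m p n = (\<Sum>l\<in>{1..d}. A m l n * \<epsilon>1 l p n)"
    using assms(1) unfolding cone_def by blast
  obtain B where B: "\<And>m l. m \<in> {1..d} \<Longrightarrow> l \<in> {1..d} \<Longrightarrow> moderate \<omega> \<Lambda> (B m l) \<and> (\<forall>n. 0 \<le> B m l n)"
    "\<And>m p n. m \<in> {1..d} \<Longrightarrow> p < d \<Longrightarrow> \<epsilon>3 m p n = (\<Sum>l\<in>{1..d}. B m l n * \<epsilon>2 l p n)"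
    using assms(2) unfolding cone_def by blast
  have "\<epsilon>3 m p n = (\<Sum>l\<in>{1..d}. (\<Sum>k\<in>{1..d}. B m k n * A k l n) * \<epsilon>1 l p n)"
    if "m \<in> {1..d}" "p < d" for m p n
  proof -
    have "\<epsilon>3 m p n = (\<Sum>k\<in>{1..d}. \<Sum>l\<in>{1..d}. B m k n * A k l n * \<epsilon>1 l p n)"
      unfolding B(2)[OF that] by (intro sum.cong refl) (simp add: A(2) that sum_distrib_left mult.assoc)
    then show ?thesis by (subst (asm) sum.swap) (simp add: sum_distrib_right)
  qed
  moreover have "moderate \<omega> \<Lambda> (\<lambda>n. \<Sum>k\<in>{1..d}. B m k n * A k l n)" "0 \<le> (\<Sum>k\<in>{1..d}. B m k n * A k l n)"
    if "m \<in> {1..d}" "l \<in> {1..d}" for m l n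
    using A B that by (auto intro!: moderate_sum moderate_mult sum_nonneg)
  ultimately show ?thesis unfolding cone_def
    by (intro exI[of _ "\<lambda>m l n. \<Sum>k\<in>{1..d}. B m k n * A k l n"]) auto
qed

text \<open>Orienting the generators \<open>f\<^sub>i\<^sup>(\<^sup>d\<^sup>-\<^sup>l\<^sup>)\<close> and \<open>f\<^sub>j\<^sup>(\<^sup>l\<^sup>-\<^sup>1\<^sup>)\<close> by \<open>ori\<close> makes the changes of basis nonnegative.\<close>

definition pair_functional ::
  "nat \<Rightarrow> (nat \<Rightarrow> nat \<Rightarrow> nat \<Rightarrow> real vec) \<Rightarrow> (nat \<Rightarrow> nat \<Rightarrow> nat \<Rightarrow> real) \<Rightarrow> nat \<Rightarrow> nat \<Rightarrow> nat \<Rightarrow> nat \<Rightarrow> nat \<Rightarrow> real" where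
  "pair_functional d V ori i j l p n = ori n i (d - l) * ori n j (l - 1) *
     brk d (blk (V n i) (d - l) @ blk (V n j) (l - 1) @ [unit_vec d p])"

text \<open>Induction on the middle exponent: the three-term relation replaces \<open>Suc b\<close>
  by \<open>b\<close> at the price of coefficients \<open>r1\<close> and \<open>r2\<close>, which
  are positive by \<open>T\<close> and moderate by \<open>md\<close> and \<open>nn\<close>. The
  coefficients \<open>M\<close> do not depend on \<open>y\<close>, so the result is an identity
  between functionals.\<close>

lemma cone_triple:
  assumes gf: "\<And>n. generic_flags d t (V n)" and adm: "\<And>n. generic_flags.admissible d (\<kappa> n) (ori n)"
    and ijk: "{i, j, k} \<subseteq> {1..t}" "distinct [i, j, k]"
    and T: "\<And>n. generic_flags.tri d (V n) (\<kappa> n) (ori n) i j k"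
    and md: "\<And>a b c. a + b + c = d \<Longrightarrow> moderate \<omega> \<Lambda> (\<lambda>n. brk d (blk (V n i) a @ blk (V n j) b @ blk (V n k) c))"
    and nn: "\<And>a b c. a + b + c = d \<Longrightarrow> \<not> null (\<lambda>n. brk d (blk (V n i) a @ blk (V n j) b @ blk (V n k) c))"
    and abc: "a + b + c + 1 = d"
  shows "\<exists>M. (\<forall>l\<in>{1..d}. moderate \<omega> \<Lambda> (M l) \<and> (\<forall>n. 0 \<le> M l n)) \<and>
    (\<forall>n. \<forall>y\<in>carrier_vec d. ori n i a * ori n j b * ori n k c *
        brk d (blk (V n i) a @ blk (V n j) b @ blk (V n k) c @ [y]) =
      (\<Sum>l\<in>{1..d}. M l n * (ori n i (d - l) * ori n k (l - 1) *
        brk d (blk (V n i) (d - l) @ blk (V n k) (l - 1) @ [y]))))"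
  using abc
proof (induction b arbitrary: a c)
  case 0
  have o: "ori n j 0 = 1" for n
    using adm[of n] by (simp add: generic_flags.admissible_def[OF gf] orientation_def)
  have "d - Suc c = a" "Suc c \<in> {1..d}" using 0 by auto
  then have "ori n i a * ori n j 0 * ori n k c *
        brk d (blk (V n i) a @ blk (V n j) 0 @ blk (V n k) c @ [y]) =
      (\<Sum>l\<in>{1..d}. (if l = Suc c then 1 else 0) * (ori n i (d - l) * ori n k (l - 1) *
        brk d (blk (V n i) (d - l) @ blk (V n k) (l - 1) @ [y])))" for n y
    using o by (simp add: if_distrib[of "\<lambda>x. x * _"] cong: if_cong)
  then show ?case by (intro exI[of _ "\<lambda>l n. if l = Suc c then 1 else 0"]) (auto simp: moderate_const)
next
  case (Suc b)
  let ?D = "\<lambda>a b c n. \<kappa> n * ori n i a * ori n j b * ori n k c * brk d (blk (V n i) a @ blk (V n j) b @ blk (V n k) c)"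
  let ?f = "\<lambda>a b c n y. ori n i a * ori n j b * ori n k c * brk d (blk (V n i) a @ blk (V n j) b @ blk (V n k) c @ [y])"
  let ?g = "\<lambda>l n y. ori n i (d - l) * ori n k (l - 1) * brk d (blk (V n i) (d - l) @ blk (V n k) (l - 1) @ [y])"
  have sum: "a + b + c + 2 = d" using Suc.prems by simp
  have h: "Suc a + b + c + 1 = d" "a + b + Suc c + 1 = d" using sum by auto
  obtain M1 where M1': "(\<forall>l\<in>{1..d}. moderate \<omega> \<Lambda> (M1 l) \<and> (\<forall>n. 0 \<le> M1 l n)) \<and>
    (\<forall>n. \<forall>y\<in>carrier_vec d. ?f (Suc a) b c n y = (\<Sum>l\<in>{1..d}. M1 l n * ?g l n y))"
    using Suc.IH[OF h(1)] by (elim exE)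
  obtain M2 where M2': "(\<forall>l\<in>{1..d}. moderate \<omega> \<Lambda> (M2 l) \<and> (\<forall>n. 0 \<le> M2 l n)) \<and>
    (\<forall>n. \<forall>y\<in>carrier_vec d. ?f a b (Suc c) n y = (\<Sum>l\<in>{1..d}. M2 l n * ?g l n y))"
    using Suc.IH[OF h(2)] by (elim exE)
  have M1: "\<And>l. l \<in> {1..d} \<Longrightarrow> moderate \<omega> \<Lambda> (M1 l) \<and> (\<forall>n. 0 \<le> M1 l n)"
    "\<And>n y. y \<in> carrier_vec d \<Longrightarrow> ?f (Suc a) b c n y = (\<Sum>l\<in>{1..d}. M1 l n * ?g l n y)"
    using M1' by blast+
  have M2: "\<And>l. l \<in> {1..d} \<Longrightarrow> moderate \<omega> \<Lambda> (M2 l) \<and> (\<forall>n. 0 \<le> M2 l n)"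
    "\<And>n y. y \<in> carrier_vec d \<Longrightarrow> ?f a b (Suc c) n y = (\<Sum>l\<in>{1..d}. M2 l n * ?g l n y)"
    using M2' by blast+
  have pos: "0 < ?D a b c n" if "a + b + c = d" for a b c n
    using T[of n] that unfolding generic_flags.tri_def[OF gf] by blast
  have abs: "\<bar>?D a b c n\<bar> = \<bar>brk d (blk (V n i) a @ blk (V n j) b @ blk (V n k) c)\<bar>" if s: "a + b + c = d" for a b c n
  proof -
    have "\<bar>x\<bar> = 1" if "x * x = 1" for x :: real using that by (auto simp: square_eq_1_iff)
    then have "\<bar>\<kappa> n\<bar> = 1" "\<bar>ori n i a\<bar> = 1" "\<bar>ori n j b\<bar> = 1" "\<bar>ori n k c\<bar> = 1"
      using adm[of n] s unfolding generic_flags.admissible_def[OF gf] orientation_def by auto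
    then show ?thesis by (simp add: abs_mult)
  qed
  have mod: "moderate \<omega> \<Lambda> (?D a b c)" "\<not> null (?D a b c)" if "a + b + c = d" for a b c
    using abs_eq_cong[OF abs[OF that]] md[OF that] nn[OF that] by simp_all
  \<comment> \<open>The coefficients of the three-term relation solved for
    \<open>?f a (Suc b) c\<close>. The common sign cancels in the quotients.\<close>
  define r1 where "r1 = (\<lambda>n. ?D a (Suc b) (Suc c) n / ?D (Suc a) b (Suc c) n)"
  define r2 where "r2 = (\<lambda>n. ?D (Suc a) (Suc b) c n / ?D (Suc a) b (Suc c) n)"
  have r: "moderate \<omega> \<Lambda> r1" "moderate \<omega> \<Lambda> r2"
    unfolding r1_def r2_def by (intro moderate_divide mod; use sum in simp)+
  have r0: "0 < r1 n" "0 < r2 n" for n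
    unfolding r1_def r2_def by (intro divide_pos_pos pos; use sum in simp)+
  have rel: "?f a (Suc b) c n y = r1 n * ?f (Suc a) b c n y + r2 n * ?f a b (Suc c) n y"
    if y: "y \<in> carrier_vec d" for n y
  proof -
    let ?b = "\<lambda>a b c. brk d (blk (V n i) a @ blk (V n j) b @ blk (V n k) c)"
    let ?e = "\<lambda>a b c. brk d (blk (V n i) a @ blk (V n j) b @ blk (V n k) c @ [y])"
    let ?Q = "\<kappa> n * (ori n i a * ori n i (Suc a)) * (ori n j b * ori n j (Suc b)) * (ori n k c * ori n k (Suc c))"
    have "?b (Suc a) b (Suc c) * ?e a (Suc b) c = ?b (Suc a) (Suc b) c * ?e a b (Suc c) + ?b a (Suc b) (Suc c) * ?e (Suc a) b c"
    proof (rule brk_three_term[OF sum _ y])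
      show "V n k s \<in> carrier_vec d" if "s \<in> {1..d}" for s
        using generic_flags.flag_carrier[OF gf] that ijk by auto
      show "?b (Suc a) (Suc b) c \<noteq> 0"
        by (rule generic_flags.br3_nz[OF gf ijk(2,1)]) (use sum in simp)
    qed
    then have "?Q * (?b (Suc a) b (Suc c) * ?e a (Suc b) c) = ?Q * (?b (Suc a) (Suc b) c * ?e a b (Suc c)) + ?Q * (?b a (Suc b) (Suc c) * ?e (Suc a) b c)"
      by (simp only: distrib_left)
    then have "?D (Suc a) b (Suc c) n * ?f a (Suc b) c n y = ?D (Suc a) (Suc b) c n * ?f a b (Suc c) n y + ?D a (Suc b) (Suc c) n * ?f (Suc a) b c n y"
      by (simp only: mult_ac)
    moreover have "0 < ?D (Suc a) b (Suc c) n" using sum by (intro pos) simp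
    moreover have "P = Z / X * S + Y / X * R" if "X * P = Y * R + Z * S" "0 < X" for X P Y R Z S :: real
      using that by (simp add: field_simps)
    ultimately show ?thesis unfolding r1_def r2_def by blast
  qed
  show ?case
  proof (intro exI[of _ "\<lambda>l n. r1 n * M1 l n + r2 n * M2 l n"] conjI ballI allI)
    fix l n assume l: "l \<in> {1..d}"
    show "moderate \<omega> \<Lambda> (\<lambda>n. r1 n * M1 l n + r2 n * M2 l n)"
      using M1(1)[OF l] M2(1)[OF l] r by (intro moderate_add moderate_mult) auto
    show "0 \<le> r1 n * M1 l n + r2 n * M2 l n"
      using M1(1)[OF l] M2(1)[OF l] r0[of n] by (intro add_nonneg_nonneg mult_nonneg_nonneg) auto
  next
    fix n and y :: "real vec" assume y: "y \<in> carrier_vec d"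
    show "?f a (Suc b) c n y = (\<Sum>l\<in>{1..d}. (r1 n * M1 l n + r2 n * M2 l n) * ?g l n y)"
      unfolding rel[OF y] M1(2)[OF y] M2(2)[OF y]
      by (simp only: sum_distrib_left distrib_right sum.distrib mult.assoc)
  qed
qed

end

section \<open>Functionals over the field of ultralimits\<close>

text \<open>Linear combinations are formed over sets of vectors; injectivity of \<open>e\<close>
  turns them into sums over an index set. \<open>span_image\<close> and \<open>basis_image\<close>
  do the same for spans and bases.\<close>

lemma (in module) lincomb_image:
  assumes "finite I" "inj_on e I" "e \<in> I \<rightarrow> carrier M" "a \<in> e ` I \<rightarrow> carrier R"
  shows "lincomb a (e ` I) = (\<Oplus>\<^bsub>M\<^esub>i\<in>I. a (e i) \<odot>\<^bsub>M\<^esub> e i)"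
proof -
  have "(\<lambda>v. a v \<odot>\<^bsub>M\<^esub> v) \<in> e ` I \<rightarrow> carrier M"
    using assms(3,4) by (auto intro!: smult_closed)
  from finsum_reindex[OF this assms(2)] show ?thesis by (simp only: lincomb_def)
qed

lemma (in module) span_image:
  assumes I: "finite I" "inj_on e I" "e \<in> I \<rightarrow> carrier M"
  shows "span (e ` I) = {\<Oplus>\<^bsub>M\<^esub>i\<in>I. a i \<odot>\<^bsub>M\<^esub> e i |a. a \<in> I \<rightarrow> carrier R}"
proof -
  have sub: "e ` I \<subseteq> carrier M" using I by auto
  have 1: "(\<Oplus>\<^bsub>M\<^esub>i\<in>I. a i \<odot>\<^bsub>M\<^esub> e i) = lincomb (\<lambda>v. a (inv_into I e v)) (e ` I)"
    if "a \<in> I \<rightarrow> carrier R" for a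
    by (subst lincomb_image) (use that I in \<open>auto simp: Pi_iff inv_into_f_f intro!: finsum_cong'\<close>)
  have 2: "(\<lambda>v. a (inv_into I e v)) \<in> e ` I \<rightarrow> carrier R" if "a \<in> I \<rightarrow> carrier R" for a
    using that I by (auto simp: Pi_iff inv_into_f_f)
  have 3: "lincomb a (e ` I) = (\<Oplus>\<^bsub>M\<^esub>i\<in>I. a (e i) \<odot>\<^bsub>M\<^esub> e i) \<and> (\<lambda>i. a (e i)) \<in> I \<rightarrow> carrier R"
    if "a \<in> e ` I \<rightarrow> carrier R" for a
    using lincomb_image[OF I that] that by auto
  show ?thesis
    unfolding finite_span[OF finite_imageI[OF I(1)] sub]
  proof (intro equalityI subsetI)
    fix v assume "v \<in> {lincomb a (e ` I) |a. a \<in> e ` I \<rightarrow> carrier R}"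
    then obtain a where a: "a \<in> e ` I \<rightarrow> carrier R" "v = lincomb a (e ` I)" by blast
    show "v \<in> {\<Oplus>\<^bsub>M\<^esub>i\<in>I. a i \<odot>\<^bsub>M\<^esub> e i |a. a \<in> I \<rightarrow> carrier R}"
      unfolding a(2) mem_Collect_eq by (rule exI[of _ "\<lambda>i. a (e i)"]) (rule 3[OF a(1)])
  next
    fix v assume "v \<in> {\<Oplus>\<^bsub>M\<^esub>i\<in>I. a i \<odot>\<^bsub>M\<^esub> e i |a. a \<in> I \<rightarrow> carrier R}"
    then obtain a where a: "a \<in> I \<rightarrow> carrier R" "v = (\<Oplus>\<^bsub>M\<^esub>i\<in>I. a i \<odot>\<^bsub>M\<^esub> e i)" by blast
    show "v \<in> {lincomb a (e ` I) |a. a \<in> e ` I \<rightarrow> carrier R}"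
      unfolding a(2) mem_Collect_eq by (rule exI[of _ "\<lambda>v. a (inv_into I e v)"]) (rule conjI[OF 1[OF a(1)] 2[OF a(1)]])
  qed
qed

lemma (in vectorspace) basis_image:
  assumes I: "finite I" "inj_on e I" "e \<in> I \<rightarrow> carrier V"
    and li: "\<And>a. a \<in> I \<rightarrow> carrier K \<Longrightarrow> (\<Oplus>\<^bsub>V\<^esub>i\<in>I. a i \<odot>\<^bsub>V\<^esub> e i) = \<zero>\<^bsub>V\<^esub> \<Longrightarrow> \<forall>i\<in>I. a i = \<zero>\<^bsub>K\<^esub>"
    and gen: "\<And>v. v \<in> carrier V \<Longrightarrow> \<exists>a\<in>I \<rightarrow> carrier K. v = (\<Oplus>\<^bsub>V\<^esub>i\<in>I. a i \<odot>\<^bsub>V\<^esub> e i)"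
  shows "basis (e ` I)"
  unfolding basis_def
proof (intro conjI)
  show sub: "e ` I \<subseteq> carrier V" using I by auto
  show "lin_indpt (e ` I)"
  proof (rule finite_lin_indpt2)
    fix a assume a: "a \<in> e ` I \<rightarrow> carrier K" "lincomb a (e ` I) = \<zero>\<^bsub>V\<^esub>"
    then have "\<forall>i\<in>I. a (e i) = \<zero>\<^bsub>K\<^esub>" using lincomb_image[OF I a(1)] by (intro li[of "\<lambda>i. a (e i)"]) auto
    then show "\<forall>v\<in>e ` I. a v = \<zero>\<^bsub>K\<^esub>" by auto
  qed (use I sub in auto)
  show "span (e ` I) = carrier V"
  proof (rule antisym)
    show "span (e ` I) \<subseteq> carrier V" using sub by (rule span_is_subset2)
    show "carrier V \<subseteq> span (e ` I)" unfolding span_image[OF I] by (auto dest: gen)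
  qed
qed

section \<open>Linear functionals as moderate coordinate sequences\<close>

context asymp_scale
begin

lemma ulim_asymp_rep:
  assumes "A \<in> carrier K" shows "moderate \<omega> \<Lambda> (asymp_rep A)" "ulim \<omega> \<Lambda> (asymp_rep A) = A"
proof -
  obtain x where x: "moderate \<omega> \<Lambda> x" "A = ulim \<omega> \<Lambda> x" using assms by (rule carrier_cases)
  show "moderate \<omega> \<Lambda> (asymp_rep A)" "ulim \<omega> \<Lambda> (asymp_rep A) = A"
    using asymp_rep_ulim[OF x(1)] x by (auto simp: ulim_eq_iff)
qed

lemma null_sum: "(\<And>i. i \<in> A \<Longrightarrow> null (f i)) \<Longrightarrow> null (\<lambda>n. \<Sum>i\<in>A. f i n)"
proof (induction A rule: infinite_finite_induct)
  case (insert x A)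
  then show ?case using null_add[of "f x" "\<lambda>n. \<Sum>i\<in>A. f i n"] by auto
qed auto

lemma null_mult': "moderate \<omega> \<Lambda> x \<Longrightarrow> null y \<Longrightarrow> null (\<lambda>n. x n * y n)"
  using null_mult[of y x] by (simp add: mult.commute)

lemma not_null_one: "\<not> null (\<lambda>n. 1)"
  using omega_nontrivial by (simp add: tendsto_const_iff)

lemma ulim_zero_iff: "moderate \<omega> \<Lambda> x \<Longrightarrow> ulim \<omega> \<Lambda> x = \<zero>\<^bsub>K\<^esub> \<longleftrightarrow> null x"
  by (simp add: zero_K ulim_eq_iff moderate_const)

definition vseq :: "nat \<Rightarrow> (nat \<Rightarrow> nat \<Rightarrow> real) \<Rightarrow> asymp vec" where
  "vseq d w = vec d (\<lambda>m. ulim \<omega> \<Lambda> (w m))"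

definition moderate_coords :: "nat \<Rightarrow> (nat \<Rightarrow> nat \<Rightarrow> real) \<Rightarrow> bool" where
  "moderate_coords d c \<longleftrightarrow> (\<forall>m<d. moderate \<omega> \<Lambda> (c m))"

lemma moderate_coordsD: "moderate_coords d c \<Longrightarrow> m < d \<Longrightarrow> moderate \<omega> \<Lambda> (c m)"
  by (simp add: moderate_coords_def)

definition funct :: "nat \<Rightarrow> (nat \<Rightarrow> nat \<Rightarrow> real) \<Rightarrow> asymp vec \<Rightarrow> asymp" where
  "funct d c = (\<lambda>u\<in>carrier (coord_space K d). ulim \<omega> \<Lambda> (\<lambda>n. \<Sum>m<d. c m n * asymp_rep (u $ m) n))"

lemma vseq_carrier: "moderate_coords d w \<Longrightarrow> vseq d w \<in> carrier (coord_space K d)"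
  by (auto simp: vseq_def coord_space_def moderate_coords_def)

lemma vseq_cases:
  assumes "u \<in> carrier (coord_space K d)"
  obtains w where "moderate_coords d w" "u = vseq d w"
proof (rule that[of "\<lambda>m. asymp_rep (u $ m)"])
  have u: "dim_vec u = d" "\<And>i. i < d \<Longrightarrow> u $ i \<in> carrier K" using assms by (auto simp: coord_space_def)
  show "moderate_coords d (\<lambda>m. asymp_rep (u $ m))"
    using u ulim_asymp_rep by (auto simp: moderate_coords_def)
  show "u = vseq d (\<lambda>m. asymp_rep (u $ m))"
    using u ulim_asymp_rep by (intro eq_vecI) (auto simp: vseq_def)
qed

lemma vseq_add:
  "moderate_coords d w \<Longrightarrow> moderate_coords d w' \<Longrightarrow>
    vseq d w \<oplus>\<^bsub>coord_space K d\<^esub> vseq d w' = vseq d (\<lambda>m n. w m n + w' m n)"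
  by (auto simp: vseq_def coord_space_def moderate_coords_def add_ulim)

lemma vseq_smult:
  "moderate \<omega> \<Lambda> x \<Longrightarrow> moderate_coords d w \<Longrightarrow>
    ulim \<omega> \<Lambda> x \<odot>\<^bsub>coord_space K d\<^esub> vseq d w = vseq d (\<lambda>m n. x n * w m n)"
  by (auto simp: vseq_def coord_space_def moderate_coords_def mult_ulim)

lemma moderate_coords_add: "moderate_coords d w \<Longrightarrow> moderate_coords d w' \<Longrightarrow> moderate_coords d (\<lambda>m n. w m n + w' m n)"
  by (simp add: moderate_coords_def moderate_add)

lemma moderate_coords_smult: "moderate \<omega> \<Lambda> x \<Longrightarrow> moderate_coords d w \<Longrightarrow> moderate_coords d (\<lambda>m n. x n * w m n)"
  by (simp add: moderate_coords_def moderate_mult)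

lemma moderate_coords_sum:
  "(\<And>i. i \<in> A \<Longrightarrow> moderate_coords d (w i)) \<Longrightarrow> moderate_coords d (\<lambda>m n. \<Sum>i\<in>A. w i m n)"
  by (simp add: moderate_coords_def moderate_sum)

lemma moderate_pairing:
  "moderate_coords d c \<Longrightarrow> moderate_coords d w \<Longrightarrow> moderate \<omega> \<Lambda> (\<lambda>n. \<Sum>m<d. c m n * w m n)"
  by (auto simp: moderate_coords_def intro!: moderate_sum moderate_mult)

text \<open>Replacing the representatives picked by \<open>asymp_rep\<close> with \<open>w\<close>
  changes each summand by a null sequence times a moderate one. Functionals can thus be evaluated on
  any representing sequences.\<close>

lemma funct_vseq:
  assumes "moderate_coords d c" "moderate_coords d w"
  shows "funct d c (vseq d w) = ulim \<omega> \<Lambda> (\<lambda>n. \<Sum>m<d. c m n * w m n)"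
proof -
  have r: "moderate \<omega> \<Lambda> (asymp_rep (ulim \<omega> \<Lambda> (w m)))" "null (\<lambda>n. asymp_rep (ulim \<omega> \<Lambda> (w m)) n - w m n)" if "m < d" for m
    using asymp_rep_ulim moderate_coordsD[OF assms(2) that] by blast+
  have "null (\<lambda>n. \<Sum>m<d. c m n * (asymp_rep (ulim \<omega> \<Lambda> (w m)) n - w m n))"
    by (intro null_sum null_mult') (use r moderate_coordsD[OF assms(1)] in auto)
  moreover have "moderate \<omega> \<Lambda> (\<lambda>n. \<Sum>m<d. c m n * asymp_rep (ulim \<omega> \<Lambda> (w m)) n)"
    by (intro moderate_sum moderate_mult) (use r moderate_coordsD[OF assms(1)] in auto)
  ultimately have "ulim \<omega> \<Lambda> (\<lambda>n. \<Sum>m<d. c m n * asymp_rep (ulim \<omega> \<Lambda> (w m)) n) = ulim \<omega> \<Lambda> (\<lambda>n. \<Sum>m<d. c m n * w m n)"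
    using moderate_pairing[OF assms] by (subst ulim_eq_iff) (auto simp: sum_subtractf right_diff_distrib)
  then show ?thesis
    using vseq_carrier[OF assms(2)] by (simp add: funct_def vseq_def)
qed

lemma funct_closed:
  assumes c: "moderate_coords d c" shows "funct d c \<in> carrier (dual_coord_space \<omega> \<Lambda> d)"
proof -
  have "funct d c u \<in> carrier K" if u: "u \<in> carrier (coord_space K d)" for u
  proof -
    obtain w where w: "moderate_coords d w" "u = vseq d w" using u by (rule vseq_cases)
    then show ?thesis using c by (simp add: funct_vseq moderate_pairing)
  qed
  moreover have "funct d c (u \<oplus>\<^bsub>coord_space K d\<^esub> u') = funct d c u \<oplus>\<^bsub>K\<^esub> funct d c u'"
    if u: "u \<in> carrier (coord_space K d)" "u' \<in> carrier (coord_space K d)" for u u'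
  proof -
    obtain w where w: "moderate_coords d w" "u = vseq d w" using u(1) by (rule vseq_cases)
    obtain w' where w': "moderate_coords d w'" "u' = vseq d w'" using u(2) by (rule vseq_cases)
    show ?thesis using c w w'
      by (simp add: vseq_add funct_vseq moderate_pairing moderate_coords_add add_ulim distrib_left sum.distrib)
  qed
  moreover have "funct d c (a \<odot>\<^bsub>coord_space K d\<^esub> u) = a \<otimes>\<^bsub>K\<^esub> funct d c u"
    if u: "a \<in> carrier K" "u \<in> carrier (coord_space K d)" for a u
  proof -
    obtain w where w: "moderate_coords d w" "u = vseq d w" using u(2) by (rule vseq_cases)
    obtain x where x: "moderate \<omega> \<Lambda> x" "a = ulim \<omega> \<Lambda> x" using u(1) by (rule carrier_cases)
    show ?thesis using c w x
      by (simp add: vseq_smult funct_vseq moderate_pairing moderate_coords_smult mult_ulim sum_distrib_left mult_ac)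
  qed
  ultimately show ?thesis by (auto simp: dual_space_def funct_def)
qed

lemma funct_eqI:
  assumes "\<phi> \<in> carrier (dual_coord_space \<omega> \<Lambda> d)" "\<psi> \<in> carrier (dual_coord_space \<omega> \<Lambda> d)"
    "\<And>w. moderate_coords d w \<Longrightarrow> \<phi> (vseq d w) = \<psi> (vseq d w)"
  shows "\<phi> = \<psi>"
proof (rule extensionalityI)
  show "\<phi> \<in> extensional (carrier (coord_space K d))" "\<psi> \<in> extensional (carrier (coord_space K d))"
    using assms by (auto simp: dual_space_def PiE_def)
  fix u assume "u \<in> carrier (coord_space K d)"
  then show "\<phi> u = \<psi> u" using assms(3) by (elim vseq_cases) auto
qed

lemma dual_eval:
  assumes "w \<in> carrier (coord_space K d)"
  shows "(\<phi> \<oplus>\<^bsub>dual_coord_space \<omega> \<Lambda> d\<^esub> \<psi>) w = \<phi> w \<oplus>\<^bsub>K\<^esub> \<psi> w"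
    "(a \<odot>\<^bsub>dual_coord_space \<omega> \<Lambda> d\<^esub> \<phi>) w = a \<otimes>\<^bsub>K\<^esub> \<phi> w"
    "\<zero>\<^bsub>dual_coord_space \<omega> \<Lambda> d\<^esub> w = \<zero>\<^bsub>K\<^esub>"
  using assms by (auto simp: dual_space_def)

lemma vs_dual: "vectorspace K (dual_coord_space \<omega> \<Lambda> d)"
  by (intro vectorspace_dual_space vectorspace_coord_space field_asymp_field)

lemma funct_add:
  assumes "moderate_coords d c" "moderate_coords d c'"
  shows "funct d (\<lambda>m n. c m n + c' m n) = funct d c \<oplus>\<^bsub>dual_coord_space \<omega> \<Lambda> d\<^esub> funct d c'"
proof (rule funct_eqI)
  interpret D: vectorspace K "dual_coord_space \<omega> \<Lambda> d" by (rule vs_dual)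
  show "funct d c \<oplus>\<^bsub>dual_coord_space \<omega> \<Lambda> d\<^esub> funct d c' \<in> carrier (dual_coord_space \<omega> \<Lambda> d)"
    using assms by (intro D.a_closed funct_closed)
qed (use assms in \<open>simp_all add: funct_closed moderate_coords_add funct_vseq dual_eval vseq_carrier
      add_ulim moderate_pairing distrib_right sum.distrib\<close>)

lemma funct_smult:
  assumes "moderate \<omega> \<Lambda> x" "moderate_coords d c"
  shows "funct d (\<lambda>m n. x n * c m n) = ulim \<omega> \<Lambda> x \<odot>\<^bsub>dual_coord_space \<omega> \<Lambda> d\<^esub> funct d c"
proof (rule funct_eqI)
  interpret D: vectorspace K "dual_coord_space \<omega> \<Lambda> d" by (rule vs_dual)
  show "ulim \<omega> \<Lambda> x \<odot>\<^bsub>dual_coord_space \<omega> \<Lambda> d\<^esub> funct d c \<in> carrier (dual_coord_space \<omega> \<Lambda> d)"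
    using assms by (intro D.smult_closed funct_closed) auto
qed (use assms in \<open>simp_all add: funct_closed moderate_coords_smult funct_vseq dual_eval vseq_carrier
      mult_ulim moderate_pairing sum_distrib_left mult.assoc\<close>)

lemma funct_zero: "funct d (\<lambda>m n. 0) = \<zero>\<^bsub>dual_coord_space \<omega> \<Lambda> d\<^esub>"
proof (rule funct_eqI)
  interpret D: vectorspace K "dual_coord_space \<omega> \<Lambda> d" by (rule vs_dual)
  show "\<zero>\<^bsub>dual_coord_space \<omega> \<Lambda> d\<^esub> \<in> carrier (dual_coord_space \<omega> \<Lambda> d)" by simp
qed (simp_all add: funct_closed moderate_coords_def moderate_const funct_vseq dual_eval vseq_carrier zero_K)

lemma funct_sum:
  assumes "finite A" "\<And>l. l \<in> A \<Longrightarrow> moderate \<omega> \<Lambda> (x l)" "\<And>l. l \<in> A \<Longrightarrow> moderate_coords d (\<epsilon> l)"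
  shows "(\<Oplus>\<^bsub>dual_coord_space \<omega> \<Lambda> d\<^esub>l\<in>A. ulim \<omega> \<Lambda> (x l) \<odot>\<^bsub>dual_coord_space \<omega> \<Lambda> d\<^esub> funct d (\<epsilon> l)) =
    funct d (\<lambda>m n. \<Sum>l\<in>A. x l n * \<epsilon> l m n)"
  using assms
proof (induction A rule: finite_induct)
  case empty
  interpret D: vectorspace K "dual_coord_space \<omega> \<Lambda> d" by (rule vs_dual)
  show ?case by (simp add: funct_zero)
next
  case (insert l A)
  interpret D: vectorspace K "dual_coord_space \<omega> \<Lambda> d" by (rule vs_dual)
  have m: "moderate_coords d (\<lambda>m n. x k n * \<epsilon> k m n)" if "k \<in> insert l A" for k
    using insert.prems that by (intro moderate_coords_smult) auto
  have "(\<Oplus>\<^bsub>dual_coord_space \<omega> \<Lambda> d\<^esub>l\<in>insert l A. ulim \<omega> \<Lambda> (x l) \<odot>\<^bsub>dual_coord_space \<omega> \<Lambda> d\<^esub> funct d (\<epsilon> l)) =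
    ulim \<omega> \<Lambda> (x l) \<odot>\<^bsub>dual_coord_space \<omega> \<Lambda> d\<^esub> funct d (\<epsilon> l) \<oplus>\<^bsub>dual_coord_space \<omega> \<Lambda> d\<^esub>
    (\<Oplus>\<^bsub>dual_coord_space \<omega> \<Lambda> d\<^esub>l\<in>A. ulim \<omega> \<Lambda> (x l) \<odot>\<^bsub>dual_coord_space \<omega> \<Lambda> d\<^esub> funct d (\<epsilon> l))"
    using insert by (intro D.finsum_insert) (auto intro!: D.smult_closed funct_closed)
  also have "\<dots> = funct d (\<lambda>m n. x l n * \<epsilon> l m n) \<oplus>\<^bsub>dual_coord_space \<omega> \<Lambda> d\<^esub> funct d (\<lambda>m n. \<Sum>l\<in>A. x l n * \<epsilon> l m n)"
    using insert by (simp add: funct_smult)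
  also have "\<dots> = funct d (\<lambda>m n. x l n * \<epsilon> l m n + (\<Sum>l\<in>A. x l n * \<epsilon> l m n))"
    by (rule funct_add[symmetric]) (use m in \<open>auto intro!: moderate_coords_sum\<close>)
  finally show ?case using insert.hyps by simp
qed

definition unit_seq :: "nat \<Rightarrow> nat \<Rightarrow> nat \<Rightarrow> real" where
  "unit_seq p m n = (if m = p then 1 else 0)"

lemma moderate_unit_seq: "moderate_coords d (unit_seq p)"
proof -
  have "unit_seq p m = (\<lambda>n. if m = p then 1 else 0)" for m by (auto simp: unit_seq_def)
  then show ?thesis by (auto simp: moderate_coords_def moderate_const)
qed

text \<open>Evaluation at the unit vectors recovers each coordinate up to a null sequence;
  conversely, null coordinates pair to null sequences.\<close>

lemma funct_eq_iff:
  assumes "moderate_coords d c" "moderate_coords d c'"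
  shows "funct d c = funct d c' \<longleftrightarrow> (\<forall>m<d. null (\<lambda>n. c m n - c' m n))"
proof
  assume eq: "funct d c = funct d c'"
  show "\<forall>m<d. null (\<lambda>n. c m n - c' m n)"
  proof (intro allI impI)
    fix p assume p: "p < d"
    have ev: "(\<Sum>m<d. c m n * unit_seq p m n) = c p n" for c n
      using p by (simp add: unit_seq_def if_distrib cong: if_cong)
    have "funct d c (vseq d (unit_seq p)) = funct d c' (vseq d (unit_seq p))" using eq by simp
    then have "ulim \<omega> \<Lambda> (\<lambda>n. c p n) = ulim \<omega> \<Lambda> (\<lambda>n. c' p n)"
      using assms moderate_unit_seq by (simp add: funct_vseq ev)
    then show "null (\<lambda>n. c p n - c' p n)"
      using assms p by (simp add: ulim_eq_iff moderate_coordsD)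
  qed
next
  assume nl: "\<forall>m<d. null (\<lambda>n. c m n - c' m n)"
  show "funct d c = funct d c'"
  proof (rule funct_eqI)
    fix w assume w: "moderate_coords d w"
    have "null (\<lambda>n. \<Sum>m<d. (c m n - c' m n) * w m n)"
      by (intro null_sum null_mult) (use nl w in \<open>auto simp: moderate_coords_def\<close>)
    then show "funct d c (vseq d w) = funct d c' (vseq d w)"
      using assms w by (simp add: funct_vseq ulim_eq_iff moderate_pairing left_diff_distrib sum_subtractf)
  qed (use assms in \<open>auto intro: funct_closed\<close>)
qed

text \<open>The coordinate sequences are representatives of the values of \<psi> on the unit
  vectors.\<close>

lemma funct_cases:
  assumes \<psi>: "\<psi> \<in> carrier (dual_coord_space \<omega> \<Lambda> d)"
  obtains c where "moderate_coords d c" "\<psi> = funct d c"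
proof -
  let ?U = "coord_space K d"
  define c where "c m = asymp_rep (\<psi> (vseq d (unit_seq m)))" for m
  have ad: "\<psi> (u \<oplus>\<^bsub>?U\<^esub> u') = \<psi> u \<oplus>\<^bsub>K\<^esub> \<psi> u'" if "u \<in> carrier ?U" "u' \<in> carrier ?U" for u u'
    using \<psi> that by (auto simp: dual_space_def)
  have sm: "\<psi> (a \<odot>\<^bsub>?U\<^esub> u) = a \<otimes>\<^bsub>K\<^esub> \<psi> u" if "a \<in> carrier K" "u \<in> carrier ?U" for a u
    using \<psi> that by (auto simp: dual_space_def)
  have cl: "\<psi> u \<in> carrier K" if "u \<in> carrier ?U" for u
    using \<psi> that by (auto simp: dual_space_def)
  have c: "moderate \<omega> \<Lambda> (c m)" "ulim \<omega> \<Lambda> (c m) = \<psi> (vseq d (unit_seq m))" for m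
    unfolding c_def using ulim_asymp_rep[OF cl[OF vseq_carrier[OF moderate_unit_seq]]] by auto
  have mc: "moderate_coords d c" using c by (simp add: moderate_coords_def)
  have "\<psi> = funct d c"
  proof (rule funct_eqI[OF \<psi> funct_closed[OF mc]])
    fix w assume w: "moderate_coords d w"
    \<comment> \<open>Truncations of \<open>w\<close> to its first \<open>k\<close> coordinates:
      additivity of \<psi> is then used one coordinate at a time.\<close>
    define part where "part k = (\<lambda>m n. if m < k then w m n else 0)" for k :: nat
    have mp: "moderate_coords d (part k)" for k
    proof -
      have "part k m = (if m < k then w m else (\<lambda>n. 0))" for m by (auto simp: part_def)
      then show ?thesis using w by (simp add: moderate_coords_def moderate_const)
    qed
    have "\<psi> (vseq d (part k)) = ulim \<omega> \<Lambda> (\<lambda>n. \<Sum>m<k. c m n * w m n)" if "k \<le> d" for k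
      using that
    proof (induction k)
      case 0
      have "vseq d (part 0) = ulim \<omega> \<Lambda> (\<lambda>n. 0) \<odot>\<^bsub>?U\<^esub> vseq d w"
        using w by (simp add: vseq_smult moderate_const part_def)
      then have "\<psi> (vseq d (part 0)) = ulim \<omega> \<Lambda> (\<lambda>n. 0) \<otimes>\<^bsub>K\<^esub> \<psi> (vseq d w)"
        using sm w by (simp add: moderate_const vseq_carrier)
      also have "\<dots> = ulim \<omega> \<Lambda> (\<lambda>n. 0)"
      proof -
        obtain x where x: "moderate \<omega> \<Lambda> x" "\<psi> (vseq d w) = ulim \<omega> \<Lambda> x"
          using carrier_cases[OF cl[OF vseq_carrier[OF w]]] by blast
        then show ?thesis by (simp add: mult_ulim moderate_const)
      qed
      finally show ?case by simp
    next
      case (Suc k)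
      have wk: "moderate \<omega> \<Lambda> (w k)" using w Suc.prems by (simp add: moderate_coords_def)
      have m1: "moderate_coords d (\<lambda>m n. w k n * unit_seq k m n)"
        by (rule moderate_coords_smult[OF wk moderate_unit_seq])
      have "vseq d (part (Suc k)) = vseq d (part k) \<oplus>\<^bsub>?U\<^esub> vseq d (\<lambda>m n. w k n * unit_seq k m n)"
      proof -
        have "(\<lambda>m n. part k m n + w k n * unit_seq k m n) = part (Suc k)"
          by (auto simp: fun_eq_iff part_def unit_seq_def)
        then show ?thesis by (simp add: vseq_add[OF mp m1])
      qed
      then have "\<psi> (vseq d (part (Suc k))) = \<psi> (vseq d (part k)) \<oplus>\<^bsub>K\<^esub> ulim \<omega> \<Lambda> (w k) \<otimes>\<^bsub>K\<^esub> \<psi> (vseq d (unit_seq k))"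
        using ad[OF vseq_carrier[OF mp] vseq_carrier[OF m1]]
          sm[OF ulim_carrier[OF wk] vseq_carrier[OF moderate_unit_seq]]
        by (simp add: vseq_smult[OF wk moderate_unit_seq])
      also have "\<dots> = ulim \<omega> \<Lambda> (\<lambda>n. \<Sum>m<k. c m n * w m n) \<oplus>\<^bsub>K\<^esub> ulim \<omega> \<Lambda> (\<lambda>n. w k n * c k n)"
        using Suc c wk by (simp add: mult_ulim flip: c(2))
      also have "\<dots> = ulim \<omega> \<Lambda> (\<lambda>n. (\<Sum>m<k. c m n * w m n) + w k n * c k n)"
        using w c wk Suc.prems by (intro add_ulim moderate_sum moderate_mult) (auto simp: moderate_coords_def)
      finally show ?case by (simp add: mult.commute)
    qed
    from this[of d] have "\<psi> (vseq d (part d)) = funct d c (vseq d w)"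
      using mc w by (simp add: funct_vseq)
    moreover have "vseq d (part d) = vseq d w" by (auto simp: vseq_def part_def)
    ultimately show "\<psi> (vseq d w) = funct d c (vseq d w)" by simp
  qed
  then show ?thesis using that mc by blast
qed

end

section \<open>Adapted norms\<close>

context asymp_scale
begin

text \<open>This is subadditivity of the power with exponent in the unit interval, which follows
  from \<open>u / s \<le> (u / s) powr p\<close> for the two parts of a sum \<open>s\<close>. It
  shows that adding a null sequence leaves the limit of \<open>N\<close> unchanged.\<close>

lemma powr_abs_diff:
  fixes a b p :: real
  assumes "0 \<le> p" "p \<le> 1" shows "\<bar>\<bar>a\<bar> powr p - \<bar>b\<bar> powr p\<bar> \<le> \<bar>a - b\<bar> powr p"
proof -
  have sub: "(x + y) powr p \<le> x powr p + y powr p" if "0 \<le> x" "0 \<le> y" for x y :: real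
  proof (cases "x + y = 0")
    case False
    define s where "s = x + y"
    have s: "0 < s" using that False by (simp add: s_def)
    have le: "u / s \<le> (u / s) powr p" if "0 \<le> u" "u \<le> s" for u
    proof (cases "u = 0")
      case False
      then have "0 < u / s" "u / s \<le> 1" using that s by auto
      then have "(u / s) powr 1 \<le> (u / s) powr p" using assms by (intro powr_mono') auto
      then show ?thesis using that s by simp
    qed simp
    have "1 = x / s + y / s" using s by (simp add: s_def flip: add_divide_distrib)
    also have "\<dots> \<le> (x / s) powr p + (y / s) powr p" using that by (intro add_mono le) (auto simp: s_def)
    also have "\<dots> = (x powr p + y powr p) / s powr p" using that s by (simp add: powr_divide add_divide_distrib)
    finally show ?thesis using s by (simp add: s_def[symmetric] le_divide_eq)
  qed (use that in auto)
  have half: "\<bar>u\<bar> powr p \<le> \<bar>w\<bar> powr p + \<bar>u - w\<bar> powr p" for u w :: real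
  proof -
    have "\<bar>u\<bar> powr p \<le> (\<bar>w\<bar> + \<bar>u - w\<bar>) powr p" using assms by (intro powr_mono2) auto
    also have "\<dots> \<le> \<bar>w\<bar> powr p + \<bar>u - w\<bar> powr p" by (rule sub) auto
    finally show ?thesis .
  qed
  show ?thesis using half[of a b] half[of b a] by (simp add: abs_minus_commute abs_le_iff)
qed

lemma tendsto_N_cong:
  assumes "(N x \<longlongrightarrow> l) \<omega>" "null (\<lambda>n. y n - x n)" shows "(N y \<longlongrightarrow> l) \<omega>"
proof -
  have "((\<lambda>n. N y n - N x n) \<longlongrightarrow> 0) \<omega>"
  proof (rule tendsto_rabs_zero_cancel, rule tendsto_sandwich[OF _ _ tendsto_const assms(2)])
    have "\<bar>N y n - N x n\<bar> \<le> N (\<lambda>n. y n - x n) n" for n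
      using powr_abs_diff[of "1 / \<Lambda> n" "y n" "x n"] scale_ge_1[of n] by simp
    then show "\<forall>\<^sub>F n in \<omega>. \<bar>N y n - N x n\<bar> \<le> N (\<lambda>n. y n - x n) n" by simp
  qed simp
  from tendsto_add[OF this assms(1)] show ?thesis by simp
qed

text \<open>The exponential undoes \<open>ext_ln\<close>, and the representative chosen in
  \<open>asymp_val\<close> differs from \<open>x\<close> by a null sequence only. The limit 0
  corresponds to infinite valuation and is treated apart.\<close>

lemma asymp_abs_ulim:
  assumes l: "(N x \<longlongrightarrow> l) \<omega>" shows "asymp_abs \<omega> \<Lambda> (ulim \<omega> \<Lambda> x) = l"
proof -
  have m: "moderate \<omega> \<Lambda> x" using l by (auto simp: moderate_def)
  let ?r = "asymp_rep (ulim \<omega> \<Lambda> x)"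
  have r: "(N ?r \<longlongrightarrow> l) \<omega>" using tendsto_N_cong[OF l asymp_rep_ulim(2)[OF m]] .
  have l0: "0 \<le> l" by (rule tendsto_lowerbound[OF l]) (use omega_nontrivial in auto)
  have T2: "Lim \<omega> f = L" if "(f \<longlongrightarrow> L) \<omega>" for f :: "nat \<Rightarrow> ereal" and L
    using tendsto_Lim[OF omega_nontrivial that] .
  show ?thesis
  proof (cases "l = 0")
    case True
    have "((\<lambda>n. ext_ln (N ?r n)) \<longlongrightarrow> -\<infinity>) \<omega>"
      unfolding tendsto_MInfty
    proof
      fix B :: real
      have "\<forall>\<^sub>F n in \<omega>. N ?r n < exp B" using order_tendstoD(2)[OF r] True by simp
      then show "\<forall>\<^sub>F n in \<omega>. ext_ln (N ?r n) < ereal B"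
      proof eventually_elim
        case (elim n)
        show ?case
        proof (cases "N ?r n = 0")
          case False
          then have "0 < N ?r n" by (simp add: less_le)
          then have "ln (N ?r n) < ln (exp B)" using elim by (subst ln_less_cancel_iff) auto
          then show ?thesis using False by (simp add: ext_ln_def)
        qed (simp add: ext_ln_def)
      qed
    qed
    from T2[OF this] show ?thesis using True by (simp add: asymp_abs_def asymp_val_def)
  next
    case False
    then have lp: "0 < l" using l0 by simp
    have "((\<lambda>n. ereal (ln (N ?r n))) \<longlongrightarrow> ereal (ln l)) \<omega>"
      using tendsto_ln[OF r] False by simp
    moreover have "\<forall>\<^sub>F n in \<omega>. ereal (ln (N ?r n)) = ext_ln (N ?r n)"
      using order_tendstoD(1)[OF r lp] by eventually_elim (auto simp: ext_ln_def)
    ultimately have "((\<lambda>n. ext_ln (N ?r n)) \<longlongrightarrow> ereal (ln l)) \<omega>" by (rule Lim_transform_eventually)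
    from T2[OF this] show ?thesis using lp by (simp add: asymp_abs_def asymp_val_def)
  qed
qed

text \<open>The order of the reals enters the estimates of norms here: a summand of a nonnegative
  sum has at most the absolute value of the sum.\<close>

lemma asymp_abs_mono:
  assumes "moderate \<omega> \<Lambda> x" "moderate \<omega> \<Lambda> y" "\<And>n. \<bar>x n\<bar> \<le> \<bar>y n\<bar>"
  shows "asymp_abs \<omega> \<Lambda> (ulim \<omega> \<Lambda> x) \<le> asymp_abs \<omega> \<Lambda> (ulim \<omega> \<Lambda> y)"
proof -
  obtain l k where lk: "(N x \<longlongrightarrow> l) \<omega>" "(N y \<longlongrightarrow> k) \<omega>" using assms by (auto simp: moderate_def)
  have "\<forall>\<^sub>F n in \<omega>. N x n \<le> N y n"
    using assms(3) scale_ge_1 by (intro always_eventually allI powr_mono2) (auto simp: order_trans[OF zero_le_one])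
  from tendsto_le[OF omega_nontrivial lk(2,1) this] show ?thesis unfolding lk[THEN asymp_abs_ulim] .
qed

lemma asymp_abs_nonneg: "0 \<le> asymp_abs \<omega> \<Lambda> A"
  by (simp add: asymp_abs_def)

lemma asymp_abs_minus_one: "asymp_abs \<omega> \<Lambda> (ulim \<omega> \<Lambda> (\<lambda>n. - 1)) = 1"
  by (rule asymp_abs_ulim) simp

text \<open>The matrix of a basis family has an inverse with moderate entries, so that the real families at
  each time and the family of ultralimits are bases simultaneously.\<close>

definition basis_family :: "nat \<Rightarrow> (nat \<Rightarrow> nat \<Rightarrow> nat \<Rightarrow> real) \<Rightarrow> bool" where
  "basis_family d \<epsilon> \<longleftrightarrow> (\<forall>l\<in>{1..d}. moderate_coords d (\<epsilon> l)) \<and>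
     (\<exists>Q. (\<forall>p<d. \<forall>l\<in>{1..d}. moderate \<omega> \<Lambda> (Q p l)) \<and>
       (\<forall>n. \<forall>p<d. \<forall>p'<d. (\<Sum>l\<in>{1..d}. Q p l n * \<epsilon> l p' n) = (if p = p' then 1 else 0)) \<and>
       (\<forall>n. \<forall>l\<in>{1..d}. \<forall>l'\<in>{1..d}. (\<Sum>p<d. \<epsilon> l p n * Q p l' n) = (if l = l' then 1 else 0)))"

lemma basis_family_coords:
  assumes b: "basis_family d \<epsilon>" and c: "moderate_coords d c"
  obtains z where "\<And>l. l \<in> {1..d} \<Longrightarrow> moderate \<omega> \<Lambda> (z l)"
    "\<And>p n. p < d \<Longrightarrow> c p n = (\<Sum>l\<in>{1..d}. z l n * \<epsilon> l p n)"
proof -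
  obtain Q where Q: "\<And>p l. p < d \<Longrightarrow> l \<in> {1..d} \<Longrightarrow> moderate \<omega> \<Lambda> (Q p l)"
    "\<And>n p p'. p < d \<Longrightarrow> p' < d \<Longrightarrow> (\<Sum>l\<in>{1..d}. Q p l n * \<epsilon> l p' n) = (if p = p' then 1 else 0)"
    using b unfolding basis_family_def by blast
  show ?thesis
  proof (rule that[of "\<lambda>l n. \<Sum>p<d. c p n * Q p l n"])
    show "moderate \<omega> \<Lambda> (\<lambda>n. \<Sum>p<d. c p n * Q p l n)" if "l \<in> {1..d}" for l
      using that Q(1) c by (auto intro!: moderate_sum moderate_mult simp: moderate_coords_def)
    fix p' n assume p': "p' < d"
    have "(\<Sum>l\<in>{1..d}. (\<Sum>p<d. c p n * Q p l n) * \<epsilon> l p' n) = (\<Sum>l\<in>{1..d}. \<Sum>p<d. c p n * (Q p l n * \<epsilon> l p' n))"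
      by (simp only: sum_distrib_right mult.assoc)
    also have "\<dots> = (\<Sum>p<d. c p n * (\<Sum>l\<in>{1..d}. Q p l n * \<epsilon> l p' n))"
      by (subst sum.swap) (simp only: sum_distrib_left)
    also have "\<dots> = (\<Sum>p<d. if p = p' then c p n else 0)"
    proof (rule sum.cong[OF refl])
      fix p assume "p \<in> {..<d}"
      then show "c p n * (\<Sum>l\<in>{1..d}. Q p l n * \<epsilon> l p' n) = (if p = p' then c p n else 0)"
        using Q(2)[OF _ p', of p n] by simp
    qed
    finally show "c p' n = (\<Sum>l\<in>{1..d}. (\<Sum>p<d. c p n * Q p l n) * \<epsilon> l p' n)" using p' by simp
  qed
qed

text \<open>Pairing with the columns of the inverse matrix \<open>Q\<close> recovers the
  coefficients of a combination exactly at each time, which gives uniqueness both termwise and up to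
  null sequences.\<close>

lemma basis_family_dual:
  assumes b: "basis_family d \<epsilon>"
  obtains Q where "\<And>p l. p < d \<Longrightarrow> l \<in> {1..d} \<Longrightarrow> moderate \<omega> \<Lambda> (Q p l)"
    "\<And>x m n. m \<in> {1..d} \<Longrightarrow> (\<Sum>p<d. (\<Sum>l\<in>{1..d}. x l * \<epsilon> l p n) * Q p m n) = x m"
proof -
  obtain Q where Q: "\<And>p l. p < d \<Longrightarrow> l \<in> {1..d} \<Longrightarrow> moderate \<omega> \<Lambda> (Q p l)"
    "\<And>n l l'. l \<in> {1..d} \<Longrightarrow> l' \<in> {1..d} \<Longrightarrow> (\<Sum>p<d. \<epsilon> l p n * Q p l' n) = (if l = l' then 1 else 0)"
    using b unfolding basis_family_def by blast
  have "(\<Sum>p<d. (\<Sum>l\<in>{1..d}. x l * \<epsilon> l p n) * Q p m n) = x m" if m: "m \<in> {1..d}" for x m n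
  proof -
    have "(\<Sum>p<d. (\<Sum>l\<in>{1..d}. x l * \<epsilon> l p n) * Q p m n) = (\<Sum>p<d. \<Sum>l\<in>{1..d}. x l * (\<epsilon> l p n * Q p m n))"
      by (simp only: sum_distrib_right mult.assoc)
    also have "\<dots> = (\<Sum>l\<in>{1..d}. x l * (\<Sum>p<d. \<epsilon> l p n * Q p m n))"
      by (subst sum.swap) (simp only: sum_distrib_left)
    also have "\<dots> = (\<Sum>l\<in>{1..d}. if l = m then x l else 0)"
    proof (rule sum.cong[OF refl])
      fix l assume "l \<in> {1..d}"
      from Q(2)[OF this m, of n] show "x l * (\<Sum>p<d. \<epsilon> l p n * Q p m n) = (if l = m then x l else 0)" by simp
    qed
    finally show ?thesis using m by simp
  qed
  then show ?thesis using that Q(1) by blast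
qed

lemma basis_family_null:
  assumes b: "basis_family d \<epsilon>" and nl: "\<And>p. p < d \<Longrightarrow> null (\<lambda>n. \<Sum>l\<in>{1..d}. x l n * \<epsilon> l p n)" and m: "m \<in> {1..d}"
  shows "null (x m)"
proof -
  obtain Q where Q: "\<And>p l. p < d \<Longrightarrow> l \<in> {1..d} \<Longrightarrow> moderate \<omega> \<Lambda> (Q p l)"
    "\<And>x m n. m \<in> {1..d} \<Longrightarrow> (\<Sum>p<d. (\<Sum>l\<in>{1..d}. x l * \<epsilon> l p n) * Q p m n) = x m"
    using basis_family_dual[OF b] by blast
  have "null (\<lambda>n. \<Sum>p<d. (\<Sum>l\<in>{1..d}. x l n * \<epsilon> l p n) * Q p m n)"
    by (intro null_sum null_mult nl Q(1) m) auto
  then show ?thesis using Q(2)[OF m, of "\<lambda>l. x l n" n for n] by simp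
qed

lemma funct_lincomb:
  assumes a: "a \<in> A \<rightarrow> carrier K" and A: "finite A" "\<And>l. l \<in> A \<Longrightarrow> moderate_coords d (\<epsilon> l)"
  shows "(\<Oplus>\<^bsub>dual_coord_space \<omega> \<Lambda> d\<^esub>l\<in>A. a l \<odot>\<^bsub>dual_coord_space \<omega> \<Lambda> d\<^esub> funct d (\<epsilon> l)) =
    funct d (\<lambda>p n. \<Sum>l\<in>A. asymp_rep (a l) n * \<epsilon> l p n)"
proof -
  interpret D: vectorspace K "dual_coord_space \<omega> \<Lambda> d" by (rule vs_dual)
  have r: "moderate \<omega> \<Lambda> (asymp_rep (a l))" "ulim \<omega> \<Lambda> (asymp_rep (a l)) = a l" if "l \<in> A" for l
    using ulim_asymp_rep[OF funcset_mem[OF a that]] by auto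
  have "(\<Oplus>\<^bsub>dual_coord_space \<omega> \<Lambda> d\<^esub>l\<in>A. a l \<odot>\<^bsub>dual_coord_space \<omega> \<Lambda> d\<^esub> funct d (\<epsilon> l)) =
    (\<Oplus>\<^bsub>dual_coord_space \<omega> \<Lambda> d\<^esub>l\<in>A. ulim \<omega> \<Lambda> (asymp_rep (a l)) \<odot>\<^bsub>dual_coord_space \<omega> \<Lambda> d\<^esub> funct d (\<epsilon> l))"
  proof (rule D.finsum_cong'[OF refl])
    show "(\<lambda>l. ulim \<omega> \<Lambda> (asymp_rep (a l)) \<odot>\<^bsub>dual_coord_space \<omega> \<Lambda> d\<^esub> funct d (\<epsilon> l)) \<in> A \<rightarrow> carrier (dual_coord_space \<omega> \<Lambda> d)"
      by (intro funcsetI D.smult_closed funct_closed A ulim_carrier r)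
  qed (simp add: r)
  also have "\<dots> = funct d (\<lambda>p n. \<Sum>l\<in>A. asymp_rep (a l) n * \<epsilon> l p n)"
    by (intro funct_sum A r)
  finally show ?thesis .
qed

lemma basis_family_basis:
  assumes b: "basis_family d \<epsilon>"
  shows "indexed_basis K (dual_coord_space \<omega> \<Lambda> d) d (\<lambda>l. funct d (\<epsilon> l))"
  unfolding indexed_basis_def
proof
  interpret D: vectorspace K "dual_coord_space \<omega> \<Lambda> d" by (rule vs_dual)
  have m: "moderate_coords d (\<epsilon> l)" if "l \<in> {1..d}" for l using b that by (simp add: basis_family_def)
  show inj: "inj_on (\<lambda>l. funct d (\<epsilon> l)) {1..d}"
  proof (rule inj_onI, rule ccontr)
    fix i j assume ij: "i \<in> {1..d}" "j \<in> {1..d}" "funct d (\<epsilon> i) = funct d (\<epsilon> j)" "i \<noteq> j"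
    \<comment> \<open>The coefficients of the difference of members \<open>i\<close> and
      \<open>j\<close>: equality of the two functionals would make the constant sequence 1
      null.\<close>
    define x where "x l n = (if l = i then 1 else if l = j then - 1 else (0::real))" for l and n :: nat
    have "(\<Sum>l\<in>{1..d}. x l n * \<epsilon> l p n) = (\<Sum>l\<in>{i, j}. x l n * \<epsilon> l p n)" for p n
      using ij by (intro sum.mono_neutral_right) (auto simp: x_def)
    then have s: "(\<Sum>l\<in>{1..d}. x l n * \<epsilon> l p n) = \<epsilon> i p n - \<epsilon> j p n" for p n
      using ij by (simp add: x_def)
    have "null (x i)"
    proof (rule basis_family_null[OF b _ ij(1)])
      show "null (\<lambda>n. \<Sum>l\<in>{1..d}. x l n * \<epsilon> l p n)" if "p < d" for p
        using ij(3) that unfolding s funct_eq_iff[OF m[OF ij(1)] m[OF ij(2)]] by blast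
    qed
    moreover have "x i = (\<lambda>n. 1)" by (auto simp: x_def)
    ultimately show False using not_null_one by simp
  qed
  show "D.basis ((\<lambda>l. funct d (\<epsilon> l)) ` {1..d})"
  proof (rule D.basis_image[OF _ inj])
    show "(\<lambda>l. funct d (\<epsilon> l)) \<in> {1..d} \<rightarrow> carrier (dual_coord_space \<omega> \<Lambda> d)" using m by (auto intro: funct_closed)
    show "\<forall>i\<in>{1..d}. a i = \<zero>\<^bsub>K\<^esub>"
      if a: "a \<in> {1..d} \<rightarrow> carrier K" "(\<Oplus>\<^bsub>dual_coord_space \<omega> \<Lambda> d\<^esub>i\<in>{1..d}. a i \<odot>\<^bsub>dual_coord_space \<omega> \<Lambda> d\<^esub> funct d (\<epsilon> i)) = \<zero>\<^bsub>dual_coord_space \<omega> \<Lambda> d\<^esub>" for a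
    proof
      fix i assume i: "i \<in> {1..d}"
      define x where "x l = asymp_rep (a l)" for l
      have x: "moderate \<omega> \<Lambda> (x l)" "a l = ulim \<omega> \<Lambda> (x l)" if "l \<in> {1..d}" for l
        using ulim_asymp_rep[OF funcset_mem[OF a(1) that]] by (simp_all add: x_def)
      have "(\<Oplus>\<^bsub>dual_coord_space \<omega> \<Lambda> d\<^esub>i\<in>{1..d}. a i \<odot>\<^bsub>dual_coord_space \<omega> \<Lambda> d\<^esub> funct d (\<epsilon> i)) =
          funct d (\<lambda>p n. \<Sum>l\<in>{1..d}. x l n * \<epsilon> l p n)"
        unfolding x_def by (rule funct_lincomb[OF a(1)]) (use m in auto)
      then have "funct d (\<lambda>p n. \<Sum>l\<in>{1..d}. x l n * \<epsilon> l p n) = funct d (\<lambda>m n. 0)"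
        using a(2) by (simp add: funct_zero)
      moreover have "moderate_coords d (\<lambda>p n. \<Sum>l\<in>{1..d}. x l n * \<epsilon> l p n)"
        using x m by (intro moderate_coords_sum moderate_coords_smult) auto
      ultimately have "null (\<lambda>n. \<Sum>l\<in>{1..d}. x l n * \<epsilon> l p n)" if "p < d" for p
        using that by (subst (asm) funct_eq_iff) (auto simp: moderate_coords_def moderate_const)
      then have "null (x i)" using basis_family_null[OF b _ i] by blast
      then show "a i = \<zero>\<^bsub>K\<^esub>" using x[OF i] by (simp add: ulim_zero_iff)
    qed
    show "\<exists>a\<in>{1..d} \<rightarrow> carrier K. v = (\<Oplus>\<^bsub>dual_coord_space \<omega> \<Lambda> d\<^esub>i\<in>{1..d}. a i \<odot>\<^bsub>dual_coord_space \<omega> \<Lambda> d\<^esub> funct d (\<epsilon> i))"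
      if v: "v \<in> carrier (dual_coord_space \<omega> \<Lambda> d)" for v
    proof -
      obtain c where c: "moderate_coords d c" "v = funct d c" using v by (rule funct_cases)
      obtain z where z: "\<And>l. l \<in> {1..d} \<Longrightarrow> moderate \<omega> \<Lambda> (z l)"
        "\<And>p n. p < d \<Longrightarrow> c p n = (\<Sum>l\<in>{1..d}. z l n * \<epsilon> l p n)"
        using basis_family_coords[OF b c(1)] by blast
      have "v = funct d (\<lambda>p n. \<Sum>l\<in>{1..d}. z l n * \<epsilon> l p n)"
        unfolding c(2) using z c m by (subst funct_eq_iff) (auto intro!: moderate_coords_sum moderate_coords_smult)
      also have "\<dots> = (\<Oplus>\<^bsub>dual_coord_space \<omega> \<Lambda> d\<^esub>i\<in>{1..d}. ulim \<omega> \<Lambda> (z i) \<odot>\<^bsub>dual_coord_space \<omega> \<Lambda> d\<^esub> funct d (\<epsilon> i))"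
        using z m by (intro funct_sum[symmetric]) auto
      finally show ?thesis using z by (intro bexI[of _ "\<lambda>i. ulim \<omega> \<Lambda> (z i)"]) auto
    qed
  qed simp
qed

text \<open>Apply the ultrametric inequality to \<open>w\<close> plus its negative, which have the
  same norm because -1 has absolute value 1; the sum has norm 0.\<close>

lemma norm_nonneg:
  assumes \<eta>: "ultrametric_norm \<omega> \<Lambda> d \<eta>" and w: "w \<in> carrier (dual_coord_space \<omega> \<Lambda> d)"
  shows "0 \<le> \<eta> w"
proof -
  interpret D: vectorspace K "dual_coord_space \<omega> \<Lambda> d" by (rule vs_dual)
  obtain c where c: "moderate_coords d c" "w = funct d c" using w by (rule funct_cases)
  let ?V = "dual_coord_space \<omega> \<Lambda> d"
  let ?m = "ulim \<omega> \<Lambda> (\<lambda>n. -1) \<odot>\<^bsub>?V\<^esub> w"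
  have m: "?m = funct d (\<lambda>m n. - 1 * c m n)" using c by (simp only: funct_smult moderate_const)
  have "w \<oplus>\<^bsub>?V\<^esub> ?m = funct d (\<lambda>m n. c m n + - 1 * c m n)"
    unfolding m unfolding c(2) by (rule funct_add[symmetric]) (rule c(1), rule moderate_coords_smult[OF moderate_const c(1)])
  then have "w \<oplus>\<^bsub>?V\<^esub> ?m = \<zero>\<^bsub>?V\<^esub>" by (simp add: funct_zero)
  then have "\<eta> (w \<oplus>\<^bsub>?V\<^esub> ?m) = 0" using \<eta> by (auto simp: ultrametric_norm_def Let_def)
  moreover have "\<eta> ?m = \<eta> w"
    using \<eta> w asymp_abs_minus_one by (simp add: ultrametric_norm_def Let_def moderate_const)
  moreover have "\<eta> (w \<oplus>\<^bsub>?V\<^esub> ?m) \<le> max (\<eta> w) (\<eta> ?m)"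
    using \<eta> w D.smult_closed[OF ulim_carrier[OF moderate_const] w] unfolding ultrametric_norm_def Let_def by blast
  ultimately show ?thesis by simp
qed

lemma norm_funct_smult:
  assumes "ultrametric_norm \<omega> \<Lambda> d \<eta>" "moderate \<omega> \<Lambda> x" "moderate_coords d c"
  shows "\<eta> (funct d (\<lambda>m n. x n * c m n)) = asymp_abs \<omega> \<Lambda> (ulim \<omega> \<Lambda> x) * \<eta> (funct d c)"
  using assms by (simp add: funct_smult ultrametric_norm_def Let_def funct_closed)

lemma norm_funct_sum:
  assumes \<eta>: "ultrametric_norm \<omega> \<Lambda> d \<eta>" and A: "finite A" "\<And>l. l \<in> A \<Longrightarrow> moderate_coords d (c l)"
    and B: "0 \<le> B" "\<And>l. l \<in> A \<Longrightarrow> \<eta> (funct d (c l)) \<le> B"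
  shows "\<eta> (funct d (\<lambda>m n. \<Sum>l\<in>A. c l m n)) \<le> B"
  using A B(2)
proof (induction A rule: finite_induct)
  case empty
  interpret D: vectorspace K "dual_coord_space \<omega> \<Lambda> d" by (rule vs_dual)
  have "\<eta> \<zero>\<^bsub>dual_coord_space \<omega> \<Lambda> d\<^esub> = 0"
    using \<eta> D.zero_closed unfolding ultrametric_norm_def Let_def by blast
  then show ?case using B(1) by (simp add: funct_zero)
next
  case (insert k A)
  have m: "moderate_coords d (c k)" "moderate_coords d (\<lambda>m n. \<Sum>l\<in>A. c l m n)"
    using insert.prems by (auto intro: moderate_coords_sum)
  have "\<eta> (funct d (\<lambda>m n. c k m n + (\<Sum>l\<in>A. c l m n))) \<le> max (\<eta> (funct d (c k))) (\<eta> (funct d (\<lambda>m n. \<Sum>l\<in>A. c l m n)))"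
    using \<eta> m by (simp add: funct_add ultrametric_norm_def Let_def funct_closed)
  also have "\<dots> \<le> B" using insert by simp
  finally show ?case using insert.hyps by simp
qed

lemma adapted_funct:
  assumes ad: "adapted \<omega> \<Lambda> d (\<lambda>l. funct d (\<epsilon> l)) \<eta>"
    and m: "\<And>l. l \<in> {1..d} \<Longrightarrow> moderate_coords d (\<epsilon> l)" "\<And>l. l \<in> {1..d} \<Longrightarrow> moderate \<omega> \<Lambda> (x l)"
  shows "\<eta> (funct d (\<lambda>p n. \<Sum>l\<in>{1..d}. x l n * \<epsilon> l p n)) =
    Max ((\<lambda>l. asymp_abs \<omega> \<Lambda> (ulim \<omega> \<Lambda> (x l)) * \<eta> (funct d (\<epsilon> l))) ` {1..d})"
proof -
  have "(\<lambda>l. ulim \<omega> \<Lambda> (x l)) \<in> {1..d} \<rightarrow> carrier K" using m by auto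
  then have "\<eta> (\<Oplus>\<^bsub>dual_coord_space \<omega> \<Lambda> d\<^esub>l\<in>{1..d}. ulim \<omega> \<Lambda> (x l) \<odot>\<^bsub>dual_coord_space \<omega> \<Lambda> d\<^esub> funct d (\<epsilon> l)) =
    Max ((\<lambda>l. asymp_abs \<omega> \<Lambda> (ulim \<omega> \<Lambda> (x l)) * \<eta> (funct d (\<epsilon> l))) ` {1..d})"
    using ad unfolding adapted_def Let_def by (elim conjE) (erule (1) bspec)
  then show ?thesis using m by (subst (asm) funct_sum) auto
qed

text \<open>Since the coefficients of both changes of basis are nonnegative, no cancellation occurs in their
  product, so that every norm of a product of coefficients is bounded by the norm of a coefficient of the
  composed change of basis.\<close>

lemma adapted_cone:
  assumes d: "1 \<le> d" and b: "basis_family d \<epsilon>1" "basis_family d \<epsilon>2" "basis_family d \<epsilon>3"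
    and cone: "cone d \<epsilon>1 \<epsilon>2" "cone d \<epsilon>2 \<epsilon>3"
    and ad: "adapted \<omega> \<Lambda> d (\<lambda>l. funct d (\<epsilon>1 l)) \<eta>" "adapted \<omega> \<Lambda> d (\<lambda>l. funct d (\<epsilon>3 l)) \<eta>"
  shows "adapted \<omega> \<Lambda> d (\<lambda>l. funct d (\<epsilon>2 l)) \<eta>"
proof -
  let ?V = "dual_coord_space \<omega> \<Lambda> d"
  interpret D: vectorspace K ?V by (rule vs_dual)
  let ?v = "\<lambda>x. asymp_abs \<omega> \<Lambda> (ulim \<omega> \<Lambda> x)"
  define H where "H c = \<eta> (funct d c)" for c
  have \<eta>: "ultrametric_norm \<omega> \<Lambda> d \<eta>" using ad by (simp add: adapted_def Let_def)
  have mc: "moderate_coords d (\<epsilon>1 l)" "moderate_coords d (\<epsilon>2 l)" "moderate_coords d (\<epsilon>3 l)" if "l \<in> {1..d}" for l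
    using b that by (auto simp: basis_family_def)
  have H0: "0 \<le> H c" if "moderate_coords d c" for c
    unfolding H_def by (rule norm_nonneg[OF \<eta> funct_closed[OF that]])
  have Hs: "H (\<lambda>m n. x n * c m n) = ?v x * H c" if "moderate \<omega> \<Lambda> x" "moderate_coords d c" for x c
    unfolding H_def by (rule norm_funct_smult[OF \<eta> that])
  have vm: "?v (\<lambda>n. x n * y n) * H c = ?v x * (?v y * H c)"
    if "moderate \<omega> \<Lambda> x" "moderate \<omega> \<Lambda> y" "moderate_coords d c" for x y c
    using Hs[OF moderate_mult[OF that(1,2)] that(3)] Hs[OF that(1) moderate_coords_smult[OF that(2,3)]] Hs[OF that(2,3)]
    by (simp only: mult.assoc)
  obtain A where A: "\<And>m l. m \<in> {1..d} \<Longrightarrow> l \<in> {1..d} \<Longrightarrow> moderate \<omega> \<Lambda> (A m l)"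
    "\<And>m l n. m \<in> {1..d} \<Longrightarrow> l \<in> {1..d} \<Longrightarrow> 0 \<le> A m l n"
    "\<And>m p n. m \<in> {1..d} \<Longrightarrow> p < d \<Longrightarrow> \<epsilon>2 m p n = (\<Sum>l\<in>{1..d}. A m l n * \<epsilon>1 l p n)"
    using cone(1) unfolding cone_def by blast
  obtain B where B: "\<And>m l. m \<in> {1..d} \<Longrightarrow> l \<in> {1..d} \<Longrightarrow> moderate \<omega> \<Lambda> (B m l)"
    "\<And>m l n. m \<in> {1..d} \<Longrightarrow> l \<in> {1..d} \<Longrightarrow> 0 \<le> B m l n"
    "\<And>m p n. m \<in> {1..d} \<Longrightarrow> p < d \<Longrightarrow> \<epsilon>3 m p n = (\<Sum>l\<in>{1..d}. B m l n * \<epsilon>2 l p n)"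
    using cone(2) unfolding cone_def by blast
  \<comment> \<open>The matrix of the composed change of basis from \<open>\<epsilon>1\<close> to
    \<open>\<epsilon>3\<close>.\<close>
  define M where "M k l n = (\<Sum>m\<in>{1..d}. B k m n * A m l n)" for k l n
  have mM: "moderate \<omega> \<Lambda> (M k l)" if "k \<in> {1..d}" "l \<in> {1..d}" for k l
    unfolding M_def using A(1) B(1) that by (intro moderate_sum moderate_mult) auto
  have H2: "H (\<epsilon>2 m) = Max ((\<lambda>l. ?v (A m l) * H (\<epsilon>1 l)) ` {1..d})" if m: "m \<in> {1..d}" for m
  proof -
    have "funct d (\<epsilon>2 m) = funct d (\<lambda>p n. \<Sum>l\<in>{1..d}. A m l n * \<epsilon>1 l p n)"
      using A m mc by (subst funct_eq_iff) (auto intro!: moderate_coords_sum moderate_coords_smult)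
    then show ?thesis unfolding H_def
      using adapted_funct[OF ad(1) mc(1), of "A m"] A(1)[OF m] by simp
  qed
  have H3: "?v (M k l) * H (\<epsilon>1 l) \<le> H (\<epsilon>3 k)" if k: "k \<in> {1..d}" "l \<in> {1..d}" for k l
  proof -
    have eq: "\<epsilon>3 k p n = (\<Sum>l\<in>{1..d}. M k l n * \<epsilon>1 l p n)" if p: "p < d" for p n
    proof -
      have "\<epsilon>3 k p n = (\<Sum>m\<in>{1..d}. \<Sum>l\<in>{1..d}. B k m n * A m l n * \<epsilon>1 l p n)"
        unfolding B(3)[OF k(1) p] by (intro sum.cong refl) (simp add: A(3) p sum_distrib_left mult.assoc)
      then show ?thesis unfolding M_def by (subst (asm) sum.swap) (simp add: sum_distrib_right)
    qed
    have "funct d (\<epsilon>3 k) = funct d (\<lambda>p n. \<Sum>l\<in>{1..d}. M k l n * \<epsilon>1 l p n)"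
      using mM eq k mc by (subst funct_eq_iff) (auto intro!: moderate_coords_sum moderate_coords_smult)
    then have "H (\<epsilon>3 k) = Max ((\<lambda>l. ?v (M k l) * H (\<epsilon>1 l)) ` {1..d})"
      unfolding H_def using adapted_funct[OF ad(1) mc(1), of "M k"] mM[OF k(1)] by simp
    then show ?thesis using k(2) by simp
  qed
  have BH: "?v (B k m) * H (\<epsilon>2 m) \<le> H (\<epsilon>3 k)" if km: "k \<in> {1..d}" "m \<in> {1..d}" for k m
  proof -
    \<comment> \<open>An index \<open>l\<close> at which the maximum is attained selects the one
      entry \<open>M k l\<close> to compare with.\<close>
    have "H (\<epsilon>2 m) \<in> (\<lambda>l. ?v (A m l) * H (\<epsilon>1 l)) ` {1..d}"
      unfolding H2[OF km(2)] using d by (intro Max_in) auto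
    then obtain l where l: "l \<in> {1..d}" "H (\<epsilon>2 m) = ?v (A m l) * H (\<epsilon>1 l)" by blast
    have "?v (B k m) * H (\<epsilon>2 m) = ?v (\<lambda>n. B k m n * A m l n) * H (\<epsilon>1 l)"
      unfolding l(2) using l km A(1) B(1) mc by (intro vm[symmetric]) auto
    also have "\<dots> \<le> ?v (M k l) * H (\<epsilon>1 l)"
    proof (intro mult_right_mono asymp_abs_mono H0 mc(1) l mM km)
      show "moderate \<omega> \<Lambda> (\<lambda>n. B k m n * A m l n)" using km l A B by (intro moderate_mult) auto
      fix n
      have "B k m n * A m l n \<le> M k l n"
        unfolding M_def using km l A(2) B(2) by (intro member_le_sum[where f = "\<lambda>m. B k m n * A m l n"]) auto
      moreover have "0 \<le> B k m n * A m l n" using km l A B by simp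
      ultimately show "\<bar>B k m n * A m l n\<bar> \<le> \<bar>M k l n\<bar>" by simp
    qed
    also have "\<dots> \<le> H (\<epsilon>3 k)" by (rule H3[OF km(1) l(1)])
    finally show ?thesis .
  qed
  have main: "H (\<lambda>p n. \<Sum>l\<in>{1..d}. X l n * \<epsilon>2 l p n) = Max ((\<lambda>l. ?v (X l) * H (\<epsilon>2 l)) ` {1..d})"
    if X: "\<And>l. l \<in> {1..d} \<Longrightarrow> moderate \<omega> \<Lambda> (X l)" for X
  proof (rule antisym)
    let ?R = "Max ((\<lambda>l. ?v (X l) * H (\<epsilon>2 l)) ` {1..d})"
    define w where "w p n = (\<Sum>l\<in>{1..d}. X l n * \<epsilon>2 l p n)" for p n
    have mw: "moderate_coords d w"
      unfolding w_def using X mc by (intro moderate_coords_sum moderate_coords_smult) auto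
    have le: "H (\<lambda>p n. X l n * \<epsilon>2 l p n) \<le> ?R" if "l \<in> {1..d}" for l
      using that X mc by (simp add: Hs)
    have "0 \<le> ?v (X 1) * H (\<epsilon>2 1)" using d mc by (intro mult_nonneg_nonneg asymp_abs_nonneg H0) auto
    also have "\<dots> \<le> ?R" using d by (intro Max_ge) auto
    finally show "H (\<lambda>p n. \<Sum>l\<in>{1..d}. X l n * \<epsilon>2 l p n) \<le> ?R"
      unfolding H_def using X mc le by (intro norm_funct_sum[OF \<eta>]) (auto intro!: moderate_coords_smult simp: H_def)
    obtain z where z: "\<And>l. l \<in> {1..d} \<Longrightarrow> moderate \<omega> \<Lambda> (z l)"
      "\<And>p n. p < d \<Longrightarrow> w p n = (\<Sum>l\<in>{1..d}. z l n * \<epsilon>3 l p n)"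
      using basis_family_coords[OF b(3) mw] by blast
    obtain Q where "\<And>p l. p < d \<Longrightarrow> l \<in> {1..d} \<Longrightarrow> moderate \<omega> \<Lambda> (Q p l)"
      and Q: "\<And>x m n. m \<in> {1..d} \<Longrightarrow> (\<Sum>p<d. (\<Sum>l\<in>{1..d}. x l * \<epsilon>2 l p n) * Q p m n) = x m"
      using basis_family_dual[OF b(2)] by blast
    \<comment> \<open>The two expansions of \<open>w\<close> in \<open>\<epsilon>2\<close>, directly
      and through \<open>\<epsilon>3\<close>, have the same coefficients at each time because
      \<open>Q\<close> reads them off.\<close>
    have Xz: "X m n = (\<Sum>k\<in>{1..d}. z k n * B k m n)" if m: "m \<in> {1..d}" for m n
    proof -
      have wz: "(\<Sum>l\<in>{1..d}. X l n * \<epsilon>2 l p n) = (\<Sum>l\<in>{1..d}. (\<Sum>k\<in>{1..d}. z k n * B k l n) * \<epsilon>2 l p n)" if p: "p < d" for p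
      proof -
        have "(\<Sum>l\<in>{1..d}. X l n * \<epsilon>2 l p n) = (\<Sum>k\<in>{1..d}. \<Sum>l\<in>{1..d}. z k n * B k l n * \<epsilon>2 l p n)"
          unfolding z(2)[OF p, of n, unfolded w_def]
          by (intro sum.cong refl) (simp add: B(3) p sum_distrib_left mult.assoc)
        then show ?thesis by (subst (asm) sum.swap) (simp add: sum_distrib_right)
      qed
      have "X m n = (\<Sum>p<d. (\<Sum>l\<in>{1..d}. X l n * \<epsilon>2 l p n) * Q p m n)" by (rule Q[OF m, symmetric])
      also have "\<dots> = (\<Sum>p<d. (\<Sum>l\<in>{1..d}. (\<Sum>k\<in>{1..d}. z k n * B k l n) * \<epsilon>2 l p n) * Q p m n)"
        by (rule sum.cong[OF refl]) (simp only: wz lessThan_iff)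
      also have "\<dots> = (\<Sum>k\<in>{1..d}. z k n * B k m n)" by (rule Q[OF m])
      finally show ?thesis .
    qed
    have Hw: "?v (z k) * H (\<epsilon>3 k) \<le> H w" if k: "k \<in> {1..d}" for k
    proof -
      have "funct d w = funct d (\<lambda>p n. \<Sum>l\<in>{1..d}. z l n * \<epsilon>3 l p n)"
        using z mw mc by (subst funct_eq_iff) (auto intro!: moderate_coords_sum moderate_coords_smult)
      then have "H w = Max ((\<lambda>l. ?v (z l) * H (\<epsilon>3 l)) ` {1..d})"
        unfolding H_def using adapted_funct[OF ad(2) mc(3), of z] z(1) by simp
      then show ?thesis using k by simp
    qed
    have "?v (X m) * H (\<epsilon>2 m) \<le> H w" if m: "m \<in> {1..d}" for m
    proof -
      have "?v (X m) * H (\<epsilon>2 m) = H (\<lambda>p n. X m n * \<epsilon>2 m p n)" using X mc m by (simp add: Hs)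
      also have "(\<lambda>p n. X m n * \<epsilon>2 m p n) = (\<lambda>p n. \<Sum>k\<in>{1..d}. z k n * (B k m n * \<epsilon>2 m p n))"
        unfolding Xz[OF m] by (simp add: sum_distrib_right mult.assoc)
      also have "H \<dots> \<le> H w"
        unfolding H_def
      proof (intro norm_funct_sum[OF \<eta>])
        fix k assume k: "k \<in> {1..d}"
        show "moderate_coords d (\<lambda>p n. z k n * (B k m n * \<epsilon>2 m p n))"
          using z(1) B(1) mc k m by (intro moderate_coords_smult) auto
        have "H (\<lambda>p n. z k n * (B k m n * \<epsilon>2 m p n)) = ?v (z k) * (?v (B k m) * H (\<epsilon>2 m))"
          using z(1) B(1) mc k m by (simp add: Hs moderate_coords_smult)
        also have "\<dots> \<le> ?v (z k) * H (\<epsilon>3 k)"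
          by (intro mult_left_mono BH k m asymp_abs_nonneg)
        also have "\<dots> \<le> H w" by (rule Hw[OF k])
        finally show "\<eta> (funct d (\<lambda>p n. z k n * (B k m n * \<epsilon>2 m p n))) \<le> \<eta> (funct d w)" unfolding H_def .
      next
        show "0 \<le> \<eta> (funct d w)" using H0[OF mw] by (simp add: H_def)
      qed simp
      finally show ?thesis .
    qed
    then show "?R \<le> H (\<lambda>p n. \<Sum>l\<in>{1..d}. X l n * \<epsilon>2 l p n)"
      using d unfolding w_def by (intro Max.boundedI) auto
  qed
  show ?thesis
    unfolding adapted_def Let_def
  proof (intro conjI \<eta> basis_family_basis[OF b(2)] ballI)
    fix x assume x: "x \<in> {1..d} \<rightarrow> carrier K"
    define X where "X l = asymp_rep (x l)" for l
    have X: "moderate \<omega> \<Lambda> (X l)" "x l = ulim \<omega> \<Lambda> (X l)" if "l \<in> {1..d}" for l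
      using ulim_asymp_rep[OF funcset_mem[OF x that]] by (simp_all add: X_def)
    have "(\<Oplus>\<^bsub>?V\<^esub>l\<in>{1..d}. x l \<odot>\<^bsub>?V\<^esub> funct d (\<epsilon>2 l)) = funct d (\<lambda>p n. \<Sum>l\<in>{1..d}. X l n * \<epsilon>2 l p n)"
      unfolding X_def by (rule funct_lincomb[OF x]) (use mc in auto)
    then have "\<eta> (\<Oplus>\<^bsub>?V\<^esub>l\<in>{1..d}. x l \<odot>\<^bsub>?V\<^esub> funct d (\<epsilon>2 l)) = Max ((\<lambda>l. ?v (X l) * H (\<epsilon>2 l)) ` {1..d})"
      using main[of X] X(1) by (simp add: H_def)
    also have "(\<lambda>l. ?v (X l) * H (\<epsilon>2 l)) ` {1..d} = (\<lambda>l. asymp_abs \<omega> \<Lambda> (x l) * \<eta> (funct d (\<epsilon>2 l))) ` {1..d}"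
      using X(2) by (intro image_cong) (auto simp: H_def)
    finally show "\<eta> (\<Oplus>\<^bsub>?V\<^esub>l\<in>{1..d}. x l \<odot>\<^bsub>?V\<^esub> funct d (\<epsilon>2 l)) =
      Max ((\<lambda>l. asymp_abs \<omega> \<Lambda> (x l) * \<eta> (funct d (\<epsilon>2 l))) ` {1..d})" .
  qed
qed

end

section \<open>Maximum span and brackets\<close>

text \<open>Both sides are submodules, so each inclusion only has to be checked on generators. This
  translates the sums in \<open>maximum_span\<close> into spans of explicit vectors.\<close>

lemma (in module) sum_of_spans:
  assumes I: "finite I" and B: "\<And>i. i \<in> I \<Longrightarrow> B i \<subseteq> carrier M"
  shows "sum_of_subspaces M I (\<lambda>i. span (B i)) = span (\<Union>i\<in>I. B i)"
proof (rule antisym)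
  let ?S = "sum_of_subspaces M I (\<lambda>i. span (B i))" and ?W = "\<Union>i\<in>I. B i"
  have W: "?W \<subseteq> carrier M" using B by auto
  have sp: "submodule R (span (B i)) M" if "i \<in> I" for i by (rule span_is_submodule[OF B[OF that]])
  have cl: "span (B i) \<subseteq> carrier M" if "i \<in> I" for i by (rule span_is_subset2[OF B[OF that]])
  have SI: "finsum M x I \<in> ?S" if "\<And>i. i \<in> I \<Longrightarrow> x i \<in> span (B i)" for x
    using that unfolding sum_of_subspaces_def by blast
  have "finsum M x A \<in> span ?W" if "finite A" "A \<subseteq> I" "\<forall>i\<in>I. x i \<in> span (B i)" for x A
    using that
  proof (induction A rule: finite_induct)
    case empty
    then show ?case using submodule.zero_closed[OF span_is_submodule[OF W]] by simp
  next
    case (insert i A)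
    have "x i \<in> span ?W" using insert.prems span_is_monotone[of "B i" ?W] by blast
    moreover have "finsum M x (insert i A) = x i \<oplus>\<^bsub>M\<^esub> finsum M x A"
      by (rule finsum_insert) (use insert cl in \<open>auto simp: Pi_iff\<close>)
    ultimately show ?case using insert submodule.m_closed[OF span_is_submodule[OF W]] by simp
  qed
  then show "?S \<subseteq> span ?W" using I unfolding sum_of_subspaces_def by blast
  have "submodule R ?S M"
  proof
    show "?S \<subseteq> carrier M"
    proof
      fix u assume "u \<in> ?S"
      then obtain x where x: "u = finsum M x I" "\<forall>i\<in>I. x i \<in> span (B i)" unfolding sum_of_subspaces_def by blast
      show "u \<in> carrier M" unfolding x(1) using x(2) cl by (intro finsum_closed) blast
    qed
    show "\<zero>\<^bsub>M\<^esub> \<in> ?S"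
    proof -
      have "finsum M (\<lambda>_. \<zero>\<^bsub>M\<^esub>) I \<in> ?S" using submodule.zero_closed[OF sp] by (intro SI)
      then show ?thesis by (simp add: finsum_zero)
    qed
  next
    fix u w assume "u \<in> ?S" "w \<in> ?S"
    then obtain x y where x: "u = finsum M x I" "\<forall>i\<in>I. x i \<in> span (B i)"
      and y: "w = finsum M y I" "\<forall>i\<in>I. y i \<in> span (B i)" unfolding sum_of_subspaces_def by blast
    have "finsum M (\<lambda>i. x i \<oplus>\<^bsub>M\<^esub> y i) I \<in> ?S" using x y submodule.m_closed[OF sp] by (intro SI) auto
    moreover have "finsum M (\<lambda>i. x i \<oplus>\<^bsub>M\<^esub> y i) I = u \<oplus>\<^bsub>M\<^esub> w"
      unfolding x(1) y(1) using x y cl by (intro finsum_addf) (auto simp: Pi_iff)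
    ultimately show "u \<oplus>\<^bsub>M\<^esub> w \<in> ?S" by simp
  next
    fix c u assume c: "c \<in> carrier R" and "u \<in> ?S"
    then obtain x where x: "u = finsum M x I" "\<forall>i\<in>I. x i \<in> span (B i)" unfolding sum_of_subspaces_def by blast
    have "finsum M (\<lambda>i. c \<odot>\<^bsub>M\<^esub> x i) I \<in> ?S" using x c submodule.smult_closed[OF sp] by (intro SI) auto
    moreover have "finsum M (\<lambda>i. c \<odot>\<^bsub>M\<^esub> x i) I = c \<odot>\<^bsub>M\<^esub> u"
      unfolding x(1) using x cl c I by (intro finsum_smult[symmetric]) (auto simp: Pi_iff)
    ultimately show "c \<odot>\<^bsub>M\<^esub> u \<in> ?S" by simp
  qed
  moreover have "?W \<subseteq> ?S"
  proof
    fix w assume "w \<in> ?W"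
    then obtain i where i: "i \<in> I" "w \<in> B i" by blast
    define x where "x j = (if j = i then w else \<zero>\<^bsub>M\<^esub>)" for j
    have "finsum M x I \<in> ?S"
      by (rule SI) (use i in_own_span[OF B] submodule.zero_closed[OF sp] in \<open>auto simp: x_def\<close>)
    moreover have "finsum M x I = w"
    proof -
      have "finsum M x I = finsum M (\<lambda>j. if i = j then (\<lambda>_. w) j else \<zero>\<^bsub>M\<^esub>) I"
        using i B[OF i(1)] by (intro finsum_cong') (auto simp: x_def)
      also have "\<dots> = w" using i I B[OF i(1)] by (subst finsum_singleton) auto
      finally show ?thesis .
    qed
    ultimately show "w \<in> ?S" by simp
  qed
  ultimately show "span ?W \<subseteq> ?S" by (intro span_is_subset)
qed

text \<open>A basis of the span, taken in the restricted module, stays independent in the whole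
  space; having as many elements as the dimension, it is a basis there.\<close>

lemma (in vectorspace) span_full:
  assumes fd: "fin_dim" and W: "finite W" "W \<subseteq> carrier V" and dm: "vectorspace.dim K (vs (span W)) = dim"
  shows "span W = carrier V"
proof -
  have sub: "submodule K (span W) V" by (rule span_is_submodule[OF W(2)])
  have vsW: "vectorspace K (vs (span W))"
    by (rule subspace_is_vs) (use sub vectorspace_axioms in \<open>simp add: subspace_def\<close>)
  interpret S: vectorspace K "vs (span W)" by (rule vsW)
  have own: "W \<subseteq> span W" by (rule in_own_span[OF W(2)])
  have "S.fin_dim"
    unfolding S.fin_dim_def using W own span_li_not_depend(1)[OF own sub] by auto
  then obtain \<beta> where \<beta>: "finite \<beta>" "S.basis \<beta>" using S.finite_basis_exists by blast
  have c: "card \<beta> = dim" using S.dim_basis[OF \<beta>] dm by simp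
  have \<beta>sub: "\<beta> \<subseteq> span W" using \<beta> by (simp add: S.basis_def)
  have li: "lin_indpt \<beta>" using \<beta> span_li_not_depend(2)[OF \<beta>sub sub] by (simp add: S.basis_def)
  have \<beta>c: "\<beta> \<subseteq> carrier V" using \<beta>sub span_is_subset2[OF W(2)] by blast
  have "basis \<beta>" by (rule dim_li_is_basis[OF fd \<beta>(1) \<beta>c li]) (simp add: c)
  then have "carrier V = span \<beta>" by (simp add: basis_def)
  also have "\<dots> \<subseteq> span W" by (rule span_is_subset[OF \<beta>sub sub])
  finally show ?thesis using span_is_subset2[OF W(2)] by blast
qed

text \<open>The selected vectors span a space of dimension \<open>d\<close>, hence everything; as
  there are only \<open>d\<close> of them, they must be distinct. Any field is allowed because the
  lemma serves the real flags as well as their ultralimits.\<close>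

lemma maximum_span_generates:
  fixes F :: "nat \<Rightarrow> 'a flag"
  assumes fld: "field k" and d: "1 \<le> d" and ms: "maximum_span k d t F"
    and bas: "\<And>i. i \<in> {1..t} \<Longrightarrow> indexed_basis k (coord_space k d) d (v i)"
    and F: "\<And>i a. i \<in> {1..t} \<Longrightarrow> a \<le> d \<Longrightarrow> F i a = module.span k (coord_space k d) (v i ` {1..a})"
    and ix: "distinct ix" "set ix \<subseteq> {1..t}" "length as = length ix" "sum_list as = d"
  defines "ws \<equiv> concat (map2 (\<lambda>i a. blk (v i) a) ix as)"
  shows "length ws = d" "distinct ws" "set ws \<subseteq> carrier (coord_space k d)"
    "module.span k (coord_space k d) (set ws) = carrier (coord_space k d)"
proof -
  interpret V: vectorspace k "coord_space k d" by (rule vectorspace_coord_space[OF fld])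
  have carr: "v i s \<in> carrier (coord_space k d)" if "i \<in> {1..t}" "s \<in> {1..d}" for i s
    using bas[OF that(1)] that(2) by (auto simp: indexed_basis_def V.basis_def)
  \<comment> \<open>The exponents \<open>as\<close> extended by 0 to flags outside
    \<open>ix\<close>, as \<open>maximum_span\<close> quantifies over all \<open>t\<close> flags;
    exponent 0 adds no vectors.\<close>
  define a where "a i = (case map_of (zip ix as) i of Some n \<Rightarrow> n | None \<Rightarrow> 0)" for i
  have a_nth: "a (ix ! j) = as ! j" if "j < length ix" for j
    using ix that by (simp add: a_def map_of_zip_nth)
  have map_a: "map a ix = as" by (rule nth_equalityI) (use ix a_nth in auto)
  have a0: "a i = 0" if "i \<notin> set ix" for i
  proof -
    have "map_of (zip ix as) i = None" using that by (auto simp: map_of_eq_None_iff dest: set_zip_leftD)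
    then show ?thesis by (simp add: a_def)
  qed
  have a_le: "a i \<le> d" for i
  proof (cases "i \<in> set ix")
    case True
    then have "a i \<in> set as" using map_a by (metis imageI set_map)
    then show ?thesis using member_le_sum_list ix(4) by blast
  qed (simp add: a0)
  have sum_a: "(\<Sum>i\<in>{1..t}. a i) = d"
  proof -
    have "(\<Sum>i\<in>{1..t}. a i) = (\<Sum>i\<in>set ix. a i)"
      by (rule sum.mono_neutral_right) (use ix a0 in auto)
    also have "\<dots> = sum_list (map a ix)" by (rule sum.distinct_set_conv_list[OF ix(1)])
    finally show ?thesis using map_a ix by simp
  qed
  have ws: "ws = concat (map (\<lambda>i. blk (v i) (a i)) ix)"
  proof -
    have "map2 (\<lambda>i a. blk (v i) a) ix as = map (\<lambda>i. blk (v i) (a i)) ix"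
      by (rule nth_equalityI) (use ix a_nth in auto)
    then show ?thesis by (simp add: ws_def)
  qed
  have set_ws: "set ws = (\<Union>i\<in>{1..t}. v i ` {1..a i})"
  proof -
    have "set ws = (\<Union>i\<in>set ix. v i ` {1..a i})" by (simp add: ws set_blk)
    moreover have "v i ` {1..a i} = {}" if "i \<notin> set ix" for i using a0[OF that] by simp
    ultimately show ?thesis using ix(2) by blast
  qed
  show len: "length ws = d"
  proof -
    have "length ws = sum_list (map a ix)" by (simp add: ws length_concat o_def)
    then show ?thesis using map_a ix(4) by simp
  qed
  show sub: "set ws \<subseteq> carrier (coord_space k d)"
    unfolding set_ws by (auto intro!: carr intro: le_trans[OF _ a_le])
  have "ix \<noteq> []" using ix d by auto
  then obtain i0 where "i0 \<in> set ix" by (cases ix) auto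
  then have i0: "i0 \<in> {1..t}" using ix by auto
  have b0: "inj_on (v i0) {1..d}" "V.basis (v i0 ` {1..d})" using bas[OF i0] by (auto simp: indexed_basis_def)
  have dim: "V.dim = d" using V.dim_basis[OF _ b0(2)] card_image[OF b0(1)] by simp
  have fd: "V.fin_dim"
    unfolding V.fin_dim_def using b0(2) by (intro exI[of _ "v i0 ` {1..d}"]) (auto simp: V.basis_def)
  have "sum_of_subspaces (coord_space k d) {1..t} (\<lambda>i. F i (a i)) = V.span (set ws)"
  proof -
    have "sum_of_subspaces (coord_space k d) {1..t} (\<lambda>i. F i (a i)) =
        sum_of_subspaces (coord_space k d) {1..t} (\<lambda>i. V.span (v i ` {1..a i}))"
      unfolding sum_of_subspaces_def using F a_le by (auto intro!: Collect_cong)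
    also have "\<dots> = V.span (set ws)" unfolding set_ws
    proof (rule V.sum_of_spans)
      show "v i ` {1..a i} \<subseteq> carrier (coord_space k d)" if "i \<in> {1..t}" for i
        using carr[OF that] a_le[of i] by auto
    qed simp
    finally show ?thesis .
  qed
  moreover have "vectorspace.dim k ((coord_space k d)\<lparr>carrier := sum_of_subspaces (coord_space k d) {1..t} (\<lambda>i. F i (a i))\<rparr>) = d"
    using ms a_le sum_a unfolding maximum_span_def by simp
  ultimately show gen: "V.span (set ws) = carrier (coord_space k d)"
    using V.span_full[OF fd _ sub] dim by simp
  have "d \<le> card (set ws)" using V.gen_ge_dim[OF _ sub gen] dim by simp
  then have "card (set ws) = length ws" using card_length[of ws] len by simp
  then show "distinct ws" by (rule card_distinct)
qed

lemma coord_space_finsum: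
  assumes fld: "field k" and f: "finite A" "f \<in> A \<rightarrow> carrier (coord_space k d)" and m: "m < d"
  shows "finsum (coord_space k d) f A $ m = finsum k (\<lambda>x. f x $ m) A"
proof -
  interpret V: vectorspace k "coord_space k d" by (rule vectorspace_coord_space[OF fld])
  have c: "u $ m \<in> carrier k" if "u \<in> carrier (coord_space k d)" for u
    using that m by (simp add: coord_space_def)
  have z: "\<zero>\<^bsub>coord_space k d\<^esub> $ m = \<zero>\<^bsub>k\<^esub>" "(u \<oplus>\<^bsub>coord_space k d\<^esub> w) $ m = u $ m \<oplus>\<^bsub>k\<^esub> w $ m" for u w
    using m by (simp_all add: coord_space_def)
  show ?thesis using f
  proof (induction A rule: finite_induct)
    case (insert x A)
    have "finsum (coord_space k d) f (insert x A) = f x \<oplus>\<^bsub>coord_space k d\<^esub> finsum (coord_space k d) f A"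
      by (rule V.finsum_insert) (use insert in auto)
    moreover have "finsum k (\<lambda>x. f x $ m) (insert x A) = f x $ m \<oplus>\<^bsub>k\<^esub> finsum k (\<lambda>x. f x $ m) A"
      by (rule V.R.finsum_insert) (use insert c in \<open>auto simp: Pi_iff\<close>)
    ultimately show ?case using insert z by simp
  qed (simp add: z)
qed

lemma span_coordinates:
  assumes fld: "field k" and I: "finite I" "inj_on e I" "e ` I \<subseteq> carrier (coord_space k d)"
    and u: "u \<in> module.span k (coord_space k d) (e ` I)"
  obtains c where "c \<in> I \<rightarrow> carrier k" "\<And>m. m < d \<Longrightarrow> u $ m = (\<Oplus>\<^bsub>k\<^esub>i\<in>I. c i \<otimes>\<^bsub>k\<^esub> e i $ m)"
proof -
  interpret V: vectorspace k "coord_space k d" by (rule vectorspace_coord_space[OF fld])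
  have e: "e \<in> I \<rightarrow> carrier (coord_space k d)" using I by auto
  obtain c where c: "c \<in> I \<rightarrow> carrier k" "u = (\<Oplus>\<^bsub>coord_space k d\<^esub>i\<in>I. c i \<odot>\<^bsub>coord_space k d\<^esub> e i)"
    using u unfolding V.span_image[OF I(1,2) e] by blast
  have "u $ m = (\<Oplus>\<^bsub>k\<^esub>i\<in>I. c i \<otimes>\<^bsub>k\<^esub> e i $ m)" if m: "m < d" for m
  proof -
    have "(\<lambda>i. c i \<odot>\<^bsub>coord_space k d\<^esub> e i) \<in> I \<rightarrow> carrier (coord_space k d)"
      using c e by (auto intro!: V.smult_closed)
    from coord_space_finsum[OF fld I(1) this m]
    have "u $ m = (\<Oplus>\<^bsub>k\<^esub>i\<in>I. (c i \<odot>\<^bsub>coord_space k d\<^esub> e i) $ m)" by (simp only: c(2))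
    also have "(\<lambda>i. (c i \<odot>\<^bsub>coord_space k d\<^esub> e i) $ m) = (\<lambda>i. c i \<otimes>\<^bsub>k\<^esub> e i $ m)"
      using m by (simp add: coord_space_def)
    finally show ?thesis .
  qed
  then show ?thesis using that c(1) by blast
qed

text \<open>Expanding the unit vectors in \<open>ws\<close> exhibits the identity matrix as a
  product, so the bracket has a factor complementing it to 1.\<close>

lemma real_span_brk_nonzero:
  fixes ws :: "real vec list"
  assumes ws: "length ws = d" "distinct ws" "set ws \<subseteq> carrier (coord_space class_ring d)"
    and gen: "module.span class_ring (coord_space class_ring d) (set ws) = carrier (coord_space class_ring d)"
  shows "brk d ws \<noteq> 0"
proof
  assume z: "brk d ws = 0"
  have img: "set ws = (!) ws ` {..<d}" using ws(1) by (auto simp: set_conv_nth)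
  have inj: "inj_on ((!) ws) {..<d}" using ws(1,2) by (auto intro: inj_on_nth)
  have sub: "(!) ws ` {..<d} \<subseteq> carrier (coord_space class_ring d)" using ws(3) unfolding img .
  have ex: "\<exists>c. i < d \<longrightarrow> (\<forall>m<d. unit_vec d i $ m = (\<Sum>j<d. c j * ws ! j $ m))" for i
  proof (cases "i < d")
    case i: True
    have mem: "unit_vec d i \<in> module.span class_ring (coord_space class_ring d) ((!) ws ` {..<d})"
      using gen unfolding img by (simp add: coord_space_def class_ring_simps)
    obtain c where "c \<in> {..<d} \<rightarrow> carrier class_ring"
      "\<And>m. m < d \<Longrightarrow> unit_vec d i $ m = (\<Oplus>\<^bsub>class_ring\<^esub>j\<in>{..<d}. c j \<otimes>\<^bsub>class_ring\<^esub> ws ! j $ m)"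
      by (rule span_coordinates[OF class_field finite_lessThan inj sub mem]) (rule that)
    then have "\<forall>m<d. unit_vec d i $ m = (\<Sum>j<d. c j * ws ! j $ m)" by (simp only: class_ring_simps) blast
    then show ?thesis by blast
  qed simp
  have "\<exists>c. \<forall>i. i < d \<longrightarrow> (\<forall>m<d. unit_vec d i $ m = (\<Sum>j<d. c i j * ws ! j $ m))"
    by (rule choice, rule allI, rule ex)
  then obtain c where c: "\<forall>i. i < d \<longrightarrow> (\<forall>m<d. unit_vec d i $ m = (\<Sum>j<d. c i j * ws ! j $ m))" by blast
  have "brk d (map (unit_vec d) [0..<d] @ []) = det (mat d d (\<lambda>(i, j). c i j)) * brk d (ws @ [])"
    by (rule brk_change[of _ d]) (use ws c in auto)
  moreover have "mat_of_rows d (map (unit_vec d) [0..<d]) = (1\<^sub>m d :: real mat)"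
    by (intro eq_matI) (auto simp: mat_of_rows_index)
  ultimately show False using z by (simp add: brk_def)
qed

section \<open>Nondegeneracy of brackets in the limit\<close>

context asymp_scale
begin

lemma finsum_ulim:
  assumes "finite A" "\<And>i. i \<in> A \<Longrightarrow> moderate \<omega> \<Lambda> (f i)"
  shows "(\<Oplus>\<^bsub>K\<^esub>i\<in>A. ulim \<omega> \<Lambda> (f i)) = ulim \<omega> \<Lambda> (\<lambda>n. \<Sum>i\<in>A. f i n)"
proof -
  interpret K: field K by (rule field_asymp_field)
  show ?thesis using assms
  proof (induction A rule: finite_induct)
    case (insert x A)
    have "(\<Oplus>\<^bsub>K\<^esub>i\<in>insert x A. ulim \<omega> \<Lambda> (f i)) = ulim \<omega> \<Lambda> (f x) \<oplus>\<^bsub>K\<^esub> (\<Oplus>\<^bsub>K\<^esub>i\<in>A. ulim \<omega> \<Lambda> (f i))"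
      by (rule K.finsum_insert) (use insert in auto)
    then show ?case using insert by (simp add: add_ulim moderate_sum)
  qed (simp add: zero_K)
qed

text \<open>Induction by changing one factor at a time: the difference telescopes into null factors
  multiplied by moderate products.\<close>

lemma null_prod_diff:
  assumes "\<And>i. i \<in> A \<Longrightarrow> moderate \<omega> \<Lambda> (f i)" "\<And>i. i \<in> A \<Longrightarrow> moderate \<omega> \<Lambda> (g i)"
    "\<And>i. i \<in> A \<Longrightarrow> null (\<lambda>n. f i n - g i n)"
  shows "null (\<lambda>n. (\<Prod>i\<in>A. f i n) - (\<Prod>i\<in>A. g i n))"
  using assms
proof (induction A rule: infinite_finite_induct)
  case (insert x A)
  have "null (\<lambda>n. (f x n - g x n) * (\<Prod>i\<in>A. f i n) + g x n * ((\<Prod>i\<in>A. f i n) - (\<Prod>i\<in>A. g i n)))"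
    by (intro null_add null_mult null_mult' moderate_prod) (use insert in auto)
  moreover have "(f x n - g x n) * (\<Prod>i\<in>A. f i n) + g x n * ((\<Prod>i\<in>A. f i n) - (\<Prod>i\<in>A. g i n)) =
    (\<Prod>i\<in>insert x A. f i n) - (\<Prod>i\<in>insert x A. g i n)" for n
    using insert by (simp add: algebra_simps)
  ultimately show ?case by simp
qed auto

lemma null_det_diff:
  assumes c: "\<And>n. A n \<in> carrier_mat d d" "\<And>n. B n \<in> carrier_mat d d"
    and m: "\<And>i j. i < d \<Longrightarrow> j < d \<Longrightarrow> moderate \<omega> \<Lambda> (\<lambda>n. A n $$ (i, j))"
      "\<And>i j. i < d \<Longrightarrow> j < d \<Longrightarrow> moderate \<omega> \<Lambda> (\<lambda>n. B n $$ (i, j))"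
    and nl: "\<And>i j. i < d \<Longrightarrow> j < d \<Longrightarrow> null (\<lambda>n. A n $$ (i, j) - B n $$ (i, j))"
  shows "null (\<lambda>n. det (A n) - det (B n))"
proof -
  have p: "p i < d" if "p permutes {0..<d}" "i < d" for p i
    using permutes_in_image[OF that(1), of i] that(2) by simp
  have "null (\<lambda>n. \<Sum>p\<in>{p. p permutes {0..<d}}. signof p *
      ((\<Prod>i = 0..<d. A n $$ (i, p i)) - (\<Prod>i = 0..<d. B n $$ (i, p i))))"
    by (intro null_sum null_mult' moderate_const null_prod_diff m nl) (auto intro: p)
  then show ?thesis
    unfolding det_def'[OF c(1)] det_def'[OF c(2)] by (simp add: right_diff_distrib sum_subtractf)
qed

text \<open>The real argument carried out modulo null sequences. The unit vectors are combinations
  of \<open>ws\<close> over the field, so real matrices \<open>C n\<close> and \<open>W n\<close>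
  have a product whose entries differ from the identity by null sequences. Its determinant then
  differs from 1 by a null sequence, which a null bracket would contradict.\<close>

lemma ulim_span_brk_not_null:
  assumes ws: "length ws = d" "distinct ws" "set ws \<subseteq> carrier (coord_space K d)"
    and gen: "module.span K (coord_space K d) (set ws) = carrier (coord_space K d)"
    and us: "\<And>n. length (us n) = d" "\<And>j m. j < d \<Longrightarrow> m < d \<Longrightarrow> moderate \<omega> \<Lambda> (\<lambda>n. us n ! j $ m)"
      "\<And>j m. j < d \<Longrightarrow> m < d \<Longrightarrow> ws ! j $ m = ulim \<omega> \<Lambda> (\<lambda>n. us n ! j $ m)"
  shows "\<not> null (\<lambda>n. brk d (us n))"
proof
  assume z: "null (\<lambda>n. brk d (us n))"
  have img: "set ws = (!) ws ` {..<d}" using ws(1) by (auto simp: set_conv_nth)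
  have inj: "inj_on ((!) ws) {..<d}" using ws(1,2) by (auto intro: inj_on_nth)
  have sub: "(!) ws ` {..<d} \<subseteq> carrier (coord_space K d)" using ws(3) unfolding img .
  have ex: "\<exists>c. i < d \<longrightarrow> (\<forall>j<d. moderate \<omega> \<Lambda> (c j)) \<and>
      (\<forall>m<d. null (\<lambda>n. (\<Sum>j<d. c j n * us n ! j $ m) - unit_seq i m n))" for i
  proof (cases "i < d")
    case i: True
    have mem: "vseq d (unit_seq i) \<in> module.span K (coord_space K d) ((!) ws ` {..<d})"
      using gen vseq_carrier[OF moderate_unit_seq] unfolding img by simp
    obtain c where c: "c \<in> {..<d} \<rightarrow> carrier K"
      "\<And>m. m < d \<Longrightarrow> vseq d (unit_seq i) $ m = (\<Oplus>\<^bsub>K\<^esub>j\<in>{..<d}. c j \<otimes>\<^bsub>K\<^esub> ws ! j $ m)"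
      by (rule span_coordinates[OF field_asymp_field finite_lessThan inj sub mem]) (rule that)
    define x where "x j = asymp_rep (c j)" for j
    have x: "moderate \<omega> \<Lambda> (x j)" "c j = ulim \<omega> \<Lambda> (x j)" if "j < d" for j
      using ulim_asymp_rep[OF funcset_mem[OF c(1)], of j] that by (simp_all add: x_def)
    have "null (\<lambda>n. (\<Sum>j<d. x j n * us n ! j $ m) - unit_seq i m n)" if m: "m < d" for m
    proof -
      have "ulim \<omega> \<Lambda> (unit_seq i m) = (\<Oplus>\<^bsub>K\<^esub>j\<in>{..<d}. c j \<otimes>\<^bsub>K\<^esub> ws ! j $ m)"
        using c(2)[OF m] m by (simp add: vseq_def)
      also have "\<dots> = (\<Oplus>\<^bsub>K\<^esub>j\<in>{..<d}. ulim \<omega> \<Lambda> (\<lambda>n. x j n * us n ! j $ m))"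
      proof -
        interpret K: field K by (rule field_asymp_field)
        show ?thesis
        proof (rule K.finsum_cong'[OF refl])
          show "(\<lambda>j. ulim \<omega> \<Lambda> (\<lambda>n. x j n * us n ! j $ m)) \<in> {..<d} \<rightarrow> carrier K"
            using x us m by (auto intro!: ulim_carrier moderate_mult)
          show "c j \<otimes>\<^bsub>K\<^esub> ws ! j $ m = ulim \<omega> \<Lambda> (\<lambda>n. x j n * us n ! j $ m)" if "j \<in> {..<d}" for j
            using that x us m by (simp add: mult_ulim)
        qed
      qed
      also have "\<dots> = ulim \<omega> \<Lambda> (\<lambda>n. \<Sum>j<d. x j n * us n ! j $ m)"
        by (rule finsum_ulim) (use x us m in \<open>auto intro!: moderate_mult\<close>)
      finally have "ulim \<omega> \<Lambda> (\<lambda>n. \<Sum>j<d. x j n * us n ! j $ m) = ulim \<omega> \<Lambda> (unit_seq i m)" ..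
      moreover have "moderate \<omega> \<Lambda> (\<lambda>n. \<Sum>j<d. x j n * us n ! j $ m)"
        by (rule moderate_sum) (use x us m in \<open>auto intro!: moderate_mult\<close>)
      ultimately show ?thesis
        using moderate_coordsD[OF moderate_unit_seq m] by (simp add: ulim_eq_iff)
    qed
    then show ?thesis using x(1) by blast
  qed simp
  have "\<exists>c. \<forall>i. i < d \<longrightarrow> (\<forall>j<d. moderate \<omega> \<Lambda> (c i j)) \<and>
      (\<forall>m<d. null (\<lambda>n. (\<Sum>j<d. c i j n * us n ! j $ m) - unit_seq i m n))"
    by (rule choice, rule allI, rule ex)
  then obtain c where "\<forall>i. i < d \<longrightarrow> (\<forall>j<d. moderate \<omega> \<Lambda> (c i j)) \<and>
      (\<forall>m<d. null (\<lambda>n. (\<Sum>j<d. c i j n * us n ! j $ m) - unit_seq i m n))" by blast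
  then have c: "\<And>i j. i < d \<Longrightarrow> j < d \<Longrightarrow> moderate \<omega> \<Lambda> (c i j)"
    "\<And>i m. i < d \<Longrightarrow> m < d \<Longrightarrow> null (\<lambda>n. (\<Sum>j<d. c i j n * us n ! j $ m) - unit_seq i m n)" by blast+
  define C where "C n = mat d d (\<lambda>(i, j). c i j n)" for n
  define W where "W n = mat_of_rows d (us n)" for n
  have CW: "C n \<in> carrier_mat d d" "W n \<in> carrier_mat d d" for n
    unfolding C_def W_def using us(1) by (auto intro: carrier_matI)
  have ent: "(C n * W n) $$ (i, m) = (\<Sum>j<d. c i j n * us n ! j $ m)" if "i < d" "m < d" for n i m
    using that us(1) CW[of n] by (auto simp: C_def W_def scalar_prod_def mat_of_rows_index lessThan_atLeast0 intro!: sum.cong)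
  have "null (\<lambda>n. det (C n * W n) - det (1\<^sub>m d :: real mat))"
  proof (rule null_det_diff)
    show "C n * W n \<in> carrier_mat d d" for n using CW[of n] by simp
    show "moderate \<omega> \<Lambda> (\<lambda>n. (C n * W n) $$ (i, j))" if "i < d" "j < d" for i j
      using that us(2) c(1) by (auto simp: ent intro!: moderate_sum moderate_mult)
    show "null (\<lambda>n. (C n * W n) $$ (i, j) - 1\<^sub>m d $$ (i, j))" if "i < d" "j < d" for i j
    proof -
      have "unit_seq i j n = 1\<^sub>m d $$ (i, j)" for n using that by (auto simp: unit_seq_def)
      then show ?thesis using c(2)[OF that] that by (simp add: ent)
    qed
  qed (auto intro: moderate_const)
  moreover have "null (\<lambda>n. det (C n) * det (W n))"
  proof (rule null_mult')
    show "moderate \<omega> \<Lambda> (\<lambda>n. det (C n))"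
      by (rule moderate_det[OF CW(1)]) (use c in \<open>simp add: C_def\<close>)
    show "null (\<lambda>n. det (W n))" using z by (simp add: W_def brk_def)
  qed
  ultimately have "null (\<lambda>n. (det (C n * W n) - 1) + - (det (C n) * det (W n)))"
    using null_add[of "\<lambda>n. det (C n * W n) - 1" "\<lambda>n. - (det (C n) * det (W n))"] by simp
  moreover have "det (C n * W n) = det (C n) * det (W n)" for n by (rule det_mult[OF CW])
  ultimately have "null (\<lambda>n. - 1)" by simp
  then show False using not_null_one by simp
qed

end

lemma distinct_blk: "inj_on v {1..a} \<Longrightarrow> distinct (blk v a)"
  by (simp add: blk_def distinct_map atLeastLessThanSuc_atLeastAtMost del: upt_Suc)

text \<open>The factor is the determinant of the matrix expressing \<open>us\<close> through
  \<open>us'\<close>, hence the same for every complement \<open>ws\<close>.\<close>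

lemma brk_rescale:
  fixes us us' :: "real vec list"
  assumes l: "length us = k" "length us' = k" "distinct us'"
    and c: "set us' \<subseteq> carrier (coord_space class_ring d)"
    and sub: "set us \<subseteq> module.span class_ring (coord_space class_ring d) (set us')"
  obtains r where "\<And>ws. k + length ws = d \<Longrightarrow> brk d (us @ ws) = r * brk d (us' @ ws)"
proof -
  have img: "set us' = (!) us' ` {..<k}" using l by (auto simp: set_conv_nth)
  have inj: "inj_on ((!) us') {..<k}" using l by (auto intro: inj_on_nth)
  have c': "(!) us' ` {..<k} \<subseteq> carrier (coord_space class_ring d)" using c unfolding img .
  have ex: "\<exists>c. i < k \<longrightarrow> (\<forall>m<d. us ! i $ m = (\<Sum>j<k. c j * us' ! j $ m))" for i
  proof (cases "i < k")
    case True
    then have mem: "us ! i \<in> module.span class_ring (coord_space class_ring d) ((!) us' ` {..<k})"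
      using sub l(1) unfolding img by (meson nth_mem subsetD)
    obtain c where "c \<in> {..<k} \<rightarrow> carrier class_ring"
      "\<And>m. m < d \<Longrightarrow> us ! i $ m = (\<Oplus>\<^bsub>class_ring\<^esub>j\<in>{..<k}. c j \<otimes>\<^bsub>class_ring\<^esub> us' ! j $ m)"
      by (rule span_coordinates[OF class_field finite_lessThan inj c' mem]) (rule that)
    then have "\<forall>m<d. us ! i $ m = (\<Sum>j<k. c j * us' ! j $ m)" by (simp only: class_ring_simps) blast
    then show ?thesis by blast
  qed simp
  have "\<exists>c. \<forall>i. i < k \<longrightarrow> (\<forall>m<d. us ! i $ m = (\<Sum>j<k. c i j * us' ! j $ m))"
    by (rule choice, rule allI, rule ex)
  then obtain c where c: "\<forall>i. i < k \<longrightarrow> (\<forall>m<d. us ! i $ m = (\<Sum>j<k. c i j * us' ! j $ m))" by blast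
  show ?thesis
  proof (rule that[of "det (mat k k (\<lambda>(i, j). c i j))"])
    show "brk d (us @ ws) = det (mat k k (\<lambda>(i, j). c i j)) * brk d (us' @ ws)" if "k + length ws = d" for ws
      by (rule brk_change[OF l(1,2) that]) (use c in auto)
  qed
qed

text \<open>The list \<open>blk v a\<close> witnesses that the choice in \<open>flag_wedge\<close>
  is possible; the chosen list is a basis of the restricted module and its properties are carried
  back to the whole space.\<close>

lemma flag_wedge_basis:
  assumes bas: "indexed_basis class_ring (coord_space class_ring d) d v" and a: "a \<le> d"
    and E: "E a = module.span class_ring (coord_space class_ring d) (v ` {1..a})"
  shows "length (flag_wedge d E a) = a" "distinct (flag_wedge d E a)"
    "set (flag_wedge d E a) \<subseteq> carrier (coord_space class_ring d)"
    "module.span class_ring (coord_space class_ring d) (set (flag_wedge d E a)) = E a"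
proof -
  let ?U = "coord_space (class_ring :: real ring) d"
  interpret V: vectorspace class_ring ?U by (rule vectorspace_coord_space[OF class_field])
  have v: "inj_on v {1..d}" "V.basis (v ` {1..d})" using bas by (auto simp: indexed_basis_def)
  have sub: "v ` {1..a} \<subseteq> v ` {1..d}" using a by auto
  have car: "v ` {1..a} \<subseteq> carrier ?U" using v(2) sub by (auto simp: V.basis_def)
  have subm: "submodule class_ring (E a) ?U" unfolding E by (rule V.span_is_submodule[OF car])
  have vsE: "vectorspace class_ring (V.vs (E a))"
    by (rule V.subspace_is_vs) (use subm V.vectorspace_axioms in \<open>simp add: subspace_def\<close>)
  interpret S: vectorspace class_ring "V.vs (E a)" by (rule vsE)
  have own: "v ` {1..a} \<subseteq> E a" unfolding E by (rule V.in_own_span[OF car])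
  have li: "V.lin_indpt (v ` {1..a})"
    using v(2) sub V.subset_li_is_li[of "v ` {1..d}" "v ` {1..a}"] by (simp add: V.basis_def)
  have "S.basis (v ` {1..a})"
    unfolding S.basis_def using own li V.span_li_not_depend[OF own subm] E by auto
  then have "length (blk v a) = a \<and> distinct (blk v a) \<and> S.basis (set (blk v a))"
    using distinct_blk[OF inj_on_subset[OF v(1)], of a] a by (simp add: set_blk)
  then have P: "length (flag_wedge d E a) = a \<and> distinct (flag_wedge d E a) \<and> S.basis (set (flag_wedge d E a))"
    unfolding flag_wedge_def by (rule someI)
  then show "length (flag_wedge d E a) = a" "distinct (flag_wedge d E a)" by auto
  have in_E: "set (flag_wedge d E a) \<subseteq> E a" using P by (simp add: S.basis_def)
  then show "set (flag_wedge d E a) \<subseteq> carrier ?U" using submodule.subset[OF subm] by blast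
  show "V.span (set (flag_wedge d E a)) = E a"
    using P V.span_li_not_depend(1)[OF in_E subm] by (simp add: S.basis_def)
qed

text \<open>\<open>r\<close> is the ratio of the generators of \<open>\<And>\<^sup>a E\<^sup>(\<^sup>a\<^sup>)\<close> given by \<^const>\<open>flag_wedge\<close> and by a basis adapted to
  the flag.\<close>

lemma flag_wedge_rescale:
  assumes bas: "indexed_basis class_ring (coord_space class_ring d) d v" and a: "a \<le> d"
    and E: "E a = module.span class_ring (coord_space class_ring d) (v ` {1..a})"
    and nz: "\<exists>ws. a + length ws = d \<and> brk d (blk v a @ ws) \<noteq> 0"
  obtains r where "r \<noteq> 0" "\<And>ws. a + length ws = d \<Longrightarrow> brk d (flag_wedge d E a @ ws) = r * brk d (blk v a @ ws)"
proof -
  let ?U = "coord_space (class_ring :: real ring) d"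
  interpret V: vectorspace class_ring ?U by (rule vectorspace_coord_space[OF class_field])
  note fw = flag_wedge_basis[where E = E and a = a, OF bas a E]
  have v: "inj_on v {1..d}" "V.basis (v ` {1..d})" using bas by (auto simp: indexed_basis_def)
  have car: "v ` {1..a} \<subseteq> carrier ?U" using v(2) a by (auto simp: V.basis_def)
  have b: "length (blk v a) = a" "distinct (blk v a)" "set (blk v a) \<subseteq> carrier ?U" "V.span (set (blk v a)) = E a"
    using distinct_blk[OF inj_on_subset[OF v(1)], of a] a car E by (simp_all add: set_blk)
  have s: "set (flag_wedge d E a) \<subseteq> V.span (set (blk v a))" "set (blk v a) \<subseteq> V.span (set (flag_wedge d E a))"
    using V.in_own_span[OF fw(3)] V.in_own_span[OF b(3)] unfolding fw(4) b(4) by auto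
  obtain r where r: "\<And>ws. a + length ws = d \<Longrightarrow> brk d (flag_wedge d E a @ ws) = r * brk d (blk v a @ ws)"
    by (rule brk_rescale[OF fw(1) b(1,2,3) s(1)]) (rule that)
  obtain r' where r': "\<And>ws. a + length ws = d \<Longrightarrow> brk d (blk v a @ ws) = r' * brk d (flag_wedge d E a @ ws)"
    by (rule brk_rescale[OF b(1) fw(1,2,3) s(2)]) (rule that)
  obtain ws where ws: "a + length ws = d" "brk d (blk v a @ ws) \<noteq> 0" using nz by blast
  have "r \<noteq> 0"
  proof
    assume "r = 0"
    then have "brk d (flag_wedge d E a @ ws) = 0" using r[OF ws(1)] by simp
    then show False using r'[OF ws(1)] ws(2) by simp
  qed
  then show ?thesis using r by (rule that)
qed

text \<open>Transposition: \<open>wedge3\<close> takes the vectors as columns, \<open>brk\<close> as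
  rows.\<close>

lemma wedge3_brk:
  assumes "length (flag_wedge d E a) + length (flag_wedge d F b) + length (flag_wedge d G c) = d"
  shows "wedge3 d E a F b G c = brk d (flag_wedge d E a @ flag_wedge d F b @ flag_wedge d G c)"
proof -
  let ?us = "flag_wedge d E a @ flag_wedge d F b @ flag_wedge d G c"
  have "mat_of_rows d ?us \<in> carrier_mat d d" using assms by (intro carrier_matI) auto
  from det_transpose[OF this] show ?thesis
    unfolding wedge3_def brk_def transpose_mat_of_rows .
qed

text \<open>Replacing \<open>flag_wedge\<close> by the blocks of the adapted bases introduces
  non-zero factors \<open>r i a\<close>. In each ratio every such factor occurs exactly twice, so
  after clearing denominators only a square \<open>R * R\<close> separates the two forms.\<close>

lemma (in generic_flags) positive_ratio_products:
  assumes t: "oriented_triangulation t T" and pos: "\<forall>X\<in>fg_coordinates d T. 0 < X F"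
    and bas: "\<And>i. i \<in> {1..t} \<Longrightarrow> indexed_basis class_ring (coord_space class_ring d) d (v i)"
    and F: "\<And>i a. i \<in> {1..t} \<Longrightarrow> a \<le> d \<Longrightarrow> F i a = module.span class_ring (coord_space class_ring d) (v i ` {1..a})"
  shows "positive_flags d t v T"
proof -
  have in_t: "i \<in> {1..t} \<and> k \<in> {1..t} \<and> i \<noteq> k" if "is_edge T i k" for i k
    using t that unfolding oriented_triangulation_def is_edge_def by blast
  have ex: "\<exists>r. i \<in> {1..t} \<and> 2 \<le> t \<and> a \<le> d \<longrightarrow> r \<noteq> 0 \<and>
    (\<forall>ws. a + length ws = d \<longrightarrow> brk d (flag_wedge d (F i) a @ ws) = r * brk d (blk (v i) a @ ws))" for i a
  proof (cases "i \<in> {1..t} \<and> 2 \<le> t \<and> a \<le> d")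
    case True
    \<comment> \<open>A second flag completes the first \<open>a\<close> basis vectors to a non-zero
      bracket, which keeps the rescaling factor from vanishing.\<close>
    then obtain j where j: "j \<in> {1..t}" "i \<noteq> j"
      by (metis One_nat_def Suc_1 atLeastAtMost_iff le_refl n_not_Suc_n not_less_eq_eq order_trans)
    have "brk d (blk (v i) a @ blk (v j) (d - a)) \<noteq> 0" by (rule br2_nz) (use True j in auto)
    then have nz: "\<exists>ws. a + length ws = d \<and> brk d (blk (v i) a @ ws) \<noteq> 0"
      using True by (intro exI[of _ "blk (v j) (d - a)"]) auto
    obtain r where "r \<noteq> 0" "\<And>ws. a + length ws = d \<Longrightarrow> brk d (flag_wedge d (F i) a @ ws) = r * brk d (blk (v i) a @ ws)"
      by (rule flag_wedge_rescale[where v = "v i" and a = a and E = "F i" and d = d]) (use bas F nz True in auto)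
    then show ?thesis by blast
  qed auto
  have "\<exists>r. \<forall>x. fst x \<in> {1..t} \<and> 2 \<le> t \<and> snd x \<le> d \<longrightarrow> r x \<noteq> 0 \<and>
    (\<forall>ws. snd x + length ws = d \<longrightarrow> brk d (flag_wedge d (F (fst x)) (snd x) @ ws) = r x * brk d (blk (v (fst x)) (snd x) @ ws))"
    by (rule choice, rule allI, rule ex)
  then obtain r0 where r0: "\<forall>x. fst x \<in> {1..t} \<and> 2 \<le> t \<and> snd x \<le> d \<longrightarrow> r0 x \<noteq> (0::real) \<and>
    (\<forall>ws. snd x + length ws = d \<longrightarrow> brk d (flag_wedge d (F (fst x)) (snd x) @ ws) = r0 x * brk d (blk (v (fst x)) (snd x) @ ws))"
    by blast
  define r where "r i a = r0 (i, a)" for i a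
  have r: "r i a \<noteq> 0" "\<And>ws. a + length ws = d \<Longrightarrow> brk d (flag_wedge d (F i) a @ ws) = r i a * brk d (blk (v i) a @ ws)"
    if "i \<in> {1..t}" "2 \<le> t" "a \<le> d" for i a
    using r0[rule_format, of "(i, a)"] that by (auto simp: r_def)
  have len: "length (flag_wedge d (F i) a) = a" if "i \<in> {1..t}" "a \<le> d" for i a
    by (rule flag_wedge_basis(1)[where E = "F i" and a = a, OF bas[OF that(1)] that(2) F[OF that]])
  have W: "wedge3 d (F i) a (F j) b (F k) c = r i a * r j b * r k c * br3 i j k a b c"
    if ijk: "i \<in> {1..t}" "j \<in> {1..t}" "k \<in> {1..t}" "2 \<le> t" and abc: "a + b + c = d" for i j k a b c
  proof -
    have le: "a \<le> d" "b \<le> d" "c \<le> d" using abc by auto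
    let ?f = "\<lambda>i a. flag_wedge d (F i) a"
    note L = len[OF ijk(1) le(1)] len[OF ijk(2) le(2)] len[OF ijk(3) le(3)]
    have sq: "((-1::real) ^ n) * ((-1) ^ n) = 1" for n :: nat
      by (simp flip: power_add mult_2)
    \<comment> \<open>The factor \<open>r\<close> rescales only a leading block, so the second and
      third blocks are brought to the front and back; the sign of each such move occurs
      twice.\<close>
    have "wedge3 d (F i) a (F j) b (F k) c = brk d (?f i a @ ?f j b @ ?f k c)"
      by (rule wedge3_brk) (use L abc in simp)
    also have "\<dots> = r i a * brk d (blk (v i) a @ ?f j b @ ?f k c)"
      by (rule r(2)[OF ijk(1,4) le(1)]) (use L abc in simp)
    also have "brk d (blk (v i) a @ ?f j b @ ?f k c) = (-1) ^ (a * b) * brk d (?f j b @ blk (v i) a @ ?f k c)"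
      using brk_block_swap[of "blk (v i) a" "?f j b" "?f k c" d] L abc by simp
    also have "brk d (?f j b @ blk (v i) a @ ?f k c) = r j b * brk d (blk (v j) b @ blk (v i) a @ ?f k c)"
      by (rule r(2)[OF ijk(2,4) le(2)]) (use L abc in simp)
    also have "brk d (blk (v j) b @ blk (v i) a @ ?f k c) = (-1) ^ (a * b) * brk d (blk (v i) a @ blk (v j) b @ ?f k c)"
      using brk_block_swap[of "blk (v j) b" "blk (v i) a" "?f k c" d] L abc by (simp add: mult.commute)
    also have "brk d (blk (v i) a @ blk (v j) b @ ?f k c) = (-1) ^ ((a + b) * c) * brk d (?f k c @ blk (v i) a @ blk (v j) b)"
      using brk_block_swap[of "blk (v i) a @ blk (v j) b" "?f k c" "[]" d] L abc by simp
    also have "brk d (?f k c @ blk (v i) a @ blk (v j) b) = r k c * brk d (blk (v k) c @ blk (v i) a @ blk (v j) b)"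
      by (rule r(2)[OF ijk(3,4) le(3)]) (use L abc in simp)
    also have "brk d (blk (v k) c @ blk (v i) a @ blk (v j) b) = (-1) ^ ((a + b) * c) * br3 i j k a b c"
      using brk_block_swap[of "blk (v k) c" "blk (v i) a @ blk (v j) b" "[]" d] L abc by (simp add: mult.commute)
    finally have "wedge3 d (F i) a (F j) b (F k) c = ((-1) ^ (a * b) * (-1) ^ (a * b)) *
        ((-1) ^ ((a + b) * c) * (-1) ^ ((a + b) * c)) * (r i a * r j b * r k c * br3 i j k a b c)"
      by (simp only: mult_ac)
    then show ?thesis unfolding sq by simp
  qed
  have sqpos: "0 < x * x" if "x \<noteq> 0" for x :: real using that by (metis not_real_square_gt_zero)
  \<comment> \<open>A positive ratio has non-zero denominators, and multiplication by their squares
    replaces division by multiplication without changing the sign.\<close>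
  have ratio3: "0 < x1 * x2 * x3 * x4 * x5 * x6" if A: "0 < x1 / x2 * (x3 / x4) * (x5 / x6)" for x1 x2 x3 x4 x5 x6 :: real
  proof -
    have nz: "x2 \<noteq> 0" "x4 \<noteq> 0" "x6 \<noteq> 0"
      using A by (metis div_by_0 mult_zero_left mult_zero_right less_irrefl)+
    then have "0 < x1 / x2 * (x3 / x4) * (x5 / x6) * ((x2 * x4 * x6) * (x2 * x4 * x6))"
      by (intro mult_pos_pos[OF A] sqpos) simp
    also have "\<dots> = x1 * x2 * x3 * x4 * x5 * x6" using nz by (simp add: field_simps)
    finally show ?thesis .
  qed
  have ratio2: "x1 * x2 * x3 * x4 < 0" if A: "0 < - (x1 / x2) * (x3 / x4)" for x1 x2 x3 x4 :: real
  proof -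
    have nz: "x2 \<noteq> 0" "x4 \<noteq> 0"
      using A by (metis div_by_0 minus_zero mult_zero_left mult_zero_right less_irrefl)+
    then have "0 < - (x1 / x2) * (x3 / x4) * ((x2 * x4) * (x2 * x4))"
      by (intro mult_pos_pos[OF A] sqpos) simp
    also have "\<dots> = - (x1 * x2 * x3 * x4)" using nz by (simp add: field_simps)
    finally show ?thesis by simp
  qed
  show ?thesis
  proof (intro positive_flags.intro generic_flags_axioms positive_flags_axioms.intro t)
    fix i j k a b c assume ijk: "i < j" "j < k" "is_triangle T i j k" and abc: "a + b + c + 3 = d"
    have it: "i \<in> {1..t}" "j \<in> {1..t}" "k \<in> {1..t}" "2 \<le> t"
      using ijk in_t[of i j] in_t[of j k] unfolding is_triangle_def by auto
    have "(\<lambda>F. triple_ratio d (a+1) (b+1) (c+1) (F i) (F j) (F k)) \<in> fg_coordinates d T"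
      unfolding fg_coordinates_def
      by (rule UnI1, rule CollectI, rule exI[of _ "a+1"], rule exI[of _ "b+1"], rule exI[of _ "c+1"],
          rule exI[of _ i], rule exI[of _ j], rule exI[of _ k]) (intro conjI refl ijk, use abc in simp_all)
    from bspec[OF pos this] have tr: "0 < triple_ratio d (a+1) (b+1) (c+1) (F i) (F j) (F k)" .
    have "triple_ratio d (a+1) (b+1) (c+1) (F i) (F j) (F k) =
       wedge3 d (F i) a (F j) (b+1) (F k) (c+2) / wedge3 d (F i) (a+2) (F j) (b+1) (F k) c *
       (wedge3 d (F i) (a+1) (F j) (b+2) (F k) c / wedge3 d (F i) (a+1) (F j) b (F k) (c+2)) *
       (wedge3 d (F i) (a+2) (F j) b (F k) (c+1) / wedge3 d (F i) a (F j) (b+2) (F k) (c+1))"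
      unfolding triple_ratio_def add_diff_cancel_right' add.assoc one_add_one ..
    from ratio3[OF tr[unfolded this]]
    have P: "0 < wedge3 d (F i) a (F j) (b+1) (F k) (c+2) * wedge3 d (F i) (a+2) (F j) (b+1) (F k) c *
       wedge3 d (F i) (a+1) (F j) (b+2) (F k) c * wedge3 d (F i) (a+1) (F j) b (F k) (c+2) *
       wedge3 d (F i) (a+2) (F j) b (F k) (c+1) * wedge3 d (F i) a (F j) (b+2) (F k) (c+1)" .
    define R where "R = r i a * r j (b+1) * r k (c+2) * r i (a+2) * r k c * r i (a+1) * r j (b+2) * r j b * r k (c+1)"
    let ?X = "br3 i j k a (b+1) (c+2) * br3 i j k (a+2) (b+1) c * br3 i j k (a+1) (b+2) c *
      br3 i j k (a+1) b (c+2) * br3 i j k (a+2) b (c+1) * br3 i j k a (b+2) (c+1)"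
    have eqs: "wedge3 d (F i) a (F j) (b+1) (F k) (c+2) = r i a * r j (b+1) * r k (c+2) * br3 i j k a (b+1) (c+2)"
      "wedge3 d (F i) (a+2) (F j) (b+1) (F k) c = r i (a+2) * r j (b+1) * r k c * br3 i j k (a+2) (b+1) c"
      "wedge3 d (F i) (a+1) (F j) (b+2) (F k) c = r i (a+1) * r j (b+2) * r k c * br3 i j k (a+1) (b+2) c"
      "wedge3 d (F i) (a+1) (F j) b (F k) (c+2) = r i (a+1) * r j b * r k (c+2) * br3 i j k (a+1) b (c+2)"
      "wedge3 d (F i) (a+2) (F j) b (F k) (c+1) = r i (a+2) * r j b * r k (c+1) * br3 i j k (a+2) b (c+1)"
      "wedge3 d (F i) a (F j) (b+2) (F k) (c+1) = r i a * r j (b+2) * r k (c+1) * br3 i j k a (b+2) (c+1)"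
      by (rule W[OF it], use abc in simp)+
    have "R \<noteq> 0" unfolding R_def using it abc by (simp add: r(1))
    have "0 < (R * R) * ?X" using P unfolding eqs R_def by (simp only: mult_ac)
    then show "0 < ?X" by (rule zero_less_mult_pos) (rule sqpos[OF \<open>R \<noteq> 0\<close>])
  next
    fix i j k l assume ijkl: "(i, k) \<in> T" "cyclically_ordered i j k l" "is_triangle T i j k" "is_triangle T i k l"
    have it: "i \<in> {1..t}" "j \<in> {1..t}" "k \<in> {1..t}" "l \<in> {1..t}" "i \<noteq> k"
      using ijkl in_t[of i j] in_t[of j k] in_t[of i l] in_t[of i k] unfolding is_triangle_def by auto
    then have t2: "2 \<le> t" by auto
    show "separated i k j l"
      unfolding separated_def
    proof (intro allI impI)
      fix a b assume ab: "a + b + 2 = d"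
      have "(\<lambda>F. double_ratio d (Suc a) (F i) (F j) (F k) (F l)) \<in> fg_coordinates d T"
        unfolding fg_coordinates_def
        by (rule UnI2, rule CollectI, rule exI[of _ "Suc a"],
            rule exI[of _ i], rule exI[of _ j], rule exI[of _ k], rule exI[of _ l])
          (intro conjI refl ijkl, use ab in simp_all)
      from bspec[OF pos this] have dr: "0 < double_ratio d (Suc a) (F i) (F j) (F k) (F l)" .
      have sb: "d - Suc a - 1 = b" "d - Suc a = Suc b" "Suc a - 1 = a" using ab by auto
      have "double_ratio d (Suc a) (F i) (F j) (F k) (F l) =
          - (wedge3 d (F i) (Suc a) (F k) b (F j) 1 / wedge3 d (F i) (Suc a) (F k) b (F l) 1) *
          (wedge3 d (F i) a (F k) (Suc b) (F l) 1 / wedge3 d (F i) a (F k) (Suc b) (F j) 1)"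
        unfolding double_ratio_def sb(2,3) diff_Suc_1 ..
      from ratio2[OF dr[unfolded this]]
      have P: "wedge3 d (F i) (Suc a) (F k) b (F j) 1 * wedge3 d (F i) (Suc a) (F k) b (F l) 1 *
          wedge3 d (F i) a (F k) (Suc b) (F l) 1 * wedge3 d (F i) a (F k) (Suc b) (F j) 1 < 0" .
      define R where "R = r i a * r i (Suc a) * r k b * r k (Suc b) * r j 1 * r l 1"
      let ?X = "br3 i k j (Suc a) b 1 * br3 i k j a (Suc b) 1 * (br3 i k l (Suc a) b 1 * br3 i k l a (Suc b) 1)"
      have eqs: "wedge3 d (F i) (Suc a) (F k) b (F j) 1 = r i (Suc a) * r k b * r j 1 * br3 i k j (Suc a) b 1"
        "wedge3 d (F i) a (F k) (Suc b) (F j) 1 = r i a * r k (Suc b) * r j 1 * br3 i k j a (Suc b) 1"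
        by (rule W[OF it(1,3,2) t2], use ab in simp)+
      have eqs': "wedge3 d (F i) (Suc a) (F k) b (F l) 1 = r i (Suc a) * r k b * r l 1 * br3 i k l (Suc a) b 1"
        "wedge3 d (F i) a (F k) (Suc b) (F l) 1 = r i a * r k (Suc b) * r l 1 * br3 i k l a (Suc b) 1"
        by (rule W[OF it(1,3,4) t2], use ab in simp)+
      have "R \<noteq> 0" unfolding R_def using it t2 ab by (simp add: r(1))
      have "?X * (R * R) < 0" using P unfolding eqs eqs' R_def by (simp only: mult_ac)
      moreover have "x < 0" if "x * y < 0" "0 < y" for x y :: real
        using that by (simp add: mult_less_0_iff)
      ultimately show "?X < 0" using sqpos[OF \<open>R \<noteq> 0\<close>] by blast
    qed
  qed
qed

section \<open>The bases of the apartments\<close>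

lemma (in module) span_singleton:
  assumes "e \<in> carrier M" shows "span {e} = {a \<odot>\<^bsub>M\<^esub> e |a. a \<in> carrier R}"
proof -
  have "span {e} = {\<Oplus>\<^bsub>M\<^esub>i\<in>{e}. a i \<odot>\<^bsub>M\<^esub> i |a. a \<in> {e} \<rightarrow> carrier R}"
    using span_image[of "{e}" "\<lambda>x. x"] assms by auto
  also have "\<dots> = {a \<odot>\<^bsub>M\<^esub> e |a. a \<in> carrier R}"
  proof (intro equalityI subsetI)
    fix w assume "w \<in> {\<Oplus>\<^bsub>M\<^esub>i\<in>{e}. a i \<odot>\<^bsub>M\<^esub> i |a. a \<in> {e} \<rightarrow> carrier R}"
    then show "w \<in> {a \<odot>\<^bsub>M\<^esub> e |a. a \<in> carrier R}" using assms by auto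
  next
    fix w assume "w \<in> {a \<odot>\<^bsub>M\<^esub> e |a. a \<in> carrier R}"
    then obtain a where a: "a \<in> carrier R" "w = a \<odot>\<^bsub>M\<^esub> e" by blast
    have "w = (\<Oplus>\<^bsub>M\<^esub>i\<in>{e}. (\<lambda>_. a) i \<odot>\<^bsub>M\<^esub> i)" using a assms by simp
    then show "w \<in> {\<Oplus>\<^bsub>M\<^esub>i\<in>{e}. a i \<odot>\<^bsub>M\<^esub> i |a. a \<in> {e} \<rightarrow> carrier R}" unfolding a(2) mem_Collect_eq by (intro exI[of _ "\<lambda>_. a"]) (use a assms in simp)
  qed
  finally show ?thesis .
qed

lemma blk_nth: "k < a \<Longrightarrow> blk v a ! k = v (Suc k)"
  by (simp add: blk_def del: upt_Suc)

context asymp_scale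
begin

lemma not_null_mult:
  assumes "moderate \<omega> \<Lambda> x" "moderate \<omega> \<Lambda> y" "\<not> null x" "\<not> null y"
  shows "\<not> null (\<lambda>n. x n * y n)"
proof
  assume z: "null (\<lambda>n. x n * y n)"
  obtain l k where lk: "(N x \<longlongrightarrow> l) \<omega>" "(N y \<longlongrightarrow> k) \<omega>" using assms(1,2) by (auto simp: moderate_def)
  then have "((\<lambda>n. N x n * N y n) \<longlongrightarrow> l * k) \<omega>" by (rule tendsto_mult)
  moreover have "((\<lambda>n. N x n * N y n) \<longlongrightarrow> 0) \<omega>" using z by (simp add: N_mult)
  ultimately have "l * k = 0" using tendsto_unique[OF omega_nontrivial] by blast
  then show False using lk assms(3,4) by auto
qed

lemma not_null_prod:
  assumes "\<And>i. i \<in> A \<Longrightarrow> moderate \<omega> \<Lambda> (f i)" "\<And>i. i \<in> A \<Longrightarrow> \<not> null (f i)"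
  shows "\<not> null (\<lambda>n. \<Prod>i\<in>A. f i n)"
  using assms
proof (induction A rule: infinite_finite_induct)
  case (insert x A)
  have "\<not> null (\<lambda>n. f x n * (\<Prod>i\<in>A. f i n))"
    by (rule not_null_mult) (use insert in \<open>auto intro!: moderate_prod\<close>)
  then show ?case using insert by simp
qed (use not_null_one in auto)

lemma moderate_adj_mat:
  assumes A: "\<And>n. A n \<in> carrier_mat d d" "\<And>i j. i < d \<Longrightarrow> j < d \<Longrightarrow> moderate \<omega> \<Lambda> (\<lambda>n. A n $$ (i, j))"
    and ij: "i < d" "j < d"
  shows "moderate \<omega> \<Lambda> (\<lambda>n. adj_mat (A n) $$ (i, j))"
proof -
  have "moderate \<omega> \<Lambda> (\<lambda>n. det (mat_delete (A n) j i))"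
  proof (rule moderate_det)
    show "mat_delete (A n) j i \<in> carrier_mat (d - 1) (d - 1)" for n
      by (rule mat_delete_carrier[OF A(1)])
    show "moderate \<omega> \<Lambda> (\<lambda>n. mat_delete (A n) j i $$ (i', j'))" if "i' < d - 1" "j' < d - 1" for i' j'
    proof -
      have "mat_delete (A n) j i $$ (i', j') = A n $$ (if i' < j then i' else Suc i', if j' < i then j' else Suc j')" for n
        using A(1)[of n] that by (simp add: mat_delete_def)
      then show ?thesis using that by (simp add: A(2))
    qed
  qed
  moreover have "adj_mat (A n) $$ (i, j) = (-1) ^ (j + i) * det (mat_delete (A n) j i)" for n
    using A(1)[of n] ij by (simp add: adj_mat_def cofactor_def)
  ultimately show ?thesis by (simp add: moderate_mult moderate_const)
qed

text \<open>Cramer's rule with the division left out: the bracket times \<open>c p\<close> is a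
  combination of the pairings with moderate coefficients, the entries of the adjugate. The product
  is null while the bracket is not, so \<open>c p\<close> must be.\<close>

lemma null_of_pairings:
  assumes us: "\<And>n. length (us n) = d" "\<And>k p. k < d \<Longrightarrow> p < d \<Longrightarrow> moderate \<omega> \<Lambda> (\<lambda>n. us n ! k $ p)"
    and nn: "\<not> null (\<lambda>n. brk d (us n))" and c: "moderate_coords d c"
    and z: "\<And>k. k < d \<Longrightarrow> null (\<lambda>n. \<Sum>q<d. c q n * us n ! k $ q)" and p: "p < d"
  shows "null (c p)"
proof (rule ccontr)
  assume "\<not> null (c p)"
  define W where "W n = mat_of_rows d (us n)" for n
  have W: "W n \<in> carrier_mat d d" for n unfolding W_def using us(1) by (auto intro: carrier_matI)
  have ent: "W n $$ (k, q) = us n ! k $ q" if "k < d" "q < d" for n k q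
    using that us(1) by (simp add: W_def mat_of_rows_index)
  have adj: "adj_mat (W n) \<in> carrier_mat d d" "adj_mat (W n) * W n = det (W n) \<cdot>\<^sub>m 1\<^sub>m d" for n
    using adj_mat[OF W] by auto
  have "brk d (us n) * c p n = (\<Sum>k<d. adj_mat (W n) $$ (p, k) * (\<Sum>q<d. c q n * us n ! k $ q))" for n
  proof -
    have "(\<Sum>k<d. adj_mat (W n) $$ (p, k) * (\<Sum>q<d. c q n * us n ! k $ q)) =
      (\<Sum>k<d. \<Sum>q<d. c q n * (adj_mat (W n) $$ (p, k) * W n $$ (k, q)))"
      unfolding sum_distrib_left by (intro sum.cong refl) (simp add: ent)
    also have "\<dots> = (\<Sum>q<d. c q n * (adj_mat (W n) * W n) $$ (p, q))"
      by (subst sum.swap) (use p W[of n] adj(1)[of n] in \<open>auto simp: scalar_prod_def sum_distrib_left lessThan_atLeast0 intro!: sum.cong\<close>)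
    also have "\<dots> = (\<Sum>q<d. if q = p then c q n * det (W n) else 0)"
      unfolding adj(2) by (intro sum.cong) (use p in auto)
    also have "\<dots> = brk d (us n) * c p n" using p by (simp add: W_def brk_def)
    finally show ?thesis ..
  qed
  moreover have "null (\<lambda>n. \<Sum>k<d. adj_mat (W n) $$ (p, k) * (\<Sum>q<d. c q n * us n ! k $ q))"
  proof (intro null_sum)
    fix k assume k: "k \<in> {..<d}"
    have mm: "moderate \<omega> \<Lambda> (\<lambda>n. adj_mat (W n) $$ (p, k))"
      by (rule moderate_adj_mat[OF W]) (use p k us(2) in \<open>auto simp: ent\<close>)
    show "null (\<lambda>n. adj_mat (W n) $$ (p, k) * (\<Sum>q<d. c q n * us n ! k $ q))"
      by (rule null_mult'[OF mm z]) (use k in simp)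
  qed
  ultimately have "null (\<lambda>n. brk d (us n) * c p n)" by simp
  moreover have "\<not> null (\<lambda>n. brk d (us n) * c p n)"
    by (rule not_null_mult[OF moderate_brk[OF us] moderate_coordsD[OF c p] nn \<open>\<not> null (c p)\<close>])
  ultimately show False by simp
qed

text \<open>The inverse is the adjugate divided by the determinant. Non-vanishing at each time makes
  the identities exact, and non-nullity keeps the entries moderate. Matrix rows start at 0 and
  functionals at 1, hence the index \<open>l - 1\<close>.\<close>

lemma basis_family_matrix:
  assumes P: "\<And>n. P n \<in> carrier_mat d d" "\<And>k p n. k < d \<Longrightarrow> p < d \<Longrightarrow> P n $$ (k, p) = \<epsilon> (Suc k) p n"
    and m: "\<And>l. l \<in> {1..d} \<Longrightarrow> moderate_coords d (\<epsilon> l)"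
    and det: "\<And>n. det (P n) \<noteq> 0" "\<not> null (\<lambda>n. det (P n))"
  shows "basis_family d \<epsilon>"
proof -
  define Q where "Q p l n = adj_mat (P n) $$ (p, l - 1) / det (P n)" for p l n
  have mP: "moderate \<omega> \<Lambda> (\<lambda>n. P n $$ (k, p))" if "k < d" "p < d" for k p
    using m[of "Suc k"] that by (simp add: P moderate_coords_def)
  have reidx: "(\<Sum>l\<in>{1..d}. f l) = (\<Sum>k<d. f (Suc k))" for f :: "nat \<Rightarrow> real"
    by (simp add: sum.atLeast1_atMost_eq)
  have adj: "adj_mat (P n) \<in> carrier_mat d d" "P n * adj_mat (P n) = det (P n) \<cdot>\<^sub>m 1\<^sub>m d"
    "adj_mat (P n) * P n = det (P n) \<cdot>\<^sub>m 1\<^sub>m d" for n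
    using adj_mat[OF P(1)] by auto
  show ?thesis unfolding basis_family_def
  proof (intro conjI exI[of _ Q] ballI allI impI m)
    fix p l assume pl: "p < d" "l \<in> {1..d}"
    have "moderate \<omega> \<Lambda> (\<lambda>n. adj_mat (P n) $$ (p, l - 1))"
      by (rule moderate_adj_mat[OF P(1) mP]) (use pl in auto)
    then show "moderate \<omega> \<Lambda> (Q p l)"
      unfolding Q_def using det(2) moderate_det[OF P(1) mP] by (intro moderate_divide)
  next
    fix n p p' assume p: "p < d" "p' < d"
    have "(\<Sum>l\<in>{1..d}. Q p l n * \<epsilon> l p' n) = (\<Sum>k<d. adj_mat (P n) $$ (p, k) * P n $$ (k, p')) / det (P n)"
      unfolding reidx Q_def sum_divide_distrib by (intro sum.cong refl) (simp add: P p)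
    also have "(\<Sum>k<d. adj_mat (P n) $$ (p, k) * P n $$ (k, p')) = (adj_mat (P n) * P n) $$ (p, p')"
      using p P(1)[of n] adj(1)[of n] by (auto simp: scalar_prod_def lessThan_atLeast0 intro!: sum.cong)
    also have "\<dots> / det (P n) = (if p = p' then 1 else 0)" unfolding adj(3) using p det(1) by auto
    finally show "(\<Sum>l\<in>{1..d}. Q p l n * \<epsilon> l p' n) = (if p = p' then 1 else 0)" .
  next
    fix n l l' assume l: "l \<in> {1..d}" "l' \<in> {1..d}"
    then have k: "l - 1 < d" "l' - 1 < d" "Suc (l - 1) = l" "l - 1 = l' - 1 \<longleftrightarrow> l = l'" by auto
    have "(\<Sum>p<d. \<epsilon> l p n * Q p l' n) = (\<Sum>p<d. P n $$ (l - 1, p) * adj_mat (P n) $$ (p, l' - 1)) / det (P n)"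
      unfolding Q_def sum_divide_distrib
    proof (intro sum.cong refl)
      fix p assume "p \<in> {..<d}"
      then have "P n $$ (l - 1, p) = \<epsilon> l p n" using P(2)[OF k(1), of p n] k(3) by simp
      then show "\<epsilon> l p n * (adj_mat (P n) $$ (p, l' - 1) / det (P n)) = P n $$ (l - 1, p) * adj_mat (P n) $$ (p, l' - 1) / det (P n)"
        by simp
    qed
    also have "(\<Sum>p<d. P n $$ (l - 1, p) * adj_mat (P n) $$ (p, l' - 1)) = (P n * adj_mat (P n)) $$ (l - 1, l' - 1)"
      using k P(1)[of n] adj(1)[of n] by (auto simp: scalar_prod_def lessThan_atLeast0 intro!: sum.cong)
    also have "\<dots> / det (P n) = (if l = l' then 1 else 0)" unfolding adj(2) using k det(1) by simp
    finally show "(\<Sum>p<d. \<epsilon> l p n * Q p l' n) = (if l = l' then 1 else 0)" .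
  qed
qed

definition list_limit :: "nat \<Rightarrow> nat \<Rightarrow> asymp vec list \<Rightarrow> (nat \<Rightarrow> real vec list) \<Rightarrow> bool" where
  "list_limit d k ws us \<longleftrightarrow> length ws = k \<and> (\<forall>n. length (us n) = k) \<and>
     (\<forall>i<k. \<forall>m<d. moderate \<omega> \<Lambda> (\<lambda>n. us n ! i $ m) \<and> ws ! i $ m = ulim \<omega> \<Lambda> (\<lambda>n. us n ! i $ m))"

lemma list_limit_append:
  "list_limit d k ws us \<Longrightarrow> list_limit d k' ws' us' \<Longrightarrow> list_limit d (k + k') (ws @ ws') (\<lambda>n. us n @ us' n)"
  by (auto simp: list_limit_def nth_append)

lemma list_limit_concat:
  "length as = length ix \<Longrightarrow> (\<And>i a. i \<in> set ix \<Longrightarrow> a \<in> set as \<Longrightarrow> list_limit d a (f i a) (\<lambda>n. g n i a)) \<Longrightarrow>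
    list_limit d (sum_list as) (concat (map2 f ix as)) (\<lambda>n. concat (map2 (g n) ix as))"
proof (induction as ix rule: list_induct2)
  case Nil
  then show ?case by (simp add: list_limit_def)
next
  case (Cons a as i ix)
  then show ?case by (auto intro!: list_limit_append)
qed

end

section \<open>Adapted bases with their ultralimits\<close>

locale ulim_flags = asymp_scale +
  fixes d t :: nat and V :: "nat \<Rightarrow> nat \<Rightarrow> nat \<Rightarrow> real vec" and F :: "nat \<Rightarrow> asymp flag"
    and vK :: "nat \<Rightarrow> nat \<Rightarrow> asymp vec"
  assumes gf: "\<And>n. generic_flags d t (V n)"
    and lim: "\<And>i s m. i \<in> {1..t} \<Longrightarrow> s \<in> {1..d} \<Longrightarrow> m < d \<Longrightarrow>
      moderate \<omega> \<Lambda> (\<lambda>n. V n i s $ m) \<and> vK i s $ m = ulim \<omega> \<Lambda> (\<lambda>n. V n i s $ m)"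
    and vK_basis: "\<And>i. i \<in> {1..t} \<Longrightarrow> indexed_basis K (coord_space K d) d (vK i)"
    and flagK: "\<And>i a. i \<in> {1..t} \<Longrightarrow> a \<le> d \<Longrightarrow> F i a = module.span K (coord_space K d) (vK i ` {1..a})"
    and spanK: "maximum_span K d t F"
begin

lemma d1: "1 \<le> d" using generic_flags.d1[OF gf] .

lemma vK_carrier: "i \<in> {1..t} \<Longrightarrow> s \<in> {1..d} \<Longrightarrow> vK i s \<in> carrier (coord_space K d)"
proof -
  interpret U: vectorspace K "coord_space K d" by (rule vectorspace_coord_space[OF field_asymp_field])
  assume "i \<in> {1..t}" "s \<in> {1..d}"
  then show ?thesis using vK_basis[of i] by (auto simp: indexed_basis_def U.basis_def)
qed

lemma V_coords: "i \<in> {1..t} \<Longrightarrow> s \<in> {1..d} \<Longrightarrow> moderate_coords d (\<lambda>m n. V n i s $ m)"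
  using lim by (simp add: moderate_coords_def)

lemma vK_vseq: "i \<in> {1..t} \<Longrightarrow> s \<in> {1..d} \<Longrightarrow> vK i s = vseq d (\<lambda>m n. V n i s $ m)"
  using vK_carrier[of i s] lim[of i s] by (intro eq_vecI) (auto simp: vseq_def coord_space_def)

lemma list_limit_blk: "i \<in> {1..t} \<Longrightarrow> a \<le> d \<Longrightarrow> list_limit d a (blk (vK i) a) (\<lambda>n. blk (V n i) a)"
  using lim by (auto simp: list_limit_def blk_nth)

text \<open>Moderateness comes from convergent entries, non-nullity from maximum span of the limit
  flags, and non-vanishing from genericity at each time.\<close>

lemma bracket_limit:
  assumes ix: "distinct ix" "set ix \<subseteq> {1..t}" "length as = length ix" "sum_list as = d"
  shows "moderate \<omega> \<Lambda> (\<lambda>n. brk d (concat (map2 (\<lambda>i a. blk (V n i) a) ix as)))"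
    "\<not> null (\<lambda>n. brk d (concat (map2 (\<lambda>i a. blk (V n i) a) ix as)))"
    "brk d (concat (map2 (\<lambda>i a. blk (V n i) a) ix as)) \<noteq> 0"
proof -
  have "list_limit d (sum_list as) (concat (map2 (\<lambda>i a. blk (vK i) a) ix as)) (\<lambda>n. concat (map2 (\<lambda>i a. blk (V n i) a) ix as))"
  proof (rule list_limit_concat[OF ix(3)])
    fix i a assume "i \<in> set ix" "a \<in> set as"
    then have "i \<in> {1..t}" "a \<le> d" using ix member_le_sum_list[of a as] by auto
    then show "list_limit d a (blk (vK i) a) (\<lambda>n. blk (V n i) a)" by (rule list_limit_blk)
  qed
  then have L: "\<And>n. length (concat (map2 (\<lambda>i a. blk (V n i) a) ix as)) = d"
    "\<And>j m. j < d \<Longrightarrow> m < d \<Longrightarrow> moderate \<omega> \<Lambda> (\<lambda>n. concat (map2 (\<lambda>i a. blk (V n i) a) ix as) ! j $ m)"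
    "\<And>j m. j < d \<Longrightarrow> m < d \<Longrightarrow> concat (map2 (\<lambda>i a. blk (vK i) a) ix as) ! j $ m =
      ulim \<omega> \<Lambda> (\<lambda>n. concat (map2 (\<lambda>i a. blk (V n i) a) ix as) ! j $ m)"
    unfolding list_limit_def ix(4) by blast+
  show "moderate \<omega> \<Lambda> (\<lambda>n. brk d (concat (map2 (\<lambda>i a. blk (V n i) a) ix as)))"
    by (rule moderate_brk[OF L(1,2)])
  show "\<not> null (\<lambda>n. brk d (concat (map2 (\<lambda>i a. blk (V n i) a) ix as)))"
    by (rule ulim_span_brk_not_null[OF maximum_span_generates[OF field_asymp_field d1 spanK vK_basis flagK ix] L])
  show "brk d (concat (map2 (\<lambda>i a. blk (V n i) a) ix as)) \<noteq> 0"
    by (rule generic_flags.generic[OF gf ix])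
qed

lemma bracket2:
  assumes "{i, j} \<subseteq> {1..t}" "i \<noteq> j" "a + b = d"
  shows "moderate \<omega> \<Lambda> (\<lambda>n. brk d (blk (V n i) a @ blk (V n j) b))"
    "\<not> null (\<lambda>n. brk d (blk (V n i) a @ blk (V n j) b))" "brk d (blk (V n i) a @ blk (V n j) b) \<noteq> 0"
  using bracket_limit[of "[i, j]" "[a, b]"] assms by simp_all

lemma bracket3:
  assumes "{i, j, k} \<subseteq> {1..t}" "distinct [i, j, k]" "a + b + c = d"
  shows "moderate \<omega> \<Lambda> (\<lambda>n. brk d (blk (V n i) a @ blk (V n j) b @ blk (V n k) c))"
    "\<not> null (\<lambda>n. brk d (blk (V n i) a @ blk (V n j) b @ blk (V n k) c))"
  using bracket_limit[of "[i, j, k]" "[a, b, c]"] assms by simp_all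

end

locale oriented_ulim_flags = ulim_flags +
  fixes \<kappa> :: "nat \<Rightarrow> real" and ori :: "nat \<Rightarrow> nat \<Rightarrow> nat \<Rightarrow> real"
  assumes adm: "\<And>n. generic_flags.admissible d (\<kappa> n) (ori n)"
begin

abbreviation \<epsilon> where "\<epsilon> i j \<equiv> pair_functional d V ori i j"

lemma ori_abs: "s \<le> d \<Longrightarrow> \<bar>ori n i s\<bar> = 1"
proof -
  assume "s \<le> d"
  then have "ori n i s * ori n i s = 1"
    using adm[of n] unfolding generic_flags.admissible_def[OF gf] orientation_def by blast
  then show ?thesis by (auto simp: square_eq_1_iff)
qed

text \<open>By linearity in the last vector, the sequences \<open>\<epsilon> i j l\<close> are the
  coordinates of the functional that inserts \<open>y\<close> into the bracket.\<close>

lemma pairing: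
  assumes "{i, j} \<subseteq> {1..t}" "l \<in> {1..d}"
  shows "(\<Sum>p<d. \<epsilon> i j l p n * y $ p) = ori n i (d - l) * ori n j (l - 1) * brk d (blk (V n i) (d - l) @ blk (V n j) (l - 1) @ [y])"
proof -
  have "brk d ((blk (V n i) (d - l) @ blk (V n j) (l - 1)) @ y # []) =
      (\<Sum>p<d. y $ p * brk d ((blk (V n i) (d - l) @ blk (V n j) (l - 1)) @ unit_vec d p # []))"
  proof (rule brk_sum)
    show "y $ m = (\<Sum>j<d. y $ j * unit_vec d j $ m)" if "m < d" for m
    proof -
      have "(\<Sum>j<d. y $ j * unit_vec d j $ m) = (\<Sum>j<d. if j = m then y $ j else 0)"
        using that by (intro sum.cong) auto
      then show ?thesis using that by simp
    qed
  qed (use assms in auto)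
  then show ?thesis by (simp add: pair_functional_def sum_distrib_left mult_ac)
qed

lemma pairing_zero:
  assumes "{i, j} \<subseteq> {1..t}" "l \<in> {1..d}"
  shows "s \<in> {1..d - l} \<Longrightarrow> (\<Sum>p<d. \<epsilon> i j l p n * V n i s $ p) = 0"
    "s \<in> {1..l - 1} \<Longrightarrow> (\<Sum>p<d. \<epsilon> i j l p n * V n j s $ p) = 0"
proof -
  have *: "brk d (blk (V n i) (d - l) @ blk (V n j) (l - 1) @ [y]) = 0"
    if "y \<in> set (blk (V n i) (d - l)) \<union> set (blk (V n j) (l - 1))" for y
    by (rule brk_notdistinct) (use assms that in auto)
  show "s \<in> {1..d - l} \<Longrightarrow> (\<Sum>p<d. \<epsilon> i j l p n * V n i s $ p) = 0"
    "s \<in> {1..l - 1} \<Longrightarrow> (\<Sum>p<d. \<epsilon> i j l p n * V n j s $ p) = 0"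
    unfolding pairing[OF assms]
    by (simp_all only: *[of "V n i s"] *[of "V n j s"] set_blk Un_iff image_eqI[OF refl] simp_thms mult_zero_right)
qed

text \<open>The first basis vector of flag \<open>i\<close> that is missing from the block has index
  \<open>Suc (d - l)\<close>; inserting it produces, up to sign, a two-flag bracket of exponents
  \<open>Suc (d - l)\<close> and \<open>l - 1\<close>.\<close>

lemma pairing_diag:
  assumes ij: "{i, j} \<subseteq> {1..t}" "i \<noteq> j" and l: "l \<in> {1..d}"
  shows "moderate \<omega> \<Lambda> (\<lambda>n. \<Sum>p<d. \<epsilon> i j l p n * V n i (Suc (d - l)) $ p)"
    "\<not> null (\<lambda>n. \<Sum>p<d. \<epsilon> i j l p n * V n i (Suc (d - l)) $ p)"
    "(\<Sum>p<d. \<epsilon> i j l p n * V n i (Suc (d - l)) $ p) \<noteq> 0"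
    "\<bar>\<Sum>p<d. \<epsilon> i j l p n * V n i (Suc (d - l)) $ p\<bar> = \<bar>brk d (blk (V n i) (d - l) @ blk (V n j) (l - 1) @ [V n i (Suc (d - l))])\<bar>"
proof -
  have ab: "Suc (d - l) + (l - 1) = d" using l by auto
  have o: "\<bar>ori n i (d - l)\<bar> = 1" "\<bar>ori n j (l - 1)\<bar> = 1" for n by (rule ori_abs, use l in auto)+
  have e1: "\<bar>\<Sum>p<d. \<epsilon> i j l p n * V n i (Suc (d - l)) $ p\<bar> = \<bar>brk d (blk (V n i) (d - l) @ blk (V n j) (l - 1) @ [V n i (Suc (d - l))])\<bar>" for n
    unfolding pairing[OF ij(1) l] by (simp only: abs_mult o mult_1)
  have "brk d (blk (V n i) (Suc (d - l)) @ blk (V n j) (l - 1)) =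
      (-1) ^ (l - 1) * brk d (blk (V n i) (d - l) @ blk (V n j) (l - 1) @ [V n i (Suc (d - l))])" for n
    using brk_move[of "blk (V n i) (d - l)" "blk (V n j) (l - 1)" "[]" d "V n i (Suc (d - l))"] l by simp
  then have e2: "\<bar>\<Sum>p<d. \<epsilon> i j l p n * V n i (Suc (d - l)) $ p\<bar> = \<bar>brk d (blk (V n i) (Suc (d - l)) @ blk (V n j) (l - 1))\<bar>" for n
    unfolding e1 by (simp only: abs_mult power_abs abs_neg_one power_one mult_1)
  note b = bracket2[OF ij ab]
  show "moderate \<omega> \<Lambda> (\<lambda>n. \<Sum>p<d. \<epsilon> i j l p n * V n i (Suc (d - l)) $ p)"
    "\<not> null (\<lambda>n. \<Sum>p<d. \<epsilon> i j l p n * V n i (Suc (d - l)) $ p)"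
    by (rule iffD2[OF abs_eq_cong(1) b(1)], rule e2)
      (rule iffD2[OF arg_cong[where f = Not, OF abs_eq_cong(2)] b(2)], rule e2)
  show "(\<Sum>p<d. \<epsilon> i j l p n * V n i (Suc (d - l)) $ p) \<noteq> 0" using e2[of n] b(3)[of n] by auto
  show "\<bar>\<Sum>p<d. \<epsilon> i j l p n * V n i (Suc (d - l)) $ p\<bar> = \<bar>brk d (blk (V n i) (d - l) @ blk (V n j) (l - 1) @ [V n i (Suc (d - l))])\<bar>"
    by (rule e1)
qed

lemma moderate_pair_functional:
  assumes ij: "{i, j} \<subseteq> {1..t}" and l: "l \<in> {1..d}"
  shows "moderate_coords d (\<epsilon> i j l)"
  unfolding moderate_coords_def
proof (intro allI impI)
  fix p assume p: "p < d"
  have o: "\<bar>ori n i (d - l)\<bar> = 1" "\<bar>ori n j (l - 1)\<bar> = 1" for n by (rule ori_abs, use l in auto)+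
  have "list_limit d 1 [vec d (\<lambda>m. ulim \<omega> \<Lambda> (\<lambda>n. unit_vec d p $ m))] (\<lambda>n. [unit_vec d p])"
    by (auto simp: list_limit_def moderate_const)
  then have "list_limit d ((d - l) + ((l - 1) + 1))
      (blk (vK i) (d - l) @ blk (vK j) (l - 1) @ [vec d (\<lambda>m. ulim \<omega> \<Lambda> (\<lambda>n. unit_vec d p $ m))])
      (\<lambda>n. blk (V n i) (d - l) @ blk (V n j) (l - 1) @ [unit_vec d p])"
    using ij l by (intro list_limit_append list_limit_blk) auto
  moreover have "(d - l) + ((l - 1) + 1) = d" using l by auto
  ultimately have b: "moderate \<omega> \<Lambda> (\<lambda>n. brk d (blk (V n i) (d - l) @ blk (V n j) (l - 1) @ [unit_vec d p]))"
    by (intro moderate_brk) (auto simp: list_limit_def)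
  have e: "\<bar>\<epsilon> i j l p n\<bar> = \<bar>brk d (blk (V n i) (d - l) @ blk (V n j) (l - 1) @ [unit_vec d p])\<bar>" for n
    unfolding pair_functional_def by (simp only: abs_mult o mult_1)
  show "moderate \<omega> \<Lambda> (\<epsilon> i j l p)" by (rule iffD2[OF abs_eq_cong(1) b]) (rule e)
qed

text \<open>Pairing the functionals with the adapted basis of flag \<open>i\<close> gives a
  triangular matrix \<open>P n * W n\<close> by \<open>pairing_zero\<close>, with the diagonal of
  \<open>pairing_diag\<close>. Its determinant is non-zero and non-null, and since
  \<open>det (W n)\<close> is moderate, \<open>det (P n)\<close> is non-null too.\<close>

lemma basis_family_pair:
  assumes ij: "{i, j} \<subseteq> {1..t}" "i \<noteq> j"
  shows "basis_family d (\<epsilon> i j)"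
proof -
  define P where "P n = mat d d (\<lambda>(k, p). \<epsilon> i j (Suc k) p n)" for n
  \<comment> \<open>The basis vectors are listed in reverse order: column \<open>s\<close> holds the
    vector of index \<open>d - s\<close>, which puts \<open>Suc (d - Suc k)\<close> on the
    diagonal.\<close>
  define W where "W n = mat d d (\<lambda>(p, s). V n i (d - s) $ p)" for n
  have PW: "P n \<in> carrier_mat d d" "W n \<in> carrier_mat d d" for n by (auto simp: P_def W_def)
  have ent: "(P n * W n) $$ (k, s) = (\<Sum>p<d. \<epsilon> i j (Suc k) p n * V n i (d - s) $ p)" if "k < d" "s < d" for n k s
    using that by (auto simp: P_def W_def scalar_prod_def lessThan_atLeast0 intro!: sum.cong)
  have dg: "det (P n * W n) = prod_list (diag_mat (P n * W n))" for n
  proof (rule det_lower_triangular)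
    show "P n * W n \<in> carrier_mat d d" using PW[of n] by simp
    fix k s assume ks: "k < s" "s < d"
    then have s: "d - s \<in> {1..d - Suc k}" "Suc k \<in> {1..d}" by auto
    have "k < d" using ks by simp
    then show "(P n * W n) $$ (k, s) = 0"
      unfolding ent[OF \<open>k < d\<close> ks(2)] by (intro pairing_zero(1)[OF ij(1) s(2) s(1)])
  qed
  have dt: "det (P n) * det (W n) = (\<Prod>k<d. \<Sum>p<d. \<epsilon> i j (Suc k) p n * V n i (Suc (d - Suc k)) $ p)" for n
  proof -
    have "det (P n) * det (W n) = prod_list (diag_mat (P n * W n))"
      using det_mult[OF PW[of n]] dg[of n] by simp
    also have "\<dots> = (\<Prod>k<d. (P n * W n) $$ (k, k))"
      using PW[of n] by (simp add: prod_list_diag_prod lessThan_atLeast0)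
    also have "\<dots> = (\<Prod>k<d. \<Sum>p<d. \<epsilon> i j (Suc k) p n * V n i (Suc (d - Suc k)) $ p)"
      by (intro prod.cong refl) (simp add: ent Suc_diff_Suc)
    finally show ?thesis .
  qed
  have nz: "det (P n) * det (W n) \<noteq> 0" for n
    unfolding dt using pairing_diag(3)[OF ij] by simp
  have nn: "\<not> null (\<lambda>n. det (P n) * det (W n))"
    unfolding dt by (rule not_null_prod) (use pairing_diag(1,2)[OF ij] in auto)
  have mW: "moderate \<omega> \<Lambda> (\<lambda>n. det (W n))"
    by (rule moderate_det[OF PW(2)]) (use lim ij in \<open>simp add: W_def\<close>)
  show ?thesis
  proof (rule basis_family_matrix[OF PW(1)])
    show "P n $$ (k, p) = \<epsilon> i j (Suc k) p n" if "k < d" "p < d" for k p n using that by (simp add: P_def)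
    show "moderate_coords d (\<epsilon> i j l)" if "l \<in> {1..d}" for l by (rule moderate_pair_functional[OF ij(1) that])
    show "det (P n) \<noteq> 0" for n using nz[of n] by auto
    show "\<not> null (\<lambda>n. det (P n))" using nn null_mult[OF _ mW, of "\<lambda>n. det (P n)"] by blast
  qed
qed

text \<open>The kernel of \<psi> is a submodule, so vanishing on the sum of two subspaces amounts to
  vanishing on their spanning vectors.\<close>

lemma annihilator_iff:
  assumes ij: "{i, j} \<subseteq> {1..t}" and l: "l \<in> {1..d}" and \<psi>: "\<psi> \<in> carrier (dual_coord_space \<omega> \<Lambda> d)"
  shows "\<psi> \<in> flag_pair_lines \<omega> \<Lambda> d (F i) (F j) l \<longleftrightarrow>
    (\<forall>s\<in>{1..d - l}. \<psi> (vK i s) = \<zero>\<^bsub>K\<^esub>) \<and> (\<forall>s\<in>{1..l - 1}. \<psi> (vK j s) = \<zero>\<^bsub>K\<^esub>)"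
proof -
  let ?U = "coord_space K d"
  interpret U: vectorspace K ?U by (rule vectorspace_coord_space[OF field_asymp_field])
  have \<psi>_add: "\<psi> (u \<oplus>\<^bsub>?U\<^esub> w) = \<psi> u \<oplus>\<^bsub>K\<^esub> \<psi> w" if "u \<in> carrier ?U" "w \<in> carrier ?U" for u w
    using \<psi> that by (auto simp: dual_space_def)
  have \<psi>_smult: "\<psi> (a \<odot>\<^bsub>?U\<^esub> u) = a \<otimes>\<^bsub>K\<^esub> \<psi> u" if "a \<in> carrier K" "u \<in> carrier ?U" for a u
    using \<psi> that by (auto simp: dual_space_def)
  have Fi: "F i (d - l) = U.span (vK i ` {1..d - l})" "F j (l - 1) = U.span (vK j ` {1..l - 1})"
    using flagK[of i "d - l"] flagK[of j "l - 1"] ij l by auto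
  have sub: "vK i ` {1..d - l} \<subseteq> carrier ?U" "vK j ` {1..l - 1} \<subseteq> carrier ?U"
    using ij l by (auto intro!: vK_carrier)
  have cl: "F i (d - l) \<subseteq> carrier ?U" "F j (l - 1) \<subseteq> carrier ?U"
    unfolding Fi using U.span_is_subset2[OF sub(1)] U.span_is_subset2[OF sub(2)] by auto
  have own: "vK i ` {1..d - l} \<subseteq> F i (d - l)" "vK j ` {1..l - 1} \<subseteq> F j (l - 1)"
    unfolding Fi using U.in_own_span[OF sub(1)] U.in_own_span[OF sub(2)] by auto
  have zero: "\<zero>\<^bsub>?U\<^esub> \<in> F i (d - l)" "\<zero>\<^bsub>?U\<^esub> \<in> F j (l - 1)"
    unfolding Fi using submodule.zero_closed[OF U.span_is_submodule[OF sub(1)]]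
      submodule.zero_closed[OF U.span_is_submodule[OF sub(2)]] by auto
  have iff: "\<psi> \<in> flag_pair_lines \<omega> \<Lambda> d (F i) (F j) l \<longleftrightarrow>
      (\<forall>x\<in>F i (d - l). \<forall>y\<in>F j (l - 1). \<psi> (x \<oplus>\<^bsub>?U\<^esub> y) = \<zero>\<^bsub>K\<^esub>)"
    using \<psi> by (auto simp: flag_pair_lines_def annihilator_def Let_def U.submodule_sum_def)
  have \<psi>0: "\<psi> \<zero>\<^bsub>?U\<^esub> = \<zero>\<^bsub>K\<^esub>"
  proof -
    have "\<psi> (\<zero>\<^bsub>K\<^esub> \<odot>\<^bsub>?U\<^esub> \<zero>\<^bsub>?U\<^esub>) = \<zero>\<^bsub>K\<^esub> \<otimes>\<^bsub>K\<^esub> \<psi> \<zero>\<^bsub>?U\<^esub>" by (rule \<psi>_smult) auto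
    moreover have "\<psi> \<zero>\<^bsub>?U\<^esub> \<in> carrier K" using \<psi> U.zero_closed by (auto simp: dual_space_def)
    ultimately show ?thesis by simp
  qed
  show ?thesis unfolding iff
  proof (intro iffI conjI ballI)
    assume A: "\<forall>x\<in>F i (d - l). \<forall>y\<in>F j (l - 1). \<psi> (x \<oplus>\<^bsub>?U\<^esub> y) = \<zero>\<^bsub>K\<^esub>"
    fix s assume "s \<in> {1..d - l}"
    then have s: "vK i s \<in> F i (d - l)" using own by blast
    then have "\<psi> (vK i s \<oplus>\<^bsub>?U\<^esub> \<zero>\<^bsub>?U\<^esub>) = \<zero>\<^bsub>K\<^esub>" using A zero by blast
    moreover have "vK i s \<oplus>\<^bsub>?U\<^esub> \<zero>\<^bsub>?U\<^esub> = vK i s" by (rule U.r_zero) (use s cl in blast)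
    ultimately show "\<psi> (vK i s) = \<zero>\<^bsub>K\<^esub>" by simp
  next
    assume A: "\<forall>x\<in>F i (d - l). \<forall>y\<in>F j (l - 1). \<psi> (x \<oplus>\<^bsub>?U\<^esub> y) = \<zero>\<^bsub>K\<^esub>"
    fix s assume "s \<in> {1..l - 1}"
    then have s: "vK j s \<in> F j (l - 1)" using own by blast
    then have "\<psi> (\<zero>\<^bsub>?U\<^esub> \<oplus>\<^bsub>?U\<^esub> vK j s) = \<zero>\<^bsub>K\<^esub>" using A zero by blast
    moreover have "\<zero>\<^bsub>?U\<^esub> \<oplus>\<^bsub>?U\<^esub> vK j s = vK j s" by (rule U.l_zero) (use s cl in blast)
    ultimately show "\<psi> (vK j s) = \<zero>\<^bsub>K\<^esub>" by simp
  next
    assume A: "(\<forall>s\<in>{1..d - l}. \<psi> (vK i s) = \<zero>\<^bsub>K\<^esub>) \<and> (\<forall>s\<in>{1..l - 1}. \<psi> (vK j s) = \<zero>\<^bsub>K\<^esub>)"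
    fix x y assume x: "x \<in> F i (d - l)" and y: "y \<in> F j (l - 1)"
    let ?N = "{u \<in> carrier ?U. \<psi> u = \<zero>\<^bsub>K\<^esub>}"
    have N: "submodule K ?N ?U"
    proof
      show "?N \<subseteq> carrier ?U" by blast
      show "\<zero>\<^bsub>?U\<^esub> \<in> ?N" using \<psi>0 by simp
      show "u \<oplus>\<^bsub>?U\<^esub> w \<in> ?N" if "u \<in> ?N" "w \<in> ?N" for u w using that by (simp add: \<psi>_add)
      show "a \<odot>\<^bsub>?U\<^esub> u \<in> ?N" if "a \<in> carrier K" "u \<in> ?N" for a u using that by (simp add: \<psi>_smult)
    qed
    have "vK i ` {1..d - l} \<subseteq> ?N" "vK j ` {1..l - 1} \<subseteq> ?N" using A sub by auto
    then have "F i (d - l) \<subseteq> ?N" "F j (l - 1) \<subseteq> ?N" unfolding Fi using U.span_is_subset[OF _ N] by blast+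
    then have "x \<in> ?N" "y \<in> ?N" using x y by blast+
    then show "\<psi> (x \<oplus>\<^bsub>?U\<^esub> y) = \<zero>\<^bsub>K\<^esub>" by (simp add: \<psi>_add)
  qed
qed

text \<open>For the harder inclusion, the pair functional is scaled by \<open>x\<close> to agree
  with \<psi> on one further vector \<open>y\<close>. The difference then pairs to null sequences
  with all vectors of a non-null bracket, so \<open>null_of_pairings\<close> makes its coordinates
  null.\<close>

lemma span_pair_functional:
  assumes ij: "{i, j} \<subseteq> {1..t}" "i \<noteq> j" and l: "l \<in> {1..d}"
  shows "module.span K (dual_coord_space \<omega> \<Lambda> d) {funct d (\<epsilon> i j l)} = flag_pair_lines \<omega> \<Lambda> d (F i) (F j) l"
proof -
  let ?D = "dual_coord_space \<omega> \<Lambda> d"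
  interpret D: vectorspace K ?D by (rule vs_dual)
  have it: "i \<in> {1..t}" "j \<in> {1..t}" using ij by auto
  have m: "moderate_coords d (\<epsilon> i j l)" by (rule moderate_pair_functional[OF ij(1) l])
  have e: "funct d (\<epsilon> i j l) \<in> carrier ?D" by (rule funct_closed[OF m])
  note sp = D.span_singleton[OF e]
  have si: "s \<in> {1..d}" if "s \<in> {1..d - l}" for s using that by auto
  have sj: "s \<in> {1..d}" if "s \<in> {1..l - 1}" for s using that l by auto
  have ev: "funct d c (vK x s) = ulim \<omega> \<Lambda> (\<lambda>n. \<Sum>p<d. c p n * V n x s $ p)"
    if "moderate_coords d c" "x \<in> {1..t}" "s \<in> {1..d}" for c x s
    unfolding vK_vseq[OF that(2,3)] by (rule funct_vseq[OF that(1) V_coords[OF that(2,3)]])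
  show ?thesis
  proof (intro equalityI subsetI)
    fix \<psi> assume "\<psi> \<in> D.span {funct d (\<epsilon> i j l)}"
    then obtain a where a: "a \<in> carrier K" "\<psi> = a \<odot>\<^bsub>?D\<^esub> funct d (\<epsilon> i j l)" unfolding sp by blast
    obtain x where x: "moderate \<omega> \<Lambda> x" "a = ulim \<omega> \<Lambda> x" using a(1) by (rule carrier_cases)
    have \<psi>: "\<psi> = funct d (\<lambda>p n. x n * \<epsilon> i j l p n)" unfolding a(2) x(2) by (rule funct_smult[OF x(1) m, symmetric])
    have mx: "moderate_coords d (\<lambda>p n. x n * \<epsilon> i j l p n)" by (rule moderate_coords_smult[OF x(1) m])
    have z: "(\<Sum>p<d. x n * \<epsilon> i j l p n * y $ p) = 0" if "(\<Sum>p<d. \<epsilon> i j l p n * y $ p) = 0" for n and y :: "real vec"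
      using that by (simp add: mult.assoc flip: sum_distrib_left)
    have "\<psi> \<in> carrier ?D" unfolding \<psi> by (rule funct_closed[OF mx])
    then show "\<psi> \<in> flag_pair_lines \<omega> \<Lambda> d (F i) (F j) l"
      unfolding annihilator_iff[OF ij(1) l \<open>\<psi> \<in> carrier ?D\<close>]
    proof (intro conjI ballI)
      show "\<psi> (vK i s) = \<zero>\<^bsub>K\<^esub>" if s: "s \<in> {1..d - l}" for s
        unfolding \<psi> ev[OF mx it(1) si[OF s]] z[OF pairing_zero(1)[OF ij(1) l s]] by (simp add: zero_K)
      show "\<psi> (vK j s) = \<zero>\<^bsub>K\<^esub>" if s: "s \<in> {1..l - 1}" for s
        unfolding \<psi> ev[OF mx it(2) sj[OF s]] z[OF pairing_zero(2)[OF ij(1) l s]] by (simp add: zero_K)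
    qed
  next
    fix \<psi> assume L: "\<psi> \<in> flag_pair_lines \<omega> \<Lambda> d (F i) (F j) l"
    then have \<psi>D: "\<psi> \<in> carrier ?D" by (simp add: flag_pair_lines_def annihilator_def Let_def)
    obtain c where c: "moderate_coords d c" "\<psi> = funct d c" using \<psi>D by (rule funct_cases)
    have zi: "null (\<lambda>n. \<Sum>p<d. c p n * V n i s $ p)" if s: "s \<in> {1..d - l}" for s
    proof -
      have "\<psi> (vK i s) = \<zero>\<^bsub>K\<^esub>" using L s unfolding annihilator_iff[OF ij(1) l \<psi>D] by blast
      then show ?thesis unfolding c(2) ev[OF c(1) it(1) si[OF s]]
        using ulim_zero_iff[OF moderate_pairing[OF c(1) V_coords[OF it(1) si[OF s]]]] by blast
    qed
    have zj: "null (\<lambda>n. \<Sum>p<d. c p n * V n j s $ p)" if s: "s \<in> {1..l - 1}" for s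
    proof -
      have "\<psi> (vK j s) = \<zero>\<^bsub>K\<^esub>" using L s unfolding annihilator_iff[OF ij(1) l \<psi>D] by blast
      then show ?thesis unfolding c(2) ev[OF c(1) it(2) sj[OF s]]
        using ulim_zero_iff[OF moderate_pairing[OF c(1) V_coords[OF it(2) sj[OF s]]]] by blast
    qed
    \<comment> \<open>The vector of flag \<open>i\<close> just beyond the first
      \<open>d - l\<close>; together with the two blocks it makes up \<open>d\<close>
      vectors.\<close>
    define y where "y n = V n i (Suc (d - l))" for n
    define us where "us n = blk (V n i) (d - l) @ blk (V n j) (l - 1) @ [y n]" for n
    define D0 where "D0 n = (\<Sum>p<d. \<epsilon> i j l p n * y n $ p)" for n
    define x where "x n = (\<Sum>p<d. c p n * y n $ p) / D0 n" for n
    have sl: "Suc (d - l) \<in> {1..d}" using l by auto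
    have D0: "moderate \<omega> \<Lambda> D0" "\<not> null D0" "D0 n \<noteq> 0" "\<bar>D0 n\<bar> = \<bar>brk d (us n)\<bar>" for n
      using pairing_diag[OF ij l] unfolding D0_def us_def y_def by blast+
    have mx: "moderate \<omega> \<Lambda> x" unfolding x_def
      by (rule moderate_divide[OF _ D0(1,2)])
        (use moderate_pairing[OF c(1) V_coords[OF it(1) sl]] in \<open>simp add: y_def\<close>)
    have me: "moderate_coords d (\<lambda>p n. x n * \<epsilon> i j l p n)" by (rule moderate_coords_smult[OF mx m])
    have mc': "moderate_coords d (\<lambda>p n. c p n - x n * \<epsilon> i j l p n)"
      using moderate_coords_add[OF c(1) moderate_coords_smult[OF moderate_const[of "-1"] me]] by simp
    have len: "length (us n) = d" for n using l by (simp add: us_def)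
    have nth: "us n ! k = (if k < d - l then V n i (Suc k) else if k < d - 1 then V n j (Suc (k - (d - l))) else y n)"
      if "k < d" for k n
      using that l by (auto simp: us_def nth_append blk_nth)
    have split: "(\<Sum>q<d. (c q n - x n * \<epsilon> i j l q n) * w $ q) = (\<Sum>q<d. c q n * w $ q) - x n * (\<Sum>q<d. \<epsilon> i j l q n * w $ q)"
      for n and w :: "real vec"
      by (simp add: left_diff_distrib sum_subtractf sum_distrib_left mult.assoc)
    have "null (\<lambda>n. c p n - x n * \<epsilon> i j l p n)" if p: "p < d" for p
    proof (rule null_of_pairings[OF len _ _ mc' _ p])
      show "moderate \<omega> \<Lambda> (\<lambda>n. us n ! k $ q)" if kq: "k < d" "q < d" for k q
      proof -
        consider "k < d - l" | "\<not> k < d - l" "k < d - 1" | "\<not> k < d - l" "\<not> k < d - 1" by blast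
        then show ?thesis
        proof cases
          case 1 then show ?thesis unfolding nth[OF kq(1)] using lim[OF it(1), of "Suc k" q] kq l by auto
        next
          case 2
          then have "Suc (k - (d - l)) \<in> {1..d}" using l by auto
          from lim[OF it(2) this kq(2)] show ?thesis unfolding nth[OF kq(1)] using 2 by simp
        next
          case 3 then show ?thesis unfolding nth[OF kq(1)] using lim[OF it(1) sl kq(2)] by (simp add: y_def)
        qed
      qed
      show "\<not> null (\<lambda>n. brk d (us n))" using D0(2) abs_eq_cong(2)[of D0 "\<lambda>n. brk d (us n)", OF D0(4)] by blast
      show "null (\<lambda>n. \<Sum>q<d. (c q n - x n * \<epsilon> i j l q n) * us n ! k $ q)" if k: "k < d" for k
      proof -
        consider "k < d - l" | "\<not> k < d - l" "k < d - 1" | "\<not> k < d - l" "\<not> k < d - 1" by blast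
        then show ?thesis
        proof cases
          case 1
          then have s: "Suc k \<in> {1..d - l}" by auto
          show ?thesis unfolding nth[OF k] split using 1 pairing_zero(1)[OF ij(1) l s] zi[OF s] by simp
        next
          case 2
          then have s: "Suc (k - (d - l)) \<in> {1..l - 1}" using l by auto
          show ?thesis unfolding nth[OF k] split using 2 pairing_zero(2)[OF ij(1) l s] zj[OF s] by simp
        next
          case 3
          have "(\<Sum>q<d. c q n * y n $ q) - x n * (\<Sum>q<d. \<epsilon> i j l q n * y n $ q) = 0" for n
            using D0(3)[of n] by (simp add: x_def flip: D0_def)
          then show ?thesis unfolding nth[OF k] split using 3 by simp
        qed
      qed
    qed
    then have "\<psi> = funct d (\<lambda>p n. x n * \<epsilon> i j l p n)"
      unfolding c(2) funct_eq_iff[OF c(1) me] by blast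
    also have "\<dots> = ulim \<omega> \<Lambda> x \<odot>\<^bsub>?D\<^esub> funct d (\<epsilon> i j l)" by (rule funct_smult[OF mx m])
    finally show "\<psi> \<in> D.span {funct d (\<epsilon> i j l)}" unfolding sp using ulim_carrier[OF mx] by blast
  qed
qed

text \<open>The extreme cases of \<open>cone_triple\<close>: exponent 0 at \<open>i\<close> leaves
  the functionals of the pair \<open>(j, k)\<close>, and exponent 0 at \<open>k\<close> those of
  \<open>(i, j)\<close>.\<close>

lemma cone_step:
  assumes ijk: "{i, j, k} \<subseteq> {1..t}" "distinct [i, j, k]"
    and T: "\<And>n. generic_flags.tri d (V n) (\<kappa> n) (ori n) i j k"
  shows "cone d (\<epsilon> i k) (\<epsilon> j k)" "cone d (\<epsilon> i k) (\<epsilon> i j)"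
proof -
  have ct: "\<exists>M. (\<forall>l\<in>{1..d}. moderate \<omega> \<Lambda> (M l) \<and> (\<forall>n. 0 \<le> M l n)) \<and>
    (\<forall>n. \<forall>y\<in>carrier_vec d. ori n i a * ori n j b * ori n k c *
        brk d (blk (V n i) a @ blk (V n j) b @ blk (V n k) c @ [y]) =
      (\<Sum>l\<in>{1..d}. M l n * (ori n i (d - l) * ori n k (l - 1) *
        brk d (blk (V n i) (d - l) @ blk (V n k) (l - 1) @ [y]))))" if "a + b + c + 1 = d" for a b c
    by (rule cone_triple[OF gf adm ijk T _ _ that]) (erule bracket3[OF ijk])+
  have o0: "ori n x 0 = 1" for n x
    using adm[of n] unfolding generic_flags.admissible_def[OF gf] orientation_def by blast
  define f where "f a b c n y = ori n i a * ori n j b * ori n k c * brk d (blk (V n i) a @ blk (V n j) b @ blk (V n k) c @ [y])"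
    for a b c n and y :: "real vec"
  define g where "g l n y = ori n i (d - l) * ori n k (l - 1) * brk d (blk (V n i) (d - l) @ blk (V n k) (l - 1) @ [y])"
    for l n and y :: "real vec"
  have C: "cone d (\<epsilon> i k) \<epsilon>'" if sum: "\<And>m. m \<in> {1..d} \<Longrightarrow> a m + b m + c m + 1 = d"
    and e': "\<And>m p n. m \<in> {1..d} \<Longrightarrow> p < d \<Longrightarrow> \<epsilon>' m p n = f (a m) (b m) (c m) n (unit_vec d p)" for a b c \<epsilon>'
  proof -
    have ex: "\<exists>M. m \<in> {1..d} \<longrightarrow> ((\<forall>l\<in>{1..d}. moderate \<omega> \<Lambda> (M l) \<and> (\<forall>n. 0 \<le> M l n)) \<and>
       (\<forall>n. \<forall>y\<in>carrier_vec d. f (a m) (b m) (c m) n y = (\<Sum>l\<in>{1..d}. M l n * g l n y)))" for m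
      using ct[OF sum] unfolding f_def g_def by blast
    have "\<exists>M. \<forall>m. m \<in> {1..d} \<longrightarrow> ((\<forall>l\<in>{1..d}. moderate \<omega> \<Lambda> (M m l) \<and> (\<forall>n. 0 \<le> M m l n)) \<and>
       (\<forall>n. \<forall>y\<in>carrier_vec d. f (a m) (b m) (c m) n y = (\<Sum>l\<in>{1..d}. M m l n * g l n y)))"
      by (rule choice, rule allI, rule ex)
    then obtain M where M: "\<forall>m. m \<in> {1..d} \<longrightarrow> ((\<forall>l\<in>{1..d}. moderate \<omega> \<Lambda> (M m l) \<and> (\<forall>n. 0 \<le> M m l n)) \<and>
       (\<forall>n. \<forall>y\<in>carrier_vec d. f (a m) (b m) (c m) n y = (\<Sum>l\<in>{1..d}. M m l n * g l n y)))" by blast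
    have gp: "g l n (unit_vec d p) = \<epsilon> i k l p n" for l n p by (simp add: g_def pair_functional_def)
    show ?thesis unfolding cone_def
    proof (intro exI[of _ M] conjI ballI allI impI)
      fix m l n assume "m \<in> {1..d}" "l \<in> {1..d}"
      then show "moderate \<omega> \<Lambda> (M m l)" "0 \<le> M m l n" using M by blast+
    next
      fix m p n assume mp: "m \<in> {1..d}" "p < d"
      have "unit_vec d p \<in> (carrier_vec d :: real vec set)" by simp
      then have "f (a m) (b m) (c m) n (unit_vec d p) = (\<Sum>l\<in>{1..d}. M m l n * g l n (unit_vec d p))" using M mp(1) by blast
      then show "\<epsilon>' m p n = (\<Sum>l\<in>{1..d}. M m l n * \<epsilon> i k l p n)" unfolding gp e'[OF mp] .
    qed
  qed
  show "cone d (\<epsilon> i k) (\<epsilon> j k)"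
    by (rule C[of "\<lambda>_. 0" "\<lambda>m. d - m" "\<lambda>m. m - 1"]) (auto simp: f_def o0 pair_functional_def)
  show "cone d (\<epsilon> i k) (\<epsilon> i j)"
    by (rule C[of "\<lambda>m. d - m" "\<lambda>m. m - 1" "\<lambda>_. 0"]) (auto simp: f_def o0 pair_functional_def)
qed

end

lemma inj_cyclic_shift: "inj_on (cyclic_shift t c) {1..t}"
proof (rule linorder_inj_onI')
  fix i j assume ij: "i \<in> {1..t}" "j \<in> {1..t}" "i < j"
  show "cyclic_shift t c i \<noteq> cyclic_shift t c j"
  proof
    assume "cyclic_shift t c i = cyclic_shift t c j"
    then have "(j - 1 + c) mod t = (i - 1 + c) mod t" by (simp add: cyclic_shift_def)
    then have "t dvd (j - 1 + c) - (i - 1 + c)" using ij by (subst (asm) mod_eq_dvd_iff_nat) auto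
    moreover have "(j - 1 + c) - (i - 1 + c) = j - i" using ij by auto
    ultimately have "t \<le> j - i" using ij by (intro dvd_imp_le) auto
    then show False using ij by auto
  qed
qed

lemma generic_flags_of_maximum_span:
  fixes F :: "nat \<Rightarrow> real flag"
  assumes d: "1 \<le> d" and ms: "maximum_span class_ring d t F"
    and bas: "\<And>i. i \<in> {1..t} \<Longrightarrow> indexed_basis class_ring (coord_space class_ring d) d (v i)"
    and F: "\<And>i a. i \<in> {1..t} \<Longrightarrow> a \<le> d \<Longrightarrow> F i a = module.span class_ring (coord_space class_ring d) (v i ` {1..a})"
  shows "generic_flags d t v"
proof
  interpret U: vectorspace class_ring "coord_space (class_ring :: real ring) d"
    by (rule vectorspace_coord_space[OF class_field])
  show "1 \<le> d" by (rule d)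
  show "v i s \<in> carrier_vec d" if "i \<in> {1..t}" "s \<in> {1..d}" for i s
  proof -
    have "v i s \<in> carrier (coord_space class_ring d)"
      using bas[OF that(1)] that(2) by (auto simp: indexed_basis_def U.basis_def)
    then show ?thesis by (simp add: coord_space_def)
  qed
  show "brk d (concat (map2 (\<lambda>i a. blk (v i) a) ix as)) \<noteq> 0"
    if ix: "distinct ix" "set ix \<subseteq> {1..t}" "length as = length ix" "sum_list as = d" for ix as
    by (rule real_span_brk_nonzero; rule maximum_span_generates[OF class_field d ms bas F ix]; assumption)
qed

section \<open>From adapted norms to apartments\<close>

context asymp_scale
begin

lemma asymp_abs_pos:
  assumes "a \<in> carrier K" "a \<noteq> \<zero>\<^bsub>K\<^esub>" shows "0 < asymp_abs \<omega> \<Lambda> a"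
proof -
  obtain x where x: "moderate \<omega> \<Lambda> x" "a = ulim \<omega> \<Lambda> x" using assms(1) by (rule carrier_cases)
  obtain l where l: "(N x \<longlongrightarrow> l) \<omega>" using x(1) by (auto simp: moderate_def)
  have "l \<noteq> 0" using assms(2) l ulim_zero_iff[OF x(1)] x(2) by auto
  moreover have "0 \<le> l" by (rule tendsto_lowerbound[OF l]) (use omega_nontrivial in auto)
  ultimately show ?thesis using asymp_abs_ulim[OF l] x(2) by simp
qed

text \<open>Generators of the same lines differ by scalars \<open>y l\<close>, and homogeneity moves
  their absolute values between the coefficients and the norms of the basis vectors.\<close>

lemma adapted_same_lines:
  assumes ad: "adapted \<omega> \<Lambda> d e \<eta>" and f: "indexed_basis K (dual_coord_space \<omega> \<Lambda> d) d f"
    and lines: "\<And>l. l \<in> {1..d} \<Longrightarrow> module.span K (dual_coord_space \<omega> \<Lambda> d) {e l} =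
      module.span K (dual_coord_space \<omega> \<Lambda> d) {f l}"
  shows "adapted \<omega> \<Lambda> d f \<eta>"
proof -
  let ?D = "dual_coord_space \<omega> \<Lambda> d"
  interpret D: vectorspace K ?D by (rule vs_dual)
  have nrm: "ultrametric_norm \<omega> \<Lambda> d \<eta>" and e: "indexed_basis K ?D d e"
    using ad by (simp_all add: adapted_def Let_def)
  have ec: "e l \<in> carrier ?D" and fc: "f l \<in> carrier ?D" if "l \<in> {1..d}" for l
    using e f that unfolding indexed_basis_def D.basis_def by blast+
  have hom: "\<eta> (x \<odot>\<^bsub>?D\<^esub> w) = asymp_abs \<omega> \<Lambda> x * \<eta> w" if "x \<in> carrier K" "w \<in> carrier ?D" for x w
    using nrm that by (simp add: ultrametric_norm_def Let_def)
  have "\<exists>a. a \<in> carrier K \<and> f l = a \<odot>\<^bsub>?D\<^esub> e l" if l: "l \<in> {1..d}" for l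
  proof -
    have "f l \<in> D.span {e l}" unfolding lines[OF l] using D.in_own_span[of "{f l}"] fc[OF l] by simp
    then show ?thesis unfolding D.span_singleton[OF ec[OF l]] by blast
  qed
  then obtain y where y: "\<And>l. l \<in> {1..d} \<Longrightarrow> y l \<in> carrier K" "\<And>l. l \<in> {1..d} \<Longrightarrow> f l = y l \<odot>\<^bsub>?D\<^esub> e l"
    by metis
  have "\<eta> (\<Oplus>\<^bsub>?D\<^esub>j\<in>{1..d}. x j \<odot>\<^bsub>?D\<^esub> f j) = Max ((\<lambda>j. asymp_abs \<omega> \<Lambda> (x j) * \<eta> (f j)) ` {1..d})"
    if x: "x \<in> {1..d} \<rightarrow> carrier K" for x
  proof -
    have xy: "x j \<odot>\<^bsub>?D\<^esub> f j = (x j \<otimes>\<^bsub>K\<^esub> y j) \<odot>\<^bsub>?D\<^esub> e j" "x j \<otimes>\<^bsub>K\<^esub> y j \<in> carrier K" if "j \<in> {1..d}" for j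
      using x y that ec[OF that] by (auto simp: D.smult_assoc1 Pi_iff)
    have "(\<Oplus>\<^bsub>?D\<^esub>j\<in>{1..d}. x j \<odot>\<^bsub>?D\<^esub> f j) = (\<Oplus>\<^bsub>?D\<^esub>j\<in>{1..d}. (x j \<otimes>\<^bsub>K\<^esub> y j) \<odot>\<^bsub>?D\<^esub> e j)"
      by (rule D.finsum_cong') (use xy ec in auto)
    moreover have "(\<lambda>j. x j \<otimes>\<^bsub>K\<^esub> y j) \<in> {1..d} \<rightarrow> carrier K" using xy(2) by blast
    ultimately have A: "\<eta> (\<Oplus>\<^bsub>?D\<^esub>j\<in>{1..d}. x j \<odot>\<^bsub>?D\<^esub> f j) =
        Max ((\<lambda>j. asymp_abs \<omega> \<Lambda> (x j \<otimes>\<^bsub>K\<^esub> y j) * \<eta> (e j)) ` {1..d})"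
      using ad unfolding adapted_def Let_def by auto
    have B: "asymp_abs \<omega> \<Lambda> (x j \<otimes>\<^bsub>K\<^esub> y j) * \<eta> (e j) = asymp_abs \<omega> \<Lambda> (x j) * \<eta> (f j)" if j: "j \<in> {1..d}" for j
    proof -
      have "asymp_abs \<omega> \<Lambda> (x j \<otimes>\<^bsub>K\<^esub> y j) * \<eta> (e j) = \<eta> (x j \<odot>\<^bsub>?D\<^esub> f j)"
        unfolding xy(1)[OF j] using hom[OF xy(2)[OF j] ec[OF j]] by simp
      also have "\<dots> = asymp_abs \<omega> \<Lambda> (x j) * \<eta> (f j)" using hom[OF _ fc[OF j]] x j by blast
      finally show ?thesis .
    qed
    show ?thesis unfolding A by (rule arg_cong[where f = Max, OF image_cong[OF refl B]])
  qed
  then show ?thesis using nrm f unfolding adapted_def Let_def by blast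
qed

lemma adapted_scaled:
  assumes ad: "adapted \<omega> \<Lambda> d e \<eta>" and d: "1 \<le> d" and nrm: "ultrametric_norm \<omega> \<Lambda> d \<eta>'" and r: "0 \<le> r"
    and scaled: "\<And>w. w \<in> carrier (dual_coord_space \<omega> \<Lambda> d) \<Longrightarrow> \<eta>' w = r * \<eta> w"
  shows "adapted \<omega> \<Lambda> d e \<eta>'"
proof -
  let ?D = "dual_coord_space \<omega> \<Lambda> d"
  interpret D: vectorspace K ?D by (rule vs_dual)
  have e: "indexed_basis K ?D d e" using ad by (simp add: adapted_def Let_def)
  have ec: "e l \<in> carrier ?D" if "l \<in> {1..d}" for l
    using e that unfolding indexed_basis_def D.basis_def by blast
  have "\<eta>' (\<Oplus>\<^bsub>?D\<^esub>j\<in>{1..d}. x j \<odot>\<^bsub>?D\<^esub> e j) = Max ((\<lambda>j. asymp_abs \<omega> \<Lambda> (x j) * \<eta>' (e j)) ` {1..d})"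
    if x: "x \<in> {1..d} \<rightarrow> carrier K" for x
  proof -
    have "(\<Oplus>\<^bsub>?D\<^esub>j\<in>{1..d}. x j \<odot>\<^bsub>?D\<^esub> e j) \<in> carrier ?D" using x ec by (intro D.finsum_closed) auto
    then have "\<eta>' (\<Oplus>\<^bsub>?D\<^esub>j\<in>{1..d}. x j \<odot>\<^bsub>?D\<^esub> e j) =
        r * Max ((\<lambda>j. asymp_abs \<omega> \<Lambda> (x j) * \<eta> (e j)) ` {1..d})"
      using scaled ad x unfolding adapted_def Let_def by auto
    also have "\<dots> = Max ((\<lambda>m. r * m) ` (\<lambda>j. asymp_abs \<omega> \<Lambda> (x j) * \<eta> (e j)) ` {1..d})"
      by (rule mono_Max_commute) (use r d in \<open>auto intro: monoI mult_left_mono\<close>)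
    also have "(\<lambda>m. r * m) ` (\<lambda>j. asymp_abs \<omega> \<Lambda> (x j) * \<eta> (e j)) ` {1..d} = (\<lambda>j. asymp_abs \<omega> \<Lambda> (x j) * \<eta>' (e j)) ` {1..d}"
      unfolding image_image by (rule image_cong[OF refl]) (simp add: scaled ec)
    finally show ?thesis .
  qed
  then show ?thesis using nrm e unfolding adapted_def Let_def by blast
qed

text \<open>Each norm of the class is compared with the norm \<open>\<eta>0\<close> that generates
  it, so any two differ by a positive real factor, which commutes with the maximum.\<close>

lemma adapted_homothetic:
  assumes c: "c \<in> building \<omega> \<Lambda> d" "\<eta> \<in> c" "\<eta>' \<in> c" and d: "1 \<le> d" and ad: "adapted \<omega> \<Lambda> d e \<eta>"
  shows "adapted \<omega> \<Lambda> d e \<eta>'"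
proof -
  let ?D = "dual_coord_space \<omega> \<Lambda> d"
  obtain \<eta>0 where "c = homothety_rel \<omega> \<Lambda> d `` {\<eta>0}"
    using c(1) unfolding building_def by (rule quotientE)
  then have rel: "(\<eta>0, \<eta>) \<in> homothety_rel \<omega> \<Lambda> d" "(\<eta>0, \<eta>') \<in> homothety_rel \<omega> \<Lambda> d" using c(2,3) by auto
  have ex: "ultrametric_norm \<omega> \<Lambda> d \<zeta> \<and> (\<exists>r>0. \<forall>w\<in>carrier ?D. \<eta>0 w = r * \<zeta> w)"
    if z: "(\<eta>0, \<zeta>) \<in> homothety_rel \<omega> \<Lambda> d" for \<zeta>
  proof -
    obtain x where x: "x \<in> carrier K" "x \<noteq> \<zero>\<^bsub>K\<^esub>" "\<And>w. w \<in> carrier ?D \<Longrightarrow> \<eta>0 w = \<zeta> (x \<odot>\<^bsub>?D\<^esub> w)"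
      and \<zeta>: "\<zeta> \<in> adaptable_norms \<omega> \<Lambda> d"
      using z unfolding homothety_rel_def Let_def by blast
    have n: "ultrametric_norm \<omega> \<Lambda> d \<zeta>" using \<zeta> by (auto simp: adaptable_norms_def adapted_def Let_def)
    then have "\<forall>w\<in>carrier ?D. \<eta>0 w = asymp_abs \<omega> \<Lambda> x * \<zeta> w"
      using x(1,3) by (simp add: ultrametric_norm_def Let_def)
    then show ?thesis using n asymp_abs_pos[OF x(1,2)] by blast
  qed
  obtain r r' where r: "0 < r" "0 < r'" "\<And>w. w \<in> carrier ?D \<Longrightarrow> \<eta>0 w = r * \<eta> w"
    "\<And>w. w \<in> carrier ?D \<Longrightarrow> \<eta>0 w = r' * \<eta>' w"
    using ex[OF rel(1)] ex[OF rel(2)] by blast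
  show ?thesis
  proof (rule adapted_scaled[OF ad d, of _ "r / r'"])
    show "ultrametric_norm \<omega> \<Lambda> d \<eta>'" using ex[OF rel(2)] by blast
    show "0 \<le> r / r'" using r by simp
    show "\<eta>' w = r / r' * \<eta> w" if "w \<in> carrier ?D" for w
      using r(3)[OF that] r(4)[OF that] r(2) by (simp add: field_simps)
  qed
qed

text \<open>The two memberships supply norms \<eta> and \<open>\<eta>'\<close> of the class and
  arbitrary generators of the lines. Both are transferred to \<eta> and to the generators
  \<open>\<epsilon>1\<close> and \<open>\<epsilon>3\<close>, where \<open>adapted_cone\<close>
  applies.\<close>

lemma apartment_between:
  assumes d: "1 \<le> d" and b: "basis_family d \<epsilon>1" "basis_family d \<epsilon>2" "basis_family d \<epsilon>3"
    and cone: "cone d \<epsilon>1 \<epsilon>2" "cone d \<epsilon>2 \<epsilon>3"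
    and L: "\<And>l. l \<in> {1..d} \<Longrightarrow> module.span K (dual_coord_space \<omega> \<Lambda> d) {funct d (\<epsilon>1 l)} = L1 l"
      "\<And>l. l \<in> {1..d} \<Longrightarrow> module.span K (dual_coord_space \<omega> \<Lambda> d) {funct d (\<epsilon>2 l)} = L2 l"
      "\<And>l. l \<in> {1..d} \<Longrightarrow> module.span K (dual_coord_space \<omega> \<Lambda> d) {funct d (\<epsilon>3 l)} = L3 l"
  shows "apartment \<omega> \<Lambda> d L1 \<inter> apartment \<omega> \<Lambda> d L3 \<subseteq> apartment \<omega> \<Lambda> d L2"
proof
  fix c assume "c \<in> apartment \<omega> \<Lambda> d L1 \<inter> apartment \<omega> \<Lambda> d L3"
  then obtain \<eta> e \<eta>' e' where c: "c \<in> building \<omega> \<Lambda> d" "\<eta> \<in> c" "\<eta>' \<in> c"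
    and e: "adapted \<omega> \<Lambda> d e \<eta>" "\<And>l. l \<in> {1..d} \<Longrightarrow> module.span K (dual_coord_space \<omega> \<Lambda> d) {e l} = L1 l"
    and e': "adapted \<omega> \<Lambda> d e' \<eta>'" "\<And>l. l \<in> {1..d} \<Longrightarrow> module.span K (dual_coord_space \<omega> \<Lambda> d) {e' l} = L3 l"
    unfolding apartment_def by blast
  have "adapted \<omega> \<Lambda> d (\<lambda>l. funct d (\<epsilon>1 l)) \<eta>"
    by (rule adapted_same_lines[OF e(1) basis_family_basis[OF b(1)]]) (simp only: e(2) L(1))
  moreover have "adapted \<omega> \<Lambda> d (\<lambda>l. funct d (\<epsilon>3 l)) \<eta>"
    by (rule adapted_homothetic[OF c(1,3,2) d], rule adapted_same_lines[OF e'(1) basis_family_basis[OF b(3)]])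
      (simp only: e'(2) L(3))
  ultimately have "adapted \<omega> \<Lambda> d (\<lambda>l. funct d (\<epsilon>2 l)) \<eta>" by (rule adapted_cone[OF d b cone])
  then show "c \<in> apartment \<omega> \<Lambda> d L2" unfolding apartment_def using c L(2) by blast
qed

end

context oriented_ulim_flags
begin

text \<open>One endpoint is moved at a time, through the pair \<open>(i', j)\<close>. Injectivity of
  \<open>\<sigma>\<close> turns an equality of positions into an equality of indices, where the cone
  is trivial.\<close>

lemma cone_nested:
  fixes \<sigma> :: "nat \<Rightarrow> nat"
  assumes \<sigma>: "inj_on \<sigma> {1..t}"
    and T: "\<And>n i j k. {i, j, k} \<subseteq> {1..t} \<Longrightarrow> \<sigma> i < \<sigma> j \<Longrightarrow> \<sigma> j < \<sigma> k \<Longrightarrow> generic_flags.tri d (V n) (\<kappa> n) (ori n) i j k"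
    and ix: "{i, j, i', j'} \<subseteq> {1..t}" and le: "\<sigma> i \<le> \<sigma> i'" "\<sigma> i' < \<sigma> j'" "\<sigma> j' \<le> \<sigma> j"
  shows "cone d (\<epsilon> i j) (\<epsilon> i' j')"
proof (rule cone_trans)
  have step: "cone d (\<epsilon> x z) (\<epsilon> y z)" "cone d (\<epsilon> x z) (\<epsilon> x y)"
    if "{x, y, z} \<subseteq> {1..t}" "\<sigma> x < \<sigma> y" "\<sigma> y < \<sigma> z" for x y z
  proof -
    have "distinct [x, y, z]" using that by auto
    then show "cone d (\<epsilon> x z) (\<epsilon> y z)" "cone d (\<epsilon> x z) (\<epsilon> x y)"
      using cone_step[OF that(1) _ T[OF that]] by blast+
  qed
  show "cone d (\<epsilon> i j) (\<epsilon> i' j)"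
  proof (cases "\<sigma> i = \<sigma> i'")
    case True
    then have "i = i'" using \<sigma> ix by (auto dest: inj_onD)
    then show ?thesis by (simp add: cone_refl)
  next
    case False
    then show ?thesis using le ix by (intro step(1)) auto
  qed
  show "cone d (\<epsilon> i' j) (\<epsilon> i' j')"
  proof (cases "\<sigma> j = \<sigma> j'")
    case True
    then have "j = j'" using \<sigma> ix by (auto dest: inj_onD)
    then show ?thesis by (simp add: cone_refl)
  next
    case False
    then show ?thesis using le ix by (intro step(2)) auto
  qed
qed

end

theorem theorem1p3:
  fixes \<omega> :: "nat filter" and \<Lambda> :: "nat \<Rightarrow> real"
    and d t :: nat and T :: "(nat \<times> nat) set"
    and Fs :: "nat \<Rightarrow> nat \<Rightarrow> real flag" and F :: "nat \<Rightarrow> asymp flag"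
    and i1 j1 i2 j2 i3 j3 :: nat
  assumes "nonprincipal_ultrafilter \<omega>"
    and "\<And>n. 1 \<le> \<Lambda> n" and "filterlim \<Lambda> at_top sequentially"
    and "oriented_triangulation t T"
    and "\<And>n. positive_tuple d t T (Fs n)"
    and "\<And>i. i \<in> {1..t} \<Longrightarrow> is_flag_ulim \<omega> \<Lambda> d (\<lambda>n. Fs n i) (F i)"
    and "ulim_positive \<omega> \<Lambda> d t T Fs F"
    and "combinatorially_separates t (i2, j2) (i1, j1) (i3, j3)"
  shows "flag_apartment \<omega> \<Lambda> d (F i1) (F j1) \<inter> flag_apartment \<omega> \<Lambda> d (F i3) (F j3) =
         flag_apartment \<omega> \<Lambda> d (F i1) (F j1) \<inter> flag_apartment \<omega> \<Lambda> d (F i2) (F j2) \<inter>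
         flag_apartment \<omega> \<Lambda> d (F i3) (F j3)"
proof (cases "d = 0")
  \<comment> \<open>For \<open>d = 0\<close> there are no lines to prescribe, so all three
    apartments are the same set.\<close>
  case True
  then show ?thesis by (simp add: flag_apartment_def apartment_def)
next
  case False
  then have d: "1 \<le> d" by simp
  interpret asymp_scale \<omega> \<Lambda> by unfold_locales (rule assms(1,2))+
  from assms(8) obtain c where ix: "{i1, j1, i2, j2, i3, j3} \<subseteq> {1..t}"
    and le: "cyclic_shift t c i1 \<le> cyclic_shift t c i2" "cyclic_shift t c i2 \<le> cyclic_shift t c i3"
      "cyclic_shift t c i3 < cyclic_shift t c j3" "cyclic_shift t c j3 \<le> cyclic_shift t c j2"
      "cyclic_shift t c j2 \<le> cyclic_shift t c j1"
    unfolding combinatorially_separates_def Let_def by auto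
  have t: "2 \<le> t"
  proof (rule ccontr)
    assume "\<not> 2 \<le> t"
    then have "i3 = j3" using ix by auto
    then show False using le(3) by simp
  qed
  let ?R = "coord_space (class_ring :: real ring) d"
  define P where "P i vs v \<longleftrightarrow> (\<forall>n. indexed_basis class_ring ?R d (\<lambda>s. vs s n)) \<and>
      indexed_basis K (coord_space K d) d v \<and>
      (\<forall>s\<in>{1..d}. \<forall>m<d. moderate \<omega> \<Lambda> (\<lambda>n. vs s n $ m) \<and> ulim \<omega> \<Lambda> (\<lambda>n. vs s n $ m) = v s $ m) \<and>
      (\<forall>n. \<forall>a\<le>d. Fs n i a = module.span class_ring ?R ((\<lambda>s. vs s n) ` {1..a})) \<and>
      (\<forall>a\<le>d. F i a = module.span K (coord_space K d) (v ` {1..a}))" for i vs v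
  have "\<exists>vs v. P i vs v" if "i \<in> {1..t}" for i
    using assms(6)[OF that] unfolding is_flag_ulim_def P_def by (elim conjE)
  then obtain vs vK where P: "\<And>i. i \<in> {1..t} \<Longrightarrow> P i (vs i) (vK i)" by metis
  have vs: "indexed_basis class_ring ?R d (\<lambda>s. vs i s n)" if "i \<in> {1..t}" for i n
    using P[OF that] unfolding P_def by blast
  have vK: "indexed_basis K (coord_space K d) d (vK i)" if "i \<in> {1..t}" for i
    using P[OF that] unfolding P_def by blast
  have lim: "moderate \<omega> \<Lambda> (\<lambda>n. vs i s n $ m) \<and> ulim \<omega> \<Lambda> (\<lambda>n. vs i s n $ m) = vK i s $ m"
    if "i \<in> {1..t}" "s \<in> {1..d}" "m < d" for i s m
    using P[OF that(1)] that(2,3) unfolding P_def by blast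
  have Fs: "Fs n i a = module.span class_ring ?R ((\<lambda>s. vs i s n) ` {1..a})" if "i \<in> {1..t}" "a \<le> d" for i n a
    using P[OF that(1)] that(2) unfolding P_def by blast
  have F: "F i a = module.span K (coord_space K d) (vK i ` {1..a})" if "i \<in> {1..t}" "a \<le> d" for i a
    using P[OF that(1)] that(2) unfolding P_def by blast
  \<comment> \<open>Time comes first, so that \<open>V n\<close> is a tuple of adapted bases at a
    fixed time.\<close>
  define V where "V n i s = vs i s n" for n i s
  have bas: "indexed_basis class_ring ?R d (V n i)" if "i \<in> {1..t}" for n i
    using vs[OF that, of n] unfolding V_def .
  have FV: "Fs n i a = module.span class_ring ?R (V n i ` {1..a})" if "i \<in> {1..t}" "a \<le> d" for n i a
    using Fs[OF that, of n] unfolding V_def .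
  have gf: "generic_flags d t (V n)" for n
    by (rule generic_flags_of_maximum_span[OF d _ bas FV]) (use assms(5)[of n] in \<open>simp add: positive_tuple_def\<close>)
  \<comment> \<open>The common sign and the orientations are found separately at each time, already
    rotated by the shift \<open>c\<close> of the separation, and then collected into
    sequences.\<close>
  have "\<exists>\<kappa> ori. generic_flags.admissible d \<kappa> ori \<and>
      (\<forall>i j k. {i, j, k} \<subseteq> {1..t} \<longrightarrow> cyclic_shift t c i < cyclic_shift t c j \<longrightarrow>
        cyclic_shift t c j < cyclic_shift t c k \<longrightarrow> generic_flags.tri d (V n) \<kappa> ori i j k)" for n
  proof -
    interpret generic_flags d t "V n" by (rule gf)
    have "positive_flags d t (V n) T"
      by (rule positive_ratio_products[OF assms(4) _ bas FV]) (use assms(5)[of n] in \<open>simp add: positive_tuple_def\<close>)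
    then interpret positive_flags d t "V n" T .
    obtain \<kappa> ori where "admissible \<kappa> ori" "polygon \<kappa> ori {1..t}" by (rule polygon_all[OF t])
    then obtain ori' where "admissible \<kappa> ori'"
      "\<And>i j k. {i, j, k} \<subseteq> {1..t} \<Longrightarrow> cyclic_shift t c i < cyclic_shift t c j \<Longrightarrow>
       cyclic_shift t c j < cyclic_shift t c k \<Longrightarrow> tri \<kappa> ori' i j k"
      by (rule polygon_rotate[where c = c]) blast
    then show ?thesis by blast
  qed
  then obtain \<kappa> ori where adm: "\<And>n. generic_flags.admissible d (\<kappa> n) (ori n)"
    and tri: "\<And>n i j k. {i, j, k} \<subseteq> {1..t} \<Longrightarrow> cyclic_shift t c i < cyclic_shift t c j \<Longrightarrow>
        cyclic_shift t c j < cyclic_shift t c k \<Longrightarrow> generic_flags.tri d (V n) (\<kappa> n) (ori n) i j k"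
    by metis
  interpret oriented_ulim_flags \<omega> \<Lambda> d t V F vK \<kappa> ori
  proof (intro oriented_ulim_flags.intro ulim_flags.intro ulim_flags_axioms.intro oriented_ulim_flags_axioms.intro)
    show "moderate \<omega> \<Lambda> (\<lambda>n. V n i s $ m) \<and> vK i s $ m = ulim \<omega> \<Lambda> (\<lambda>n. V n i s $ m)"
      if "i \<in> {1..t}" "s \<in> {1..d}" "m < d" for i s m
      using lim[OF that] unfolding V_def by simp
    show "maximum_span K d t F" using assms(7) by (simp add: ulim_positive_def)
  qed (rule asymp_scale_axioms gf vK F adm; assumption)+
  note nested = cone_nested[OF inj_cyclic_shift tri]
  have ne: "i1 \<noteq> j1" "i2 \<noteq> j2" "i3 \<noteq> j3" using le by auto
  have sub: "{i1, j1} \<subseteq> {1..t}" "{i2, j2} \<subseteq> {1..t}" "{i3, j3} \<subseteq> {1..t}" using ix by auto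
  have "cone d (\<epsilon> i1 j1) (\<epsilon> i2 j2)" "cone d (\<epsilon> i2 j2) (\<epsilon> i3 j3)"
    by (rule nested; (use ix le in auto))+
  then have "flag_apartment \<omega> \<Lambda> d (F i1) (F j1) \<inter> flag_apartment \<omega> \<Lambda> d (F i3) (F j3) \<subseteq>
      flag_apartment \<omega> \<Lambda> d (F i2) (F j2)"
    unfolding flag_apartment_def
    by (rule apartment_between[OF d basis_family_pair[OF sub(1) ne(1)] basis_family_pair[OF sub(2) ne(2)]
      basis_family_pair[OF sub(3) ne(3)]]) (rule span_pair_functional[OF sub(1) ne(1)]
      span_pair_functional[OF sub(2) ne(2)] span_pair_functional[OF sub(3) ne(3)]; assumption)+
  then show ?thesis by blast
qed

end
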